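(* Let $f\in L^2(ds)\cap L^1\left(\frac{ds}{1+\sqrt{s}}\right)$. Then $$f(\cdot+u)\in L^1\left(\frac{ds}{\sqrt{s}}\right)\quad\text{for a.e. } u\in[0,\infty),$$ and there exists a jointly measurable functional $(u,X)\mapsto I(f;u,X)$ on $[0,\infty)\times\Omega$ such that $$\int_0^\infty f(s)\,dX_s = I(f;g(X),X)\quad \mathscr{W}\text{-a.e.}$$ and such that, for a.e. $u\in[0,\infty)$, $$I(f;u,X)=\int_0^u f(s)\,dX_s+\int_0^\infty f(s+u)\,d(\theta_uX)_s\quad (\Pi^{(u)}\bullet R)\text{-a.e.},$$ where the first and the second terms on the right-hand side are the Wiener integrals for the Brownian bridge $(X_s:s\le u)$ and for the symmetrized 3-dimensional Bessel process $((\theta_uX)_s:s\ge0)$, respectively.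
   Context: Path space. $\Omega = C([0,\infty)\to\mathbb{R})$, $X=(X_s)_{s\ge 0}$ is the coordinate process, $\mathcal{F}_\infty=\sigma(X_s:s\ge 0)$. $g(X)=\sup\{s\ge0:X_s=0\}$ is the last exit time from $0$; $\theta_uX$ is the shifted path $(\theta_uX)_s=X_{u+s}$, $s\ge0$. Measures. $\Pi^{(u)}$ ($u>0$) is the law on $C([0,u]\to\mathbb{R})$ of the Brownian bridge from $0$ to $0$ of length $u$. $R^+$ is the law on $(\Omega,\mathcal{F}_\infty)$ of the 3-dimensional Bessel process starting from $0$, $R^-$ is the law of $(-X_t)$ under $R^+$, and $R=\frac{R^++R^-}{2}$ (law of the symmetrized 3-dimensional Bessel process). For $u>0$, $X^{(u)}=(X_t:0\le t\le u)$ and $Y=(Y_t:t\ge0)$, the concatenation $X^{(u)}\bullet Y$ is the path with $(X^{(u)}\bullet Y)_t = X_t$ if $0\le t<u$; $=Y_{t-u}$ if $t\ge u$ and $X_u=Y_0$; $=X_u$ if $t\ge u$ and $X_u\ne Y_0$. $\Pi^{(u)}\bullet R$ is the law on $(\Omega,\mathcal{F}_\infty)$ of $X^{(u)}\bullet Y$ under $\Pi^{(u)}(dX^{(u)})\otimes R(dY)$; thus under $\Pi^{(u)}\bullet R$, $(X_s:s\le u)$ has law $\Pi^{(u)}$ and $\theta_uX$ has law $R$. The $\sigma$-finite measure $\mathscr{W}$ on $(\Omega,\mathcal{F}_\infty)$ is $$\mathscr{W}=\int_0^\infty \frac{du}{\sqrt{2\pi u}}\,\left(\Pi^{(u)}\bullet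 R\right).$$ Functions. $L^2(ds)=L^2([0,\infty),ds)$ (real-valued functions), $L^1\left(\frac{ds}{1+\sqrt{s}}\right)=\{f:\int_0^\infty|f(s)|\frac{ds}{1+\sqrt{s}}<\infty\}$, $L^1\left(\frac{ds}{\sqrt{s}}\right)=\{f:\int_0^\infty|f(s)|\frac{ds}{\sqrt{s}}<\infty\}$. "a.e. $u$" refers to Lebesgue measure. A step function is $f=\sum_{k=1}^n c_k 1_{[t_{k-1},t_k)}$ with $c_k\in\mathbb{R}$, $0=t_0<t_1<\cdots<t_n<\infty$; for a process $Y$, $\int_0^\infty f(s)\,dY_s:=\sum_{k=1}^n c_k(Y_{t_k}-Y_{t_{k-1}})$, and $\int_0^uf(s)\,dY_s$ is the integral of $1_{[0,u)}f$. Wiener integrals. (1) Under $\mathscr{W}$: for $f\in L^2(ds)\cap L^1\left(\frac{ds}{1+\sqrt{s}}\right)$, $\int_0^\infty f(s)\,dX_s$ is the ($\mathscr{W}$-a.e. unique, independent of the sequence) limit of $\int_0^\infty f_n(s)\,dX_s$ locally in $\mathscr{W}$-measure for step functions $f_n\to f$ in both $L^2(ds)$ and $L^1\left(\frac{ds}{1+\sqrt{s}}\right)$; here $Z_n\to Z$ locally in $\mathscr{W}$-measure means $\mathscr{W}(A\cap\{|Z_n-Z|\ge\varepsilon\})\to0$ for all $\varepsilon>0$ and all $A\in\mathcal{F}_\infty$ with $\mathscr{W}(A)<\infty$. (2) Brownian bridge: for $f\in L^2([0,u],ds)$, $\int_0^uf(s)\,dX_s$ is the $L^2(\Pi^{(u)})$-limit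 of $\int_0^uf_n(s)\,dX_s$ for step functions $f_n\to f$ in $L^2([0,u],ds)$. (3) Symmetrized 3-dimensional Bessel process: for $f\in L^2(ds)\cap L^1\left(\frac{ds}{\sqrt{s}}\right)$, $\int_0^\infty f(s)\,dX_s$ is the limit in $R$-probability of $\int_0^\infty f_n(s)\,dX_s$ for step functions $f_n\to f$ in both $L^2(ds)$ and $L^1\left(\frac{ds}{\sqrt{s}}\right)$. The limits in (2) and (3) exist and do not depend on the approximating sequence. *)

theory Defs
  imports "HOL-Probability.Probability"
begin

subsection \<open>Path spaces\<close>

text \<open>Paths indexed by \<open>I\<close> are functions that are \<open>undefined\<close> outside \<open>I\<close>
  (as in \<open>PiM\<close>), so that two paths are equal iff they agree on \<open>I\<close>. Restricting the
  product sigma-algebra to the continuous functions gives the sigma-algebra generated by the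
  coordinate process. \<open>path_space {0..}\<close> is \<open>(\<Omega>, F_\<infinity>)\<close>.\<close>

definition path_space :: "real set \<Rightarrow> (real \<Rightarrow> 'b::euclidean_space) measure" where
  "path_space I = restrict_space (\<Pi>\<^sub>M s\<in>I. borel) {x. continuous_on I x}"

definition shift_path :: "real \<Rightarrow> (real \<Rightarrow> real) \<Rightarrow> real \<Rightarrow> real" where
  "shift_path u X = (\<lambda>s\<in>{0..}. X (u + s))"

definition concat_path :: "real \<Rightarrow> (real \<Rightarrow> real) \<Rightarrow> (real \<Rightarrow> real) \<Rightarrow> real \<Rightarrow> real" where
  "concat_path u X Y = (\<lambda>t\<in>{0..}.
     if t < u then X t else if X u = Y 0 then Y (t - u) else X u)"

text \<open>For paths with no zero, or with an unbounded set of zeros, the real-valued supremum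
  carries no information. These paths are null for the measure
  \<open>scrW\<close> below.\<close>

definition last_zero :: "(real \<Rightarrow> real) \<Rightarrow> real" where
  "last_zero X = Sup {s. 0 \<le> s \<and> X s = 0}"

subsection \<open>Measures\<close>

text \<open>\<open>W\<close> is the law of standard Brownian motion in \<open>'b\<close> started at \<open>0\<close>. The density in the
  last conjunct is that of the centred normal distribution with covariance \<open>(t - s)\<close> times the
  identity.\<close>

definition wiener_law :: "(real \<Rightarrow> 'b::euclidean_space) measure \<Rightarrow> bool" where
  "wiener_law W \<longleftrightarrow>
     prob_space W \<and> sets W = sets (path_space {0..}) \<and>
     (AE X in W. X 0 = 0) \<and>
     (\<forall>n (t :: nat \<Rightarrow> real). (\<forall>k<n. 0 \<le> t k \<and> t k \<le> t (Suc k)) \<longrightarrow>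
        prob_space.indep_vars W (\<lambda>_. borel) (\<lambda>k X. X (t (Suc k)) - X (t k)) {..<n}) \<and>
     (\<forall>s t. 0 \<le> s \<and> s < t \<longrightarrow>
        distributed W lborel (\<lambda>X. X t - X s)
          (\<lambda>x. ennreal (\<Prod>b\<in>Basis. normal_density 0 (sqrt (t - s)) (x \<bullet> b))))"

text \<open>The laws below are image measures of Wiener measure: the bridge is
  \<open>B_s - (s/u) B_u\<close>, \<open>0 \<le> s \<le> u\<close>, for a linear Brownian motion \<open>B\<close>, and the 3-dimensional
  Bessel process is the Euclidean norm of a Brownian motion in \<open>\<real>^3\<close>.\<close>

definition brownian_bridge :: "(real \<Rightarrow> real) measure \<Rightarrow> real \<Rightarrow> (real \<Rightarrow> real) measure" where
  "brownian_bridge W u =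
     distr W (path_space {0..u}) (\<lambda>X. \<lambda>s\<in>{0..u}. X s - s / u * X u)"

definition bessel3 :: "(real \<Rightarrow> real ^ 3) measure \<Rightarrow> (real \<Rightarrow> real) measure" where
  "bessel3 W = distr W (path_space {0..}) (\<lambda>X. \<lambda>t\<in>{0..}. norm (X t))"

definition bessel3_minus :: "(real \<Rightarrow> real ^ 3) measure \<Rightarrow> (real \<Rightarrow> real) measure" where
  "bessel3_minus W = distr (bessel3 W) (path_space {0..}) (\<lambda>X. \<lambda>t\<in>{0..}. - X t)"

definition sym_bessel3 :: "(real \<Rightarrow> real ^ 3) measure \<Rightarrow> (real \<Rightarrow> real) measure" where
  "sym_bessel3 W = measure_of (space (path_space {0..})) (sets (path_space {0..}))
     (\<lambda>A. (emeasure (bessel3 W) A + emeasure (bessel3_minus W) A) / 2)"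

definition concat_law ::
  "real \<Rightarrow> (real \<Rightarrow> real) measure \<Rightarrow> (real \<Rightarrow> real) measure \<Rightarrow> (real \<Rightarrow> real) measure" where
  "concat_law u P Q = distr (P \<Otimes>\<^sub>M Q) (path_space {0..}) (\<lambda>(X, Y). concat_path u X Y)"

text \<open>The integral of the kernel \<open>u \<mapsto> \<Pi>^(u) \<bullet> R\<close> against \<open>du / sqrt (2 \<pi> u)\<close> on \<open>(0, \<infinity>)\<close> is
  the monadic bind of measures, see \<open>emeasure_bind\<close>.\<close>

definition scrW ::
  "(real \<Rightarrow> real) measure \<Rightarrow> (real \<Rightarrow> real ^ 3) measure \<Rightarrow> (real \<Rightarrow> real) measure" where
  "scrW W1 W3 =
     bind (density (restrict_space lborel {0<..}) (\<lambda>u. ennreal (1 / sqrt (2 * pi * u))))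
       (\<lambda>u. concat_law u (brownian_bridge W1 u) (sym_bessel3 W3))"

subsection \<open>Function spaces\<close>

definition L2 :: "real set \<Rightarrow> (real \<Rightarrow> real) set" where
  "L2 A = {f. set_borel_measurable lebesgue A f \<and>
     (\<integral>\<^sup>+s\<in>A. ennreal ((f s)\<^sup>2) \<partial>lebesgue) < \<infinity>}"

definition L1_weighted :: "(real \<Rightarrow> real) \<Rightarrow> (real \<Rightarrow> real) set" where
  "L1_weighted w = {f. set_borel_measurable lebesgue {0..} f \<and>
     (\<integral>\<^sup>+s\<in>{0..}. ennreal (\<bar>f s\<bar> * w s) \<partial>lebesgue) < \<infinity>}"

definition L2_tendsto :: "real set \<Rightarrow> (nat \<Rightarrow> real \<Rightarrow> real) \<Rightarrow> (real \<Rightarrow> real) \<Rightarrow> bool" where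
  "L2_tendsto A F f \<longleftrightarrow>
     (\<lambda>n. \<integral>\<^sup>+s\<in>A. ennreal ((F n s - f s)\<^sup>2) \<partial>lebesgue) \<longlonglongrightarrow> 0"

definition L1_weighted_tendsto ::
  "(real \<Rightarrow> real) \<Rightarrow> (nat \<Rightarrow> real \<Rightarrow> real) \<Rightarrow> (real \<Rightarrow> real) \<Rightarrow> bool" where
  "L1_weighted_tendsto w F f \<longleftrightarrow>
     (\<lambda>n. \<integral>\<^sup>+s\<in>{0..}. ennreal (\<bar>F n s - f s\<bar> * w s) \<partial>lebesgue) \<longlonglongrightarrow> 0"

subsection \<open>Step functions\<close>

text \<open>A step function is given by data \<open>(n, t, c)\<close>, where \<open>c k\<close> is its value on
  \<open>{t k..<t (Suc k)}\<close> for \<open>k < n\<close>. Different data may describe the same function; they then give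
  the same integral.\<close>

type_synonym step_data = "nat \<times> (nat \<Rightarrow> real) \<times> (nat \<Rightarrow> real)"

definition is_step :: "step_data \<Rightarrow> bool" where
  "is_step = (\<lambda>(n, t, c). t 0 = 0 \<and> (\<forall>k<n. t k < t (Suc k)))"

definition step_fun :: "step_data \<Rightarrow> real \<Rightarrow> real" where
  "step_fun = (\<lambda>(n, t, c) s. \<Sum>k<n. c k * indicator {t k..<t (Suc k)} s)"

definition step_integral :: "step_data \<Rightarrow> (real \<Rightarrow> real) \<Rightarrow> real" where
  "step_integral = (\<lambda>(n, t, c) Y. \<Sum>k<n. c k * (Y (t (Suc k)) - Y (t k)))"

text \<open>The integral of \<open>indicator {0..<u} * f\<close>: each interval \<open>[t k, t (Suc k))\<close> is
  cut off at \<open>u\<close>, which amounts to stopping the path at \<open>u\<close>.\<close>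

definition step_integral_upto :: "real \<Rightarrow> step_data \<Rightarrow> (real \<Rightarrow> real) \<Rightarrow> real" where
  "step_integral_upto u \<phi> Y = step_integral \<phi> (\<lambda>s. Y (min s u))"

subsection \<open>Wiener integrals\<close>

definition tendsto_locally_in_measure ::
  "'a measure \<Rightarrow> (nat \<Rightarrow> 'a \<Rightarrow> real) \<Rightarrow> ('a \<Rightarrow> real) \<Rightarrow> bool" where
  "tendsto_locally_in_measure M F Z \<longleftrightarrow>
     (\<forall>\<epsilon>>0. \<forall>A\<in>sets M. emeasure M A < \<infinity> \<longrightarrow>
        (\<lambda>n. emeasure M (A \<inter> {x \<in> space M. \<epsilon> \<le> \<bar>F n x - Z x\<bar>})) \<longlonglongrightarrow> 0)"

definition tendsto_in_probability ::
  "'a measure \<Rightarrow> (nat \<Rightarrow> 'a \<Rightarrow> real) \<Rightarrow> ('a \<Rightarrow> real) \<Rightarrow> bool" where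
  "tendsto_in_probability M F Z \<longleftrightarrow>
     (\<forall>\<epsilon>>0. (\<lambda>n. emeasure M {x \<in> space M. \<epsilon> \<le> \<bar>F n x - Z x\<bar>}) \<longlonglongrightarrow> 0)"

text \<open>The Wiener integrals are defined up to null sets; \<open>SOME\<close> picks a
  measurable version of the common limit along all approximating sequences.\<close>

definition wiener_integral_scrW ::
  "(real \<Rightarrow> real) measure \<Rightarrow> (real \<Rightarrow> real) \<Rightarrow> (real \<Rightarrow> real) \<Rightarrow> real" where
  "wiener_integral_scrW M f = (SOME Z. Z \<in> borel_measurable M \<and>
     (\<forall>\<phi>. (\<forall>n. is_step (\<phi> n)) \<and>
          L2_tendsto {0..} (\<lambda>n. step_fun (\<phi> n)) f \<and>
          L1_weighted_tendsto (\<lambda>s. 1 / (1 + sqrt s)) (\<lambda>n. step_fun (\<phi> n)) f \<longrightarrow>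
        tendsto_locally_in_measure M (\<lambda>n. step_integral (\<phi> n)) Z))"

definition wiener_integral_bridge ::
  "(real \<Rightarrow> real) measure \<Rightarrow> real \<Rightarrow> (real \<Rightarrow> real) \<Rightarrow> (real \<Rightarrow> real) \<Rightarrow> real" where
  "wiener_integral_bridge P u f = (SOME Z. Z \<in> borel_measurable P \<and>
     (\<forall>\<phi>. (\<forall>n. is_step (\<phi> n)) \<and> L2_tendsto {0..u} (\<lambda>n. step_fun (\<phi> n)) f \<longrightarrow>
        (\<lambda>n. \<integral>\<^sup>+X. ennreal ((step_integral_upto u (\<phi> n) X - Z X)\<^sup>2) \<partial>P) \<longlonglongrightarrow> 0))"

definition wiener_integral_bessel ::
  "(real \<Rightarrow> real) measure \<Rightarrow> (real \<Rightarrow> real) \<Rightarrow> (real \<Rightarrow> real) \<Rightarrow> real" where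
  "wiener_integral_bessel R f = (SOME Z. Z \<in> borel_measurable R \<and>
     (\<forall>\<phi>. (\<forall>n. is_step (\<phi> n)) \<and>
          L2_tendsto {0..} (\<lambda>n. step_fun (\<phi> n)) f \<and>
          L1_weighted_tendsto (\<lambda>s. 1 / sqrt s) (\<lambda>n. step_fun (\<phi> n)) f \<longrightarrow>
        tendsto_in_probability R (\<lambda>n. step_integral (\<phi> n)) Z))"

end

theory Submission
  imports Defs
begin

text \<open>Let \<open>K u\<close> be the law of the bridge of length \<open>u\<close> followed by the symmetrized Bessel
  process. For a step function \<open>f\<close> the integral of \<open>f\<close> along a path is the sum of the integral
  up to \<open>u\<close> and of that of \<open>f(\<cdot> + u)\<close> along the shifted path. The first term has second moment
  at most \<open>4 \<parallel>f\<parallel>\<^sup>2\<close> in \<open>L\<^sup>2\<close>. For the second term write the Bessel process as \<open>|B|\<close> with \<open>B\<close> a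
  three-dimensional Brownian motion, and split each increment of \<open>|B|\<close> into its conditional
  expectation given the past and a martingale difference. The martingale differences are orthogonal,
  which bounds their sum in \<open>L\<^sup>2\<close>; the conditional expectations are nonnegative by convexity of the
  norm, so that the expectation of their weighted sum telescopes to a multiple of
  \<open>\<Sum> |c k| (sqrt (t (k + 1)) - sqrt (t k))\<close>, which is at most \<open>\<integral> |f s| ds / sqrt s\<close>. No stochastic
  calculus is needed.

  By Fubini the norm of \<open>f(\<cdot> + u)\<close> in \<open>L\<^sup>1(ds / sqrt s)\<close> is integrable in \<open>u\<close> against
  \<open>(1 + u) powr (-3/2)\<close>, with integral at most \<open>3 \<integral> |f s| ds / (1 + sqrt s)\<close>. Hence along a sequence of
  step functions that converges fast enough to \<open>f\<close>, for almost every \<open>u\<close> the integrals converge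
  \<open>K u\<close>-almost everywhere to the sum of the two Wiener integrals. Let \<open>Z\<close> be this limit; it is a
  functional of the path alone and does not involve \<open>u\<close>. It is also the limit locally in
  \<open>scrW\<close>-measure along every approximating sequence, and since \<open>scrW\<close> is sigma-finite such limits
  are unique, so \<open>Z\<close> is the Wiener integral under \<open>scrW\<close>. Therefore \<open>I u X = Z X\<close> has all the
  required properties.\<close>

subsection \<open>Step functions\<close>

text \<open>The density of \<open>scrW\<close> cannot serve as the weight in the Fubini argument:
  the integral of \<open>1 / (sqrt u * sqrt (s - u))\<close> over \<open>0 < u < s\<close> equals pi
  for every s, so it would require f to be in L^1(ds), which is not given. A weight with faster
  decay at infinity restores the factor \<open>1 / (1 + sqrt s)\<close>. The price is that
  convergence under \<open>scrW\<close> comes only on sets A of finite measure, where the masses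
  \<open>emeasure (K u) A\<close> are integrable against the density and act as a dominating
  function. The Wiener integrals are picked by \<open>SOME\<close>, so nothing is known about them
  before a limit valid along all approximating sequences has been exhibited. The estimates therefore
  compare the integral of one arbitrary step function with the limit along one fixed fast sequence.
  Since the bridge and martingale parts are controlled in L^2 but the drift only in L^1, all bounds
  are cast as tail estimates with the common factor \<open>1 + 1 / \<epsilon>\<^sup>2\<close>.
  Events about the symmetrized process that are invariant under a change of sign are evaluated
  through |B| alone.\<close>

lemma step_fun_eq_step_integral:
  assumes "is_step \<phi>"
  shows "step_fun \<phi> s = step_integral \<phi> (\<lambda>t. - indicator {..s} t)"
proof -
  obtain n t c where \<phi>: "\<phi> = (n, t, c)" by (cases \<phi>)
  \<comment> \<open>Evaluation at \<open>s\<close> is integration against a jump path. Hence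
    identities of step integrals that hold for all \<open>Y\<close>, continuous or not, carry over
    to step functions.\<close>
  have "indicator {t k..<t (Suc k)} s = - indicator {..s} (t (Suc k)) - (- indicator {..s} (t k) :: real)"
    if "k < n" for k
    using assms that by (auto simp: \<phi> is_step_def indicator_def not_less split: if_splits)
  then show ?thesis
    unfolding \<phi> step_fun_def step_integral_def prod.case by (intro sum.cong) simp_all
qed

text \<open>Common refinement: the breakpoints are all end points, and the coefficient on a cell is
  the sum of the \<open>c k\<close> over the intervals containing it. Intervals may overlap and may
  be empty; \<open>step_shift\<close> needs the latter.\<close>

lemma ex_step_sum:
  fixes a b c :: "'i \<Rightarrow> real"
  assumes "finite A" and ab: "\<And>k. k \<in> A \<Longrightarrow> 0 \<le> a k \<and> a k \<le> b k"
  shows "\<exists>\<psi>. is_step \<psi> \<and>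
    (\<forall>Y. step_integral \<psi> Y = (\<Sum>k\<in>A. c k * (Y (b k) - Y (a k))))"
proof -
  \<comment> \<open>The point 0 is added because \<open>is_step\<close> demands that the partition
    start there, whether or not an interval does.\<close>
  define S where "S = insert 0 (a ` A \<union> b ` A)"
  define p where "p = sorted_list_of_set S"
  have S: "finite S" using assms by (simp add: S_def)
  have p: "set p = S" "sorted p" "distinct p" using S by (simp_all add: p_def)
  have ne: "p \<noteq> []" using p(1) by (auto simp: S_def)
  define N where "N = length p - 1"
  have len: "length p = Suc N" using ne by (simp add: N_def)
  have less: "p ! i < p ! j" if "i < j" "j \<le> N" for i j
    using sorted_wrt_nth_less[of "(<)" p i j] p(2,3) that len by (simp add: strict_sorted_iff)
  have p0: "p ! 0 = 0"
  proof -
    have nn: "0 \<le> s" if "s \<in> S" for s using ab that by (force simp: S_def)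
    have "0 \<in> set p" by (simp add: p(1) S_def)
    then obtain i where i: "i < length p" "p ! i = 0" by (auto simp: in_set_conv_nth)
    have "p ! 0 \<le> p ! i" using p(2) i(1) by (simp add: sorted_nth_mono)
    moreover have "p ! 0 \<in> set p" by (rule nth_mem) (simp add: len)
    ultimately show ?thesis using nn i p(1) by fastforce
  qed
  \<comment> \<open>The end points of every interval are grid points, so the left end
    \<open>p ! m\<close> decides whether a whole cell lies in it.\<close>
  define d where "d m = (\<Sum>k\<in>A. c k * indicator {a k..<b k} (p ! m))" for m
  have tel: "(\<Sum>m<N. indicator {a k..<b k} (p ! m) * (Y (p ! Suc m) - Y (p ! m))) = Y (b k) - Y (a k)"
    if k: "k \<in> A" for k and Y :: "real \<Rightarrow> real"
  proof -
    have "a k \<in> set p" "b k \<in> set p" using k p(1) by (auto simp: S_def)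
    then obtain i j where ij: "i \<le> N" "p ! i = a k" "j \<le> N" "p ! j = b k"
      by (auto simp: in_set_conv_nth len less_Suc_eq_le)
    have le: "p ! x \<le> p ! y \<longleftrightarrow> x \<le> y" if "x \<le> N" "y \<le> N" for x y
      using less[of x y] less[of y x] that by (cases x y rule: linorder_cases) auto
    have "i \<le> j" using ab[OF k] ij le[of i j] by simp
    have "(\<Sum>m<N. indicator {a k..<b k} (p ! m) * (Y (p ! Suc m) - Y (p ! m)))
       = (\<Sum>m<N. if m \<in> {i..<j} then Y (p ! Suc m) - Y (p ! m) else 0)"
    proof (rule sum.cong[OF refl])
      fix m assume "m \<in> {..<N}"
      then have "p ! m \<in> {a k..<b k} \<longleftrightarrow> m \<in> {i..<j}"
        using le[of i m] le[of j m] ij by auto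
      then show "indicator {a k..<b k} (p ! m) * (Y (p ! Suc m) - Y (p ! m)) =
         (if m \<in> {i..<j} then Y (p ! Suc m) - Y (p ! m) else 0)" by (simp add: indicator_def)
    qed
    also have "\<dots> = (\<Sum>m\<in>{..<N} \<inter> {i..<j}. Y (p ! Suc m) - Y (p ! m))"
      by (simp add: sum.inter_restrict)
    also have "{..<N} \<inter> {i..<j} = {i..<j}" using ij by auto
    also have "(\<Sum>m\<in>{i..<j}. Y (p ! Suc m) - Y (p ! m)) = Y (p ! j) - Y (p ! i)"
      using sum_Suc_diff'[of i j "\<lambda>m. Y (p ! m)"] \<open>i \<le> j\<close> by simp
    finally show ?thesis using ij by simp
  qed
  have "is_step (N, (!) p, d)"
    using less p0 by (auto simp: is_step_def)
  moreover have "step_integral (N, (!) p, d) Y = (\<Sum>k\<in>A. c k * (Y (b k) - Y (a k)))" for Y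
  proof -
    have "step_integral (N, (!) p, d) Y = (\<Sum>m<N. \<Sum>k\<in>A. c k * (indicator {a k..<b k} (p ! m) * (Y (p ! Suc m) - Y (p ! m))))"
      by (simp add: step_integral_def d_def sum_distrib_right mult.assoc)
    also have "\<dots> = (\<Sum>k\<in>A. c k * (\<Sum>m<N. indicator {a k..<b k} (p ! m) * (Y (p ! Suc m) - Y (p ! m))))"
      by (subst sum.swap) (simp only: sum_distrib_left)
    finally show ?thesis by (simp only: tel cong: sum.cong)
  qed
  ultimately show ?thesis by blast
qed

lemma is_step_mono:
  assumes "is_step (n, t, c)" "i \<le> j" "j \<le> n"
  shows "t i \<le> t j"
  using assms(2,3)
proof (induction rule: dec_induct)
  case (step m)
  then have "t m < t (Suc m)" using assms(1) by (simp add: is_step_def)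
  with step show ?case by simp
qed simp

lemma is_step_nonneg: "is_step (n, t, c) \<Longrightarrow> k \<le> n \<Longrightarrow> 0 \<le> t k"
  using is_step_mono[of n t c 0 k] by (simp add: is_step_def)

text \<open>\<open>ex_step_sum\<close> on the disjoint union of both index sets, with the second
  coefficients negated.\<close>

lemma ex_step_diff:
  assumes "is_step \<phi>" "is_step \<psi>"
  shows "\<exists>\<rho>. is_step \<rho> \<and> (\<forall>Y. step_integral \<rho> Y = step_integral \<phi> Y - step_integral \<psi> Y)"
proof -
  obtain n t c where \<phi>: "\<phi> = (n, t, c)" by (cases \<phi>)
  obtain m s d where \<psi>: "\<psi> = (m, s, d)" by (cases \<psi>)
  have "\<exists>\<rho>. is_step \<rho> \<and> (\<forall>Y. step_integral \<rho> Y =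
    (\<Sum>k\<in>{..<n} <+> {..<m}. case_sum c (\<lambda>k. - d k) k * (Y (case_sum (\<lambda>k. t (Suc k)) (\<lambda>k. s (Suc k)) k) - Y (case_sum t s k))))"
    by (rule ex_step_sum)
      (use assms in \<open>auto simp: \<phi> \<psi> is_step_nonneg intro!: is_step_mono[of n t c] is_step_mono[of m s d]\<close>)
  then show ?thesis
    by (simp add: sum.Plus \<phi> \<psi> step_integral_def sum_negf)
qed

text \<open>Only the integral is prescribed: the truncated integral and the step function are
  themselves step integrals, against a stopped path and a jump path, so they follow.\<close>

definition step_diff :: "step_data \<Rightarrow> step_data \<Rightarrow> step_data" where
  "step_diff \<phi> \<psi> = (SOME \<rho>. is_step \<rho> \<and>
     (\<forall>Y. step_integral \<rho> Y = step_integral \<phi> Y - step_integral \<psi> Y))"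

lemma step_diff:
  assumes "is_step \<phi>" "is_step \<psi>"
  shows is_step_diff: "is_step (step_diff \<phi> \<psi>)"
    and step_integral_diff: "step_integral (step_diff \<phi> \<psi>) Y = step_integral \<phi> Y - step_integral \<psi> Y"
    and step_integral_upto_diff:
      "step_integral_upto u (step_diff \<phi> \<psi>) Y = step_integral_upto u \<phi> Y - step_integral_upto u \<psi> Y"
    and step_fun_diff: "step_fun (step_diff \<phi> \<psi>) s = step_fun \<phi> s - step_fun \<psi> s"
proof -
  have *: "is_step (step_diff \<phi> \<psi>) \<and>
     (\<forall>Y. step_integral (step_diff \<phi> \<psi>) Y = step_integral \<phi> Y - step_integral \<psi> Y)"
    unfolding step_diff_def by (rule someI_ex) (rule ex_step_diff[OF assms])
  show "is_step (step_diff \<phi> \<psi>)"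
    "step_integral (step_diff \<phi> \<psi>) Y = step_integral \<phi> Y - step_integral \<psi> Y"
    "step_integral_upto u (step_diff \<phi> \<psi>) Y = step_integral_upto u \<phi> Y - step_integral_upto u \<psi> Y"
    "step_fun (step_diff \<phi> \<psi>) s = step_fun \<phi> s - step_fun \<psi> s"
    using * assms by (simp_all add: step_integral_upto_def step_fun_eq_step_integral)
qed

text \<open>Data for f(. + u) on [0, infinity): breakpoints move by \<open>u\<close> and are clipped
  at 0, so intervals to the left of \<open>u\<close> become empty and contribute nothing.\<close>

definition step_shift :: "real \<Rightarrow> step_data \<Rightarrow> step_data" where
  "step_shift u = (\<lambda>(n, t, c). SOME \<rho>. is_step \<rho> \<and>
     (\<forall>Y. step_integral \<rho> Y = (\<Sum>k<n. c k * (Y (max 0 (t (Suc k) - u)) - Y (max 0 (t k - u))))))"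

lemma step_shift:
  assumes "is_step (n, t, c)"
  shows "is_step (step_shift u (n, t, c)) \<and> (\<forall>Y. step_integral (step_shift u (n, t, c)) Y =
    (\<Sum>k<n. c k * (Y (max 0 (t (Suc k) - u)) - Y (max 0 (t k - u)))))"
proof -
  have "\<exists>\<rho>. is_step \<rho> \<and>
     (\<forall>Y. step_integral \<rho> Y = (\<Sum>k\<in>{..<n}. c k * (Y (max 0 (t (Suc k) - u)) - Y (max 0 (t k - u)))))"
    by (rule ex_step_sum)
      (simp, intro conjI max.mono diff_right_mono max.cobounded1 order_refl is_step_mono[OF assms], auto)
  from someI_ex[OF this] show ?thesis by (simp add: step_shift_def)
qed

lemma is_step_shift: "is_step \<phi> \<Longrightarrow> is_step (step_shift u \<phi>)"
  using step_shift by (cases \<phi>) simp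

lemma step_fun_shift:
  assumes "is_step \<phi>" "0 \<le> s"
  shows "step_fun (step_shift u \<phi>) s = step_fun \<phi> (s + u)"
proof -
  obtain n t c where \<phi>: "\<phi> = (n, t, c)" by (cases \<phi>)
  have "indicator {..s} (max 0 (x - u)) = (indicator {..s + u} x :: real)" for x
    using assms(2) by (auto simp: indicator_def)
  then show ?thesis
    using assms step_shift[of n t c u] is_step_shift[of \<phi> u]
    by (simp add: step_fun_eq_step_integral \<phi> step_integral_def)
qed

lemma step_integral_split:
  assumes "is_step \<phi>" "0 \<le> u"
  shows "step_integral \<phi> X =
    step_integral_upto u \<phi> X + step_integral (step_shift u \<phi>) (shift_path u X)"
proof -
  obtain n t c where \<phi>: "\<phi> = (n, t, c)" by (cases \<phi>)
  \<comment> \<open>The path is the piece stopped at \<open>u\<close> plus the piece restarted at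
    \<open>u\<close>; the constant \<open>X u\<close> counted twice cancels in increments.\<close>
  have sp: "X b = X (min b u) + shift_path u X (max 0 (b - u)) - X u" for b
    using assms(2) by (cases "b \<le> u") (simp_all add: shift_path_def)
  have "c k * (X b - X a) = c k * (X (min b u) - X (min a u)) +
      c k * (shift_path u X (max 0 (b - u)) - shift_path u X (max 0 (a - u)))" for a b k
    unfolding distrib_left[symmetric] by (subst (1) sp[of a], subst (1) sp[of b]) simp
  then have "step_integral \<phi> X = (\<Sum>k<n. c k * (X (min (t (Suc k)) u) - X (min (t k) u)) +
      c k * (shift_path u X (max 0 (t (Suc k) - u)) - shift_path u X (max 0 (t k - u))))"
    unfolding \<phi> step_integral_def prod.case by (intro sum.cong refl)
  then show ?thesis
    using assms step_shift[of n t c u]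
    by (simp add: step_integral_upto_def step_integral_def \<phi> sum.distrib)
qed

lemma step_fun_measurable [measurable]: "step_fun \<phi> \<in> borel_measurable borel"
  unfolding step_fun_def by (cases \<phi>) (simp only: prod.case, measurable)

subsection \<open>Convergence in measure\<close>

lemma convergent_if_geometric:
  fixes X :: "nat \<Rightarrow> real"
  assumes "\<forall>\<^sub>F n in sequentially. \<bar>X (Suc n) - X n\<bar> < (1/2) ^ n"
  shows "convergent X"
proof -
  have "summable (\<lambda>n. X (Suc n) - X n)"
    by (rule summable_comparison_test_ev[where g = "\<lambda>n. (1/2) ^ n"])
      (use assms in \<open>auto elim: eventually_mono intro: summable_geometric\<close>)
  then have "convergent (\<lambda>m. \<Sum>n<m. X (Suc n) - X n)"
    by (simp add: summable_iff_convergent)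
  then have "convergent (\<lambda>m. (X m - X 0) + X 0)"
    by (intro convergent_add convergent_const) (simp only: sum_lessThan_telescope)
  then show ?thesis by simp
qed

lemma (in finite_measure) AE_tendsto_imp_measure:
  fixes F :: "nat \<Rightarrow> 'a \<Rightarrow> real"
  assumes [measurable]: "\<And>n. F n \<in> borel_measurable M" "Z \<in> borel_measurable M"
    and ae: "AE x in M. (\<lambda>n. F n x) \<longlonglongrightarrow> Z x" and "0 < \<epsilon>"
  shows "(\<lambda>n. emeasure M {x \<in> space M. \<epsilon> \<le> \<bar>F n x - Z x\<bar>}) \<longlonglongrightarrow> 0"
proof -
  have "(\<lambda>n. \<integral>\<^sup>+x. indicator {x \<in> space M. \<epsilon> \<le> \<bar>F n x - Z x\<bar>} x \<partial>M) \<longlonglongrightarrow> (\<integral>\<^sup>+x. 0 \<partial>M)"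
  proof (rule nn_integral_dominated_convergence[where w = "\<lambda>_. 1"])
    show "AE x in M. (\<lambda>n. indicator {x \<in> space M. \<epsilon> \<le> \<bar>F n x - Z x\<bar>} x :: ennreal) \<longlonglongrightarrow> 0"
      using ae
    proof eventually_elim
      case (elim x)
      from tendstoD[OF elim \<open>0 < \<epsilon>\<close>]
      have "\<forall>\<^sub>F n in sequentially. indicator {x \<in> space M. \<epsilon> \<le> \<bar>F n x - Z x\<bar>} x = (0::ennreal)"
        by eventually_elim (auto simp: dist_real_def)
      then show ?case by (rule tendsto_eventually)
    qed
  qed (auto simp: indicator_def less_top[symmetric])
  then show ?thesis by simp
qed

text \<open>Uniqueness of limits in measure, localized to a set \<open>A\<close> so as to serve
  twice: with the whole space for probability laws, and with the covering sets
  \<open>cover m\<close> for \<open>scrW\<close>.\<close>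

lemma AE_eq_of_tendsto_in_measure:
  fixes F :: "nat \<Rightarrow> 'a \<Rightarrow> real"
  assumes [measurable]: "\<And>n. F n \<in> borel_measurable M" "Z \<in> borel_measurable M"
      "Z' \<in> borel_measurable M" "A \<in> sets M"
    and Z: "\<And>\<epsilon>. 0 < \<epsilon> \<Longrightarrow> (\<lambda>n. emeasure M (A \<inter> {x \<in> space M. \<epsilon> \<le> \<bar>F n x - Z x\<bar>})) \<longlonglongrightarrow> 0"
    and Z': "\<And>\<epsilon>. 0 < \<epsilon> \<Longrightarrow> (\<lambda>n. emeasure M (A \<inter> {x \<in> space M. \<epsilon> \<le> \<bar>F n x - Z' x\<bar>})) \<longlonglongrightarrow> 0"
  shows "AE x in M. x \<in> A \<longrightarrow> Z x = Z' x"
proof -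
  \<comment> \<open>The factor 2 leaves a margin \<open>inverse (real (Suc k))\<close> for each of
    the two distances to \<open>F n\<close>.\<close>
  define B where "B k = A \<inter> {x \<in> space M. 2 * inverse (real (Suc k)) \<le> \<bar>Z x - Z' x\<bar>}" for k
  have [measurable]: "B k \<in> sets M" for k by (simp add: B_def)
  have "emeasure M (B k) = 0" for k
  proof -
    define \<epsilon> where "\<epsilon> = inverse (real (Suc k))"
    have "0 < \<epsilon>" by (simp add: \<epsilon>_def)
    have "emeasure M (B k) \<le> emeasure M (A \<inter> {x \<in> space M. \<epsilon> \<le> \<bar>F n x - Z x\<bar>})
        + emeasure M (A \<inter> {x \<in> space M. \<epsilon> \<le> \<bar>F n x - Z' x\<bar>})" for n
    proof -
      have "B k \<subseteq> (A \<inter> {x \<in> space M. \<epsilon> \<le> \<bar>F n x - Z x\<bar>}) \<union> (A \<inter> {x \<in> space M. \<epsilon> \<le> \<bar>F n x - Z' x\<bar>})"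
        by (auto simp: B_def \<epsilon>_def)
      then have "emeasure M (B k) \<le> emeasure M ((A \<inter> {x \<in> space M. \<epsilon> \<le> \<bar>F n x - Z x\<bar>}) \<union> (A \<inter> {x \<in> space M. \<epsilon> \<le> \<bar>F n x - Z' x\<bar>}))"
        by (rule emeasure_mono) measurable
      also have "\<dots> \<le> emeasure M (A \<inter> {x \<in> space M. \<epsilon> \<le> \<bar>F n x - Z x\<bar>})
        + emeasure M (A \<inter> {x \<in> space M. \<epsilon> \<le> \<bar>F n x - Z' x\<bar>})"
        by (rule emeasure_subadditive) measurable
      finally show ?thesis .
    qed
    moreover have "(\<lambda>n. emeasure M (A \<inter> {x \<in> space M. \<epsilon> \<le> \<bar>F n x - Z x\<bar>})
        + emeasure M (A \<inter> {x \<in> space M. \<epsilon> \<le> \<bar>F n x - Z' x\<bar>})) \<longlonglongrightarrow> 0 + 0"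
      using \<open>0 < \<epsilon>\<close> by (intro tendsto_add Z Z')
    ultimately have "emeasure M (B k) \<le> 0 + 0" by (intro LIMSEQ_le_const) auto
    then show ?thesis by simp
  qed
  then have "AE x in M. x \<notin> B k" for k
    by (intro AE_not_in null_setsI) auto
  then have "AE x in M. \<forall>k. x \<notin> B k"
    by (simp add: AE_all_countable)
  then show ?thesis
    using AE_space
  proof eventually_elim
    case (elim x)
    have False if "x \<in> A" "Z x \<noteq> Z' x"
    proof -
      have "0 < \<bar>Z x - Z' x\<bar> / 2" using that by simp
      from reals_Archimedean[OF this] obtain k where "inverse (real (Suc k)) < \<bar>Z x - Z' x\<bar> / 2" ..
      then have "x \<in> B k" using elim(2) \<open>x \<in> A\<close> by (simp add: B_def del: of_nat_Suc)
      with elim(1) show False by blast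
    qed
    then show ?case by blast
  qed
qed

lemma emeasure_abs_ge_triangle:
  fixes X Y :: "'a \<Rightarrow> real"
  assumes [measurable]: "X \<in> borel_measurable M" "Y \<in> borel_measurable M"
    and le: "\<And>x. x \<in> space M \<Longrightarrow> \<bar>V x\<bar> \<le> \<bar>X x\<bar> + \<bar>Y x\<bar>"
  shows "emeasure M {x \<in> space M. \<epsilon> \<le> \<bar>V x\<bar>} \<le>
    emeasure M {x \<in> space M. \<epsilon> / 2 \<le> \<bar>X x\<bar>} + emeasure M {x \<in> space M. \<epsilon> / 2 \<le> \<bar>Y x\<bar>}"
proof -
  have "{x \<in> space M. \<epsilon> \<le> \<bar>V x\<bar>} \<subseteq> {x \<in> space M. \<epsilon> / 2 \<le> \<bar>X x\<bar>} \<union> {x \<in> space M. \<epsilon> / 2 \<le> \<bar>Y x\<bar>}"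
    using le by fastforce
  then have "emeasure M {x \<in> space M. \<epsilon> \<le> \<bar>V x\<bar>} \<le>
      emeasure M ({x \<in> space M. \<epsilon> / 2 \<le> \<bar>X x\<bar>} \<union> {x \<in> space M. \<epsilon> / 2 \<le> \<bar>Y x\<bar>})"
    by (rule emeasure_mono) measurable
  also have "\<dots> \<le> emeasure M {x \<in> space M. \<epsilon> / 2 \<le> \<bar>X x\<bar>} + emeasure M {x \<in> space M. \<epsilon> / 2 \<le> \<bar>Y x\<bar>}"
    by (rule emeasure_subadditive) measurable
  finally show ?thesis .
qed

lemma emeasure_abs_ge_le_square:
  fixes X :: "'a \<Rightarrow> real"
  assumes [measurable]: "X \<in> borel_measurable M" and "0 < \<epsilon>"
  shows "emeasure M {x \<in> space M. \<epsilon> \<le> \<bar>X x\<bar>} \<le> ennreal (1 / \<epsilon>\<^sup>2) * (\<integral>\<^sup>+x. ennreal ((X x)\<^sup>2) \<partial>M)"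
proof -
  have "{x \<in> space M. \<epsilon> \<le> \<bar>X x\<bar>} = {x \<in> space M. 1 \<le> ennreal (1 / \<epsilon>\<^sup>2) * ennreal ((X x)\<^sup>2)}"
    using \<open>0 < \<epsilon>\<close>
    by (auto simp: ennreal_mult[symmetric] abs_le_square_iff[symmetric] simp flip: ennreal_1 simp: field_simps)
  also have "emeasure M \<dots> \<le> ennreal (1 / \<epsilon>\<^sup>2) * (\<integral>\<^sup>+x. ennreal ((X x)\<^sup>2) * indicator (space M) x \<partial>M)"
    using nn_integral_Markov_inequality[of "\<lambda>x. ennreal ((X x)\<^sup>2)" "space M" M "ennreal (1 / \<epsilon>\<^sup>2)"] by simp
  also have "(\<integral>\<^sup>+x. ennreal ((X x)\<^sup>2) * indicator (space M) x \<partial>M) = (\<integral>\<^sup>+x. ennreal ((X x)\<^sup>2) \<partial>M)"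
    by (intro nn_integral_cong) simp
  finally show ?thesis .
qed

lemma emeasure_abs_ge_le_abs:
  fixes X :: "'a \<Rightarrow> real"
  assumes [measurable]: "X \<in> borel_measurable M" and "0 < \<epsilon>"
  shows "emeasure M {x \<in> space M. \<epsilon> \<le> \<bar>X x\<bar>} \<le> ennreal (1 / \<epsilon>) * (\<integral>\<^sup>+x. ennreal \<bar>X x\<bar> \<partial>M)"
proof -
  have "{x \<in> space M. \<epsilon> \<le> \<bar>X x\<bar>} = {x \<in> space M. 1 \<le> ennreal (1 / \<epsilon>) * ennreal \<bar>X x\<bar>}"
    using \<open>0 < \<epsilon>\<close>
    by (auto simp: ennreal_mult[symmetric] simp flip: ennreal_1 simp: field_simps)
  also have "emeasure M \<dots> \<le> ennreal (1 / \<epsilon>) * (\<integral>\<^sup>+x. ennreal \<bar>X x\<bar> * indicator (space M) x \<partial>M)"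
    using nn_integral_Markov_inequality[of "\<lambda>x. ennreal \<bar>X x\<bar>" "space M" M "ennreal (1 / \<epsilon>)"] by simp
  also have "(\<integral>\<^sup>+x. ennreal \<bar>X x\<bar> * indicator (space M) x \<partial>M) = (\<integral>\<^sup>+x. ennreal \<bar>X x\<bar> \<partial>M)"
    by (intro nn_integral_cong) simp
  finally show ?thesis .
qed

lemma tendsto_0_ennreal_le:
  fixes f g :: "nat \<Rightarrow> ennreal"
  assumes "g \<longlonglongrightarrow> 0" "\<And>n. f n \<le> g n"
  shows "f \<longlonglongrightarrow> 0"
  using tendsto_sandwich[of "\<lambda>_. 0" f sequentially g 0] assms by simp

lemma tendsto_0_cmult_ennreal:
  fixes f :: "nat \<Rightarrow> ennreal"
  assumes "f \<longlonglongrightarrow> 0" "c < \<infinity>"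
  shows "(\<lambda>n. c * f n) \<longlonglongrightarrow> 0"
  using ennreal_tendsto_cmult[of c f 0 sequentially] assms by (simp add: infinity_ennreal_def)

lemma suminf_ennreal_tendsto_0:
  fixes f :: "nat \<Rightarrow> ennreal"
  assumes "(\<Sum>n. f n) < \<infinity>"
  shows "f \<longlonglongrightarrow> 0"
proof -
  have fin: "f n < \<infinity>" for n
    using sum_le_suminf[of f "{n}"] assms by (auto intro: le_less_trans)
  have "summable (\<lambda>n. enn2real (f n))"
    by (rule summable_suminf_not_top) (use assms fin in \<open>auto simp: less_top\<close>)
  then have "(\<lambda>n. ennreal (enn2real (f n))) \<longlonglongrightarrow> ennreal 0"
    by (intro tendsto_ennrealI summable_LIMSEQ_zero)
  then show ?thesis using fin by (simp add: less_top)
qed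

text \<open>Common frame for the bridge (\<open>q\<close> a squared L^2 norm, \<open>C = 4\<close>)
  and the Bessel process (\<open>q = bessel_dist\<close>). The factor 2 in \<open>q_diff\<close> is
  there because \<open>q\<close> contains a square; the form
  \<open>1 + 1 / \<epsilon>\<^sup>2\<close> absorbs both a Chebyshev term and a Markov term.\<close>

locale step_functional = prob_space M for M :: "'a measure" +
  fixes S :: "step_data \<Rightarrow> 'a \<Rightarrow> real" and q :: "(real \<Rightarrow> real) \<Rightarrow> ennreal" and C :: real
  assumes S_measurable: "is_step \<phi> \<Longrightarrow> S \<phi> \<in> borel_measurable M"
    and S_diff: "is_step \<phi> \<Longrightarrow> is_step \<psi> \<Longrightarrow> S (step_diff \<phi> \<psi>) x = S \<phi> x - S \<psi> x"
    and S_bound: "is_step \<phi> \<Longrightarrow> 0 < \<epsilon> \<Longrightarrow>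
      emeasure M {x \<in> space M. \<epsilon> \<le> \<bar>S \<phi> x\<bar>} \<le> ennreal (C * (1 + 1 / \<epsilon>\<^sup>2)) * q (step_fun \<phi>)"
    and q_diff: "f \<in> borel_measurable borel \<Longrightarrow> g \<in> borel_measurable borel \<Longrightarrow> h \<in> borel_measurable borel \<Longrightarrow>
      q (\<lambda>s. f s - g s) \<le> 2 * (q (\<lambda>s. f s - h s) + q (\<lambda>s. g s - h s))"
    and C_nonneg: "0 \<le> C"
begin

lemma S_diff_bound:
  assumes "is_step \<phi>" "is_step \<psi>" "0 < \<epsilon>" and [measurable]: "f \<in> borel_measurable borel"
  shows "emeasure M {x \<in> space M. \<epsilon> \<le> \<bar>S \<phi> x - S \<psi> x\<bar>} \<le>
    ennreal (C * (1 + 1 / \<epsilon>\<^sup>2)) * (2 * (q (\<lambda>s. step_fun \<phi> s - f s) + q (\<lambda>s. step_fun \<psi> s - f s)))"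
proof -
  have "step_fun (step_diff \<phi> \<psi>) = (\<lambda>s. step_fun \<phi> s - step_fun \<psi> s)"
    using assms by (auto simp: step_fun_diff)
  moreover have "q (\<lambda>s. step_fun \<phi> s - step_fun \<psi> s) \<le> 2 * (q (\<lambda>s. step_fun \<phi> s - f s) + q (\<lambda>s. step_fun \<psi> s - f s))"
    by (rule q_diff) measurable
  moreover have "emeasure M {x \<in> space M. \<epsilon> \<le> \<bar>S (step_diff \<phi> \<psi>) x\<bar>} \<le>
      ennreal (C * (1 + 1 / \<epsilon>\<^sup>2)) * q (step_fun (step_diff \<phi> \<psi>))"
    using assms by (intro S_bound is_step_diff)
  ultimately show ?thesis
    using assms(1,2) by (simp only: S_diff) (erule order_trans, rule mult_left_mono, auto)
qed

context
  fixes f :: "real \<Rightarrow> real" and \<phi> :: "nat \<Rightarrow> step_data"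
  assumes f [measurable]: "f \<in> borel_measurable borel"
    and \<phi>: "\<And>n. is_step (\<phi> n)"
    and fast: "(\<Sum>n. 4 ^ n * q (\<lambda>s. step_fun (\<phi> n) s - f s)) < \<infinity>"
begin

text \<open>Borel-Cantelli for increments larger than \<open>(1/2) ^ n\<close>: at this threshold
  the tail bound costs a factor of order \<open>4 ^ n\<close>, which is the weight in
  \<open>fast\<close>.\<close>

lemma S_AE_convergent: "AE x in M. convergent (\<lambda>n. S (\<phi> n) x)"
proof -
  have [measurable]: "S (\<phi> n) \<in> borel_measurable M" for n using \<phi> by (rule S_measurable)
  define e where "e n = 4 ^ n * q (\<lambda>s. step_fun (\<phi> n) s - f s)" for n
  define B where "B n = {x \<in> space M. (1/2) ^ n \<le> \<bar>S (\<phi> (Suc n)) x - S (\<phi> n) x\<bar>}" for n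
  have B [measurable]: "B n \<in> sets M" for n by (simp add: B_def)
  have "emeasure M (B n) \<le> ennreal (4 * C) * (e (Suc n) + e n)" for n
  proof -
    have "emeasure M (B n) \<le> ennreal (C * (1 + 1 / ((1/2) ^ n)\<^sup>2)) *
      (2 * (q (\<lambda>s. step_fun (\<phi> (Suc n)) s - f s) + q (\<lambda>s. step_fun (\<phi> n) s - f s)))"
      unfolding B_def by (rule S_diff_bound) (simp_all add: \<phi>)
    also have "C * (1 + 1 / ((1/2) ^ n)\<^sup>2) \<le> C * (2 * 4 ^ n)"
    proof (rule mult_left_mono[OF _ C_nonneg])
      have "1 / ((1/2::real) ^ n)\<^sup>2 = 4 ^ n" by (simp add: power_one_over power2_eq_square power_mult_distrib[symmetric])
      moreover have "(1::real) \<le> 4 ^ n" by simp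
      ultimately show "1 + 1 / ((1/2::real) ^ n)\<^sup>2 \<le> 2 * 4 ^ n" by simp
    qed
    also have "ennreal (C * (2 * 4 ^ n)) * (2 * (q (\<lambda>s. step_fun (\<phi> (Suc n)) s - f s) + q (\<lambda>s. step_fun (\<phi> n) s - f s)))
       = ennreal (4 * C) * (4 ^ n * q (\<lambda>s. step_fun (\<phi> (Suc n)) s - f s) + e n)"
    proof -
      have "ennreal (C * (2 * 4 ^ n)) * 2 = ennreal (4 * C) * 4 ^ n"
        using C_nonneg by (simp add: ennreal_mult'' ennreal_mult ennreal_power[symmetric] mult.assoc mult.left_commute mult.commute)
      then show ?thesis
        by (simp add: e_def distrib_left mult.assoc[symmetric])
    qed
    also have "\<dots> \<le> ennreal (4 * C) * (e (Suc n) + e n)"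
      unfolding e_def by (intro mult_left_mono add_mono mult_right_mono power_increasing) auto
    finally show ?thesis by (simp add: mult_right_mono ennreal_leI)
  qed
  then have "(\<Sum>n. emeasure M (B n)) \<le> (\<Sum>n. ennreal (4 * C) * (e (Suc n) + e n))"
    by (intro suminf_le) auto
  also have "\<dots> = ennreal (4 * C) * ((\<Sum>n. e (Suc n)) + (\<Sum>n. e n))"
    by (simp add: suminf_add[symmetric])
  also have "(\<Sum>n. e (Suc n)) \<le> (\<Sum>n. e n)"
    using suminf_offset[of e 1] by (simp add: add_increasing2)
  finally have "(\<Sum>n. emeasure M (B n)) \<le> ennreal (4 * C) * ((\<Sum>n. e n) + (\<Sum>n. e n))"
    by (simp add: mult_left_mono add_right_mono)
  also have "\<dots> < \<infinity>"
    using fast by (auto simp: e_def ennreal_mult_less_top)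
  finally have "(\<Sum>n. ennreal (measure M (B n))) \<noteq> \<top>"
    by (simp add: emeasure_eq_measure)
  then have "summable (\<lambda>n. measure M (B n))"
    by (intro summable_suminf_not_top) auto
  then have "AE x in M. \<forall>\<^sub>F n in sequentially. x \<in> space M - B n"
    by (intro borel_cantelli_AE1) (auto simp: less_top[symmetric])
  then show ?thesis
  proof eventually_elim
    case (elim x)
    then have "\<forall>\<^sub>F n in sequentially. \<bar>S (\<phi> (Suc n)) x - S (\<phi> n) x\<bar> < (1/2) ^ n"
      by eventually_elim (auto simp: B_def)
    then show ?case by (rule convergent_if_geometric)
  qed
qed

definition limS :: "'a \<Rightarrow> real" where "limS x = lim (\<lambda>n. S (\<phi> n) x)"

lemma limS_measurable [measurable]: "limS \<in> borel_measurable M"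
  unfolding limS_def using S_measurable[OF \<phi>] by (intro borel_measurable_lim_metric)

lemma limS_AE: "AE x in M. (\<lambda>n. S (\<phi> n) x) \<longlonglongrightarrow> limS x"
  using S_AE_convergent by eventually_elim (simp add: limS_def convergent_LIMSEQ_iff)

lemma q_tendsto_0: "(\<lambda>n. q (\<lambda>s. step_fun (\<phi> n) s - f s)) \<longlonglongrightarrow> 0"
  by (rule tendsto_0_ennreal_le[OF suminf_ennreal_tendsto_0[OF fast]])
    (metis mult_right_mono one_le_power mult_1 zero_le one_le_numeral)

text \<open>Compare \<open>\<psi>\<close> with \<open>\<phi> n\<close> and let n tend to infinity.
  Splitting the tolerance into halves gives \<open>4 / \<epsilon>\<^sup>2\<close>, and
  \<open>q_diff\<close> gives the factor 2. The bound concerns a single \<open>\<psi>\<close>, so it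
  yields convergence along every approximating sequence and can be integrated over a
  parameter.\<close>

lemma limS_bound:
  assumes \<psi>: "is_step \<psi>" and "0 < \<epsilon>"
  shows "emeasure M {x \<in> space M. \<epsilon> \<le> \<bar>S \<psi> x - limS x\<bar>} \<le>
    ennreal (2 * C * (1 + 4 / \<epsilon>\<^sup>2)) * q (\<lambda>s. step_fun \<psi> s - f s)"
proof -
  have [measurable]: "S (\<phi> n) \<in> borel_measurable M" "S \<psi> \<in> borel_measurable M" for n
    using \<phi> \<psi> by (auto intro: S_measurable)
  define c where "c = ennreal (C * (1 + 1 / (\<epsilon> / 2)\<^sup>2))"
  let ?q = "q (\<lambda>s. step_fun \<psi> s - f s)" and ?qn = "\<lambda>n. q (\<lambda>s. step_fun (\<phi> n) s - f s)"
  have "emeasure M {x \<in> space M. \<epsilon> \<le> \<bar>S \<psi> x - limS x\<bar>} \<le>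
     c * (2 * (?q + ?qn n)) + emeasure M {x \<in> space M. \<epsilon> / 2 \<le> \<bar>S (\<phi> n) x - limS x\<bar>}" for n
  proof -
    have "emeasure M {x \<in> space M. \<epsilon> \<le> \<bar>S \<psi> x - limS x\<bar>} \<le>
       emeasure M {x \<in> space M. \<epsilon> / 2 \<le> \<bar>S \<psi> x - S (\<phi> n) x\<bar>} + emeasure M {x \<in> space M. \<epsilon> / 2 \<le> \<bar>S (\<phi> n) x - limS x\<bar>}"
      by (rule emeasure_abs_ge_triangle) auto
    also have "emeasure M {x \<in> space M. \<epsilon> / 2 \<le> \<bar>S \<psi> x - S (\<phi> n) x\<bar>} \<le> c * (2 * (?q + ?qn n))"
      unfolding c_def using \<open>0 < \<epsilon>\<close> by (intro S_diff_bound \<phi> \<psi>) auto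
    finally show ?thesis by (simp add: add_right_mono)
  qed
  moreover have "(\<lambda>n. c * (2 * (?q + ?qn n)) + emeasure M {x \<in> space M. \<epsilon> / 2 \<le> \<bar>S (\<phi> n) x - limS x\<bar>})
     \<longlonglongrightarrow> c * (2 * (?q + 0)) + 0"
    using \<open>0 < \<epsilon>\<close> limS_AE
    by (intro tendsto_add ennreal_tendsto_cmult tendsto_const q_tendsto_0 AE_tendsto_imp_measure)
      (auto simp: c_def)
  ultimately have "emeasure M {x \<in> space M. \<epsilon> \<le> \<bar>S \<psi> x - limS x\<bar>} \<le> c * (2 * (?q + 0)) + 0"
    by (intro LIMSEQ_le_const) auto
  also have "\<dots> = ennreal (2 * C * (1 + 4 / \<epsilon>\<^sup>2)) * ?q"
  proof -
    have "c * 2 = ennreal (2 * C * (1 + 4 / \<epsilon>\<^sup>2))"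
      using C_nonneg unfolding c_def ennreal_numeral[symmetric]
      by (subst ennreal_mult[symmetric]) (simp_all add: power_divide field_simps)
    then show ?thesis by (simp add: mult.assoc[symmetric])
  qed
  finally show ?thesis .
qed

end

end

subsection \<open>Weighted norms of step functions\<close>

text \<open>The square of the norm, which is what second moments produce. Integration over
  \<open>lborel\<close> gives the same value as over \<open>lebesgue\<close>, even for functions
  that are not Borel.\<close>

definition sq_norm :: "real set \<Rightarrow> (real \<Rightarrow> real) \<Rightarrow> ennreal" where
  "sq_norm A g = (\<integral>\<^sup>+s\<in>A. ennreal ((g s)\<^sup>2) \<partial>lborel)"

definition wt_norm :: "(real \<Rightarrow> real) \<Rightarrow> (real \<Rightarrow> real) \<Rightarrow> ennreal" where
  "wt_norm w g = (\<integral>\<^sup>+s\<in>{0..}. ennreal (\<bar>g s\<bar> * w s) \<partial>lborel)"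

lemma L2_tendsto_iff_sq_norm: "L2_tendsto A F f \<longleftrightarrow> (\<lambda>n. sq_norm A (\<lambda>s. F n s - f s)) \<longlonglongrightarrow> 0"
  by (simp add: L2_tendsto_def sq_norm_def nn_integral_completion)

lemma L1_weighted_tendsto_iff_wt_norm:
  "L1_weighted_tendsto w F f \<longleftrightarrow> (\<lambda>n. wt_norm w (\<lambda>s. F n s - f s)) \<longlonglongrightarrow> 0"
  by (simp add: L1_weighted_tendsto_def wt_norm_def nn_integral_completion)

lemma sq_norm_mono: "A \<subseteq> B \<Longrightarrow> sq_norm A g \<le> sq_norm B g"
  unfolding sq_norm_def by (intro nn_integral_mono mult_left_mono) (auto simp: indicator_def)

lemma sq_norm_diff:
  assumes [measurable]: "f \<in> borel_measurable borel" "g \<in> borel_measurable borel"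
    "h \<in> borel_measurable borel" "A \<in> sets borel"
  shows "sq_norm A (\<lambda>s. f s - g s) \<le> 2 * (sq_norm A (\<lambda>s. f s - h s) + sq_norm A (\<lambda>s. g s - h s))"
proof -
  have "(f s - g s)\<^sup>2 \<le> 2 * ((f s - h s)\<^sup>2 + (g s - h s)\<^sup>2)" for s
    using sum_squares_ge_zero[of "(f s - h s) + (g s - h s)" 0]
    by (simp add: power2_eq_square algebra_simps)
  then have "ennreal ((f s - g s)\<^sup>2) \<le> 2 * (ennreal ((f s - h s)\<^sup>2) + ennreal ((g s - h s)\<^sup>2))" for s
    by (simp add: ennreal_plus[symmetric] ennreal_mult[symmetric] ennreal_leI flip: ennreal_numeral del: ennreal_plus)
  then have "sq_norm A (\<lambda>s. f s - g s) \<le> (\<integral>\<^sup>+s. 2 * (ennreal ((f s - h s)\<^sup>2) * indicator A s + ennreal ((g s - h s)\<^sup>2) * indicator A s) \<partial>lborel)"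
    unfolding sq_norm_def by (intro nn_integral_mono) (auto simp: indicator_def)
  also have "\<dots> = 2 * (sq_norm A (\<lambda>s. f s - h s) + sq_norm A (\<lambda>s. g s - h s))"
    unfolding sq_norm_def by (simp add: nn_integral_cmult nn_integral_add)
  finally show ?thesis .
qed

lemma wt_norm_diff:
  assumes [measurable]: "f \<in> borel_measurable borel" "g \<in> borel_measurable borel"
    "h \<in> borel_measurable borel" "w \<in> borel_measurable borel" and w: "\<And>s. 0 \<le> s \<Longrightarrow> 0 \<le> w s"
  shows "wt_norm w (\<lambda>s. f s - g s) \<le> wt_norm w (\<lambda>s. f s - h s) + wt_norm w (\<lambda>s. g s - h s)"
proof -
  have "ennreal (\<bar>f s - g s\<bar> * w s) \<le> ennreal (\<bar>f s - h s\<bar> * w s) + ennreal (\<bar>g s - h s\<bar> * w s)" if "0 \<le> s" for s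
    using w[OF that] mult_right_mono[of "\<bar>f s - g s\<bar>" "\<bar>f s - h s\<bar> + \<bar>g s - h s\<bar>" "w s"]
    by (simp add: ennreal_plus[symmetric] ennreal_leI distrib_right del: ennreal_plus)
  then have "wt_norm w (\<lambda>s. f s - g s) \<le> (\<integral>\<^sup>+s. (ennreal (\<bar>f s - h s\<bar> * w s) * indicator {0..} s + ennreal (\<bar>g s - h s\<bar> * w s) * indicator {0..} s) \<partial>lborel)"
    unfolding wt_norm_def by (intro nn_integral_mono) (auto simp: indicator_def)
  also have "\<dots> = wt_norm w (\<lambda>s. f s - h s) + wt_norm w (\<lambda>s. g s - h s)"
    unfolding wt_norm_def by (subst nn_integral_add) measurable
  finally show ?thesis .
qed

lemma step_fun_on:
  assumes st: "is_step (n, t, c)" and k: "k < n" "s \<in> {t k..<t (Suc k)}"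
  shows "step_fun (n, t, c) s = c k" "j < n \<Longrightarrow> s \<in> {t j..<t (Suc j)} \<Longrightarrow> j = k"
proof -
  have *: "j = k" if "j < n" "s \<in> {t j..<t (Suc j)}" for j
  proof (rule ccontr)
    assume "j \<noteq> k"
    then consider "Suc j \<le> k" | "Suc k \<le> j" by linarith
    then show False
    proof cases
      case 1 with is_step_mono[OF st 1] that k show ?thesis by simp
    next
      case 2 with is_step_mono[OF st 2] that k show ?thesis by simp
    qed
  qed
  then show "j < n \<Longrightarrow> s \<in> {t j..<t (Suc j)} \<Longrightarrow> j = k" .
  have "step_fun (n, t, c) s = (\<Sum>j\<in>{k}. c j * indicator {t j..<t (Suc j)} s)"
    unfolding step_fun_def prod.case
  proof (rule sum.mono_neutral_right)
    show "\<forall>j\<in>{..<n} - {k}. c j * indicator {t j..<t (Suc j)} s = 0"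
      by (metis * DiffE indicator_simps(2) insertI1 lessThan_iff mult_zero_right)
  qed (use k in auto)
  moreover have "sum F {k} = F k" for F :: "nat \<Rightarrow> real" by simp
  ultimately show "step_fun (n, t, c) s = c k" using k(2) by (simp only: indicator_simps mult_1_right)
qed

text \<open>The intervals are disjoint, so at each point at most one summand survives, and there the
  step function equals \<open>c k\<close>. It is only an inequality because \<open>\<Phi> 0\<close>
  may be positive where the step function vanishes.\<close>

lemma sum_step_nn_integral_le:
  fixes \<Phi> :: "real \<Rightarrow> real \<Rightarrow> ennreal"
  assumes st: "is_step (n, t, c)" and [measurable]: "\<And>k. \<Phi> (c k) \<in> borel_measurable borel"
  shows "(\<Sum>k<n. \<integral>\<^sup>+s\<in>{t k..<t (Suc k)}. \<Phi> (c k) s \<partial>lborel) \<le>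
    (\<integral>\<^sup>+s\<in>{0..}. \<Phi> (step_fun (n, t, c) s) s \<partial>lborel)"
proof -
  have "(\<Sum>k<n. \<Phi> (c k) s * indicator {t k..<t (Suc k)} s) \<le> \<Phi> (step_fun (n, t, c) s) s * indicator {0..} s" for s
  proof (cases "\<exists>k<n. s \<in> {t k..<t (Suc k)}")
    case True
    then obtain k where k: "k < n" "s \<in> {t k..<t (Suc k)}" by blast
    have "(\<Sum>j<n. \<Phi> (c j) s * indicator {t j..<t (Suc j)} s) = (\<Sum>j\<in>{k}. \<Phi> (c j) s * indicator {t j..<t (Suc j)} s)"
    proof (rule sum.mono_neutral_right)
      show "\<forall>j\<in>{..<n} - {k}. \<Phi> (c j) s * indicator {t j..<t (Suc j)} s = 0"
        by (metis step_fun_on(2)[OF st k] DiffE indicator_simps(2) insertI1 lessThan_iff mult_zero_right)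
    qed (use k in auto)
    moreover have "0 \<le> s" using is_step_nonneg[OF st, of k] k by simp
    moreover have "sum F {k} = F k" for F :: "nat \<Rightarrow> ennreal" by simp
    ultimately show ?thesis using k(2) step_fun_on(1)[OF st k] by simp
  next
    case False
    then have "(\<Sum>k<n. \<Phi> (c k) s * indicator {t k..<t (Suc k)} s) = 0"
      by (intro sum.neutral) (auto simp: indicator_def)
    then show ?thesis by simp
  qed
  then have "(\<integral>\<^sup>+s. (\<Sum>k<n. \<Phi> (c k) s * indicator {t k..<t (Suc k)} s) \<partial>lborel) \<le>
    (\<integral>\<^sup>+s\<in>{0..}. \<Phi> (step_fun (n, t, c) s) s \<partial>lborel)"
    by (intro nn_integral_mono)
  then show ?thesis
    by (subst (asm) nn_integral_sum) measurable
qed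

lemma sum_step_sq_norm:
  assumes st: "is_step (n, t, c)"
  shows "(\<Sum>k<n. ennreal ((c k)\<^sup>2 * (t (Suc k) - t k))) \<le> sq_norm {0..} (step_fun (n, t, c))"
proof -
  have "ennreal ((c k)\<^sup>2 * (t (Suc k) - t k)) = (\<integral>\<^sup>+s\<in>{t k..<t (Suc k)}. ennreal ((c k)\<^sup>2) \<partial>lborel)" if "k < n" for k
    using is_step_mono[OF st, of k "Suc k"] that by (simp add: nn_integral_cmult_indicator ennreal_mult)
  then show ?thesis
    using sum_step_nn_integral_le[OF st, of "\<lambda>x s. ennreal (x\<^sup>2)"] by (simp add: sq_norm_def)
qed

lemma sum_step_sq_norm_upto:
  assumes st: "is_step (n, t, c)" and "0 \<le> u"
  shows "(\<Sum>k<n. ennreal ((c k)\<^sup>2 * (min (t (Suc k)) u - min (t k) u))) \<le> sq_norm {0..u} (step_fun (n, t, c))"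
proof -
  have "ennreal ((c k)\<^sup>2 * (min (t (Suc k)) u - min (t k) u)) =
      (\<integral>\<^sup>+s\<in>{t k..<t (Suc k)}. ennreal ((c k)\<^sup>2) * indicator {..<u} s \<partial>lborel)" if "k < n" for k
  proof -
    have "(\<integral>\<^sup>+s\<in>{t k..<t (Suc k)}. ennreal ((c k)\<^sup>2) * indicator {..<u} s \<partial>lborel) =
      (\<integral>\<^sup>+s. ennreal ((c k)\<^sup>2) * indicator {min (t k) u..<min (t (Suc k)) u} s \<partial>lborel)"
      by (intro nn_integral_cong) (auto simp: indicator_def min_def)
    also have "\<dots> = ennreal ((c k)\<^sup>2 * (min (t (Suc k)) u - min (t k) u))"
      using is_step_mono[OF st, of k "Suc k"] that
      by (subst nn_integral_cmult_indicator) (auto simp: ennreal_mult min_def)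
    finally show ?thesis by simp
  qed
  then have "(\<Sum>k<n. ennreal ((c k)\<^sup>2 * (min (t (Suc k)) u - min (t k) u))) \<le>
    (\<integral>\<^sup>+s\<in>{0..}. ennreal ((step_fun (n, t, c) s)\<^sup>2) * indicator {..<u} s \<partial>lborel)"
    using sum_step_nn_integral_le[OF st, of "\<lambda>x s. ennreal (x\<^sup>2) * indicator {..<u} s"] by simp
  also have "\<dots> \<le> sq_norm {0..u} (step_fun (n, t, c))"
    unfolding sq_norm_def by (intro nn_integral_mono) (auto simp: indicator_def)
  finally show ?thesis .
qed

text \<open>On the interval the integrand is at least \<open>1 / sqrt b\<close>, and
  \<open>sqrt b - sqrt a \<le> (b - a) / sqrt b\<close>. The exact antiderivative would improve the
  constant but bring in the singularity at 0.\<close>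

lemma sqrt_diff_le_nn_integral:
  assumes "0 \<le> a" "a < b"
  shows "ennreal (sqrt b - sqrt a) \<le> (\<integral>\<^sup>+s\<in>{a..<b}. ennreal (1 / sqrt s) \<partial>lborel)"
proof -
  have "0 < b" using assms by simp
  have "(sqrt b - sqrt a) * sqrt b \<le> (sqrt b - sqrt a) * (sqrt b + sqrt a)"
    using assms by (intro mult_left_mono) auto
  also have "\<dots> = b - a" using assms by (simp add: algebra_simps)
  finally have "sqrt b - sqrt a \<le> 1 / sqrt b * (b - a)"
    using \<open>0 < b\<close> by (simp add: field_simps)
  then have "ennreal (sqrt b - sqrt a) \<le> ennreal (1 / sqrt b * (b - a))" by (rule ennreal_leI)
  \<comment> \<open>The interval is open because for \<open>a = 0\<close> the integrand at
    \<open>s = 0\<close> is \<open>1 / sqrt 0 = 0\<close>.\<close>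
  also have "\<dots> = (\<integral>\<^sup>+s. ennreal (1 / sqrt b) * indicator {a<..<b} s \<partial>lborel)"
    using assms by (simp add: nn_integral_cmult_indicator ennreal_mult[symmetric])
  also have "\<dots> \<le> (\<integral>\<^sup>+s\<in>{a..<b}. ennreal (1 / sqrt s) \<partial>lborel)"
    using assms by (intro nn_integral_mono) (auto simp: indicator_def intro!: ennreal_leI frac_le)
  finally show ?thesis .
qed

lemma sum_step_wt_norm:
  assumes st: "is_step (n, t, c)"
  shows "(\<Sum>k<n. ennreal (\<bar>c k\<bar> * (sqrt (t (Suc k)) - sqrt (t k)))) \<le> wt_norm (\<lambda>s. 1 / sqrt s) (step_fun (n, t, c))"
proof -
  have "(\<Sum>k<n. ennreal (\<bar>c k\<bar> * (sqrt (t (Suc k)) - sqrt (t k)))) \<le>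
      (\<Sum>k<n. \<integral>\<^sup>+s\<in>{t k..<t (Suc k)}. ennreal (\<bar>c k\<bar> * (1 / sqrt s)) \<partial>lborel)"
  proof (rule sum_mono)
    fix k assume "k \<in> {..<n}"
    then have t: "0 \<le> t k" "t k < t (Suc k)" using st is_step_nonneg[OF st, of k] by (auto simp: is_step_def)
    have "ennreal (\<bar>c k\<bar> * (sqrt (t (Suc k)) - sqrt (t k))) = ennreal \<bar>c k\<bar> * ennreal (sqrt (t (Suc k)) - sqrt (t k))"
      using t by (intro ennreal_mult) auto
    also have "\<dots> \<le> ennreal \<bar>c k\<bar> * (\<integral>\<^sup>+s\<in>{t k..<t (Suc k)}. ennreal (1 / sqrt s) \<partial>lborel)"
      using t by (intro mult_left_mono sqrt_diff_le_nn_integral) auto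
    also have "\<dots> = (\<integral>\<^sup>+s. ennreal \<bar>c k\<bar> * (ennreal (1 / sqrt s) * indicator {t k..<t (Suc k)} s) \<partial>lborel)"
      by (subst nn_integral_cmult) measurable
    also have "\<dots> = (\<integral>\<^sup>+s\<in>{t k..<t (Suc k)}. ennreal (\<bar>c k\<bar> * (1 / sqrt s)) \<partial>lborel)"
      using t by (intro nn_integral_cong) (auto simp: indicator_def ennreal_mult[symmetric])
    finally show "ennreal (\<bar>c k\<bar> * (sqrt (t (Suc k)) - sqrt (t k))) \<le> \<dots>" .
  qed
  also have "\<dots> \<le> wt_norm (\<lambda>s. 1 / sqrt s) (step_fun (n, t, c))"
    unfolding wt_norm_def by (rule sum_step_nn_integral_le[OF st]) measurable
  finally show ?thesis .
qed

text \<open>With this weight the integral below has the antiderivative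
  \<open>u \<mapsto> - 2 / (1 + s) * sqrt ((s - u) / (1 + u))\<close>.\<close>

definition shift_weight :: "real \<Rightarrow> real" where
  "shift_weight u = 1 / ((1 + u) * sqrt (1 + u))"

lemma shift_weight_measurable [measurable]: "shift_weight \<in> borel_measurable borel"
  unfolding shift_weight_def by measurable

lemma shift_weight_pos: "0 \<le> u \<Longrightarrow> 0 < shift_weight u"
  by (simp add: shift_weight_def)

lemma nn_integral_shift_weight:
  assumes "0 \<le> s"
  shows "(\<integral>\<^sup>+u. ennreal (shift_weight u * (1 / sqrt (s - u))) * indicator {0..s} u \<partial>lborel) \<le> ennreal (3 / (1 + sqrt s))"
proof (cases "s = 0")
  case True
  have "(\<integral>\<^sup>+u. ennreal (shift_weight u * (1 / sqrt (s - u))) * indicator {0..s} u \<partial>lborel) = integral\<^sup>N lborel (\<lambda>u::real. 0)"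
    by (intro nn_integral_cong) (auto simp: True indicator_def)
  then show ?thesis by simp
next
  case False
  then have s: "0 < s" using assms by simp
  define F where "F u = - 2 / (1 + s) * sqrt ((s - u) / (1 + u))" for u
  define h where "h u = shift_weight u * (1 / sqrt (s - u))" for u
  have h: "0 \<le> h u" if "0 < u" "u < s" for u using that shift_weight_pos[of u] by (simp add: h_def)
  have D: "DERIV F u :> h u" if "0 < u" "u < s" for u
  proof -
    define p where "p = sqrt (s - u)"
    define r where "r = sqrt (1 + u)"
    have pr: "0 < p" "0 < r" "p\<^sup>2 = s - u" "r\<^sup>2 = 1 + u" using that by (simp_all add: p_def r_def)
    have "((\<lambda>u. (s - u) / (1 + u)) has_real_derivative - (1 + s) / (1 + u)\<^sup>2) (at u)"
      using that by (auto intro!: derivative_eq_intros simp: power2_eq_square field_simps)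
    then have "((\<lambda>u. sqrt ((s - u) / (1 + u))) has_real_derivative
       (- (1 + s) / (1 + u)\<^sup>2) * (inverse (sqrt ((s - u) / (1 + u))) / 2)) (at u)"
      using DERIV_chain2[where f = sqrt and g = "\<lambda>u. (s - u) / (1 + u)" and x = u,
          OF DERIV_real_sqrt[of "(s - u) / (1 + u)"]] that by (simp only: mult.commute divide_pos_pos diff_gt_0_iff_gt add_pos_pos zero_less_one)
    then have "(F has_real_derivative - 2 / (1 + s) * ((- (1 + s) / (1 + u)\<^sup>2) * (inverse (sqrt ((s - u) / (1 + u))) / 2))) (at u)"
      unfolding F_def by (rule DERIV_cmult)
    also have "- 2 / (1 + s) * ((- (1 + s) / (1 + u)\<^sup>2) * (inverse (sqrt ((s - u) / (1 + u))) / 2)) = h u"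
    proof -
      have "- 2 / (1 + s) * ((- (1 + s) / (1 + u)\<^sup>2) * (inverse (sqrt ((s - u) / (1 + u))) / 2)) = inverse (sqrt ((s - u) / (1 + u))) / (1 + u)\<^sup>2"
      proof -
        have *: "- 2 / x * ((- x / a) * (i / 2)) = i / a" if "x \<noteq> 0" for x a i :: real
          using that by (cases "a = 0") (auto simp: field_simps)
        show ?thesis by (rule *) (use s in simp)
      qed
      also have "\<dots> = (r / p) / (r\<^sup>2)\<^sup>2"
        by (simp add: real_sqrt_divide p_def[symmetric] r_def[symmetric] pr)
      also have "\<dots> = h u"
        using pr(1,2) unfolding h_def shift_weight_def p_def[symmetric] r_def[symmetric] pr(4)[symmetric]
        by (simp add: field_simps power2_eq_square)
      finally show ?thesis .
    qed
    finally show ?thesis .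
  qed
  have cont: "isCont h u" if "0 < u" "u < s" for u
    using that unfolding h_def shift_weight_def by (intro continuous_intros) auto
  have F0: "isCont F 0" unfolding F_def by (intro continuous_intros) auto
  have Fs: "isCont F s" unfolding F_def using s by (intro continuous_intros) auto
  \<comment> \<open>The integrand is unbounded at \<open>u = s\<close>. The improper form of the
    fundamental theorem only needs one-sided limits of \<open>F\<close> at the end points, and a
    nonnegative derivative in between.\<close>
  have A: "((F \<circ> real_of_ereal) \<longlongrightarrow> F 0) (at_right (ereal 0))"
    unfolding ereal_tendsto_simps1 using F0 by (simp add: isCont_def filterlim_at_split)
  have B: "((F \<circ> real_of_ereal) \<longlongrightarrow> F s) (at_left (ereal s))"
    unfolding ereal_tendsto_simps1 using Fs by (simp add: isCont_def filterlim_at_split)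
  have int: "set_integrable lborel (einterval (ereal 0) (ereal s)) h"
    and val: "(LBINT u=ereal 0..ereal s. h u) = F s - F 0"
    by (rule interval_integral_FTC_nonneg[where F = F]; use s D cont h A B in force)+
  have "(\<integral>\<^sup>+u. ennreal (h u) * indicator {0..s} u \<partial>lborel) = (\<integral>\<^sup>+u. ennreal (indicator {0<..<s} u *\<^sub>R h u) \<partial>lborel)"
  proof (rule nn_integral_cong_AE)
    show "AE u in lborel. ennreal (h u) * indicator {0..s} u = ennreal (indicator {0<..<s} u *\<^sub>R h u)"
      using AE_lborel_singleton[of 0] AE_lborel_singleton[of s]
      by eventually_elim (auto simp: indicator_def)
  qed
  also have "\<dots> = ennreal (\<integral>u. indicator {0<..<s} u *\<^sub>R h u \<partial>lborel)"
    using int h by (intro nn_integral_eq_integral) (auto simp: set_integrable_def einterval_eq indicator_def)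
  also have "(\<integral>u. indicator {0<..<s} u *\<^sub>R h u \<partial>lborel) = F s - F 0"
    using val s by (simp add: interval_lebesgue_integral_def set_lebesgue_integral_def einterval_eq)
  also have "F s - F 0 = 2 * sqrt s / (1 + s)" by (simp add: F_def)
  \<comment> \<open>After cross-multiplication, \<open>2 * sqrt s + 2 * s \<le> 1 + 3 * s\<close> by
    the arithmetic-geometric mean inequality; hence the constant 3.\<close>
  also have "2 * sqrt s / (1 + s) \<le> 3 / (1 + sqrt s)"
  proof -
    have "0 \<le> (1 - sqrt s)\<^sup>2" by simp
    then have "2 * sqrt s \<le> 1 + s" using s by (simp add: power2_eq_square algebra_simps)
    moreover have "sqrt s * (sqrt s * 2) = 2 * s" using s by simp
    ultimately show ?thesis using s by (simp add: field_simps add_pos_pos del: real_sqrt_mult_self real_sqrt_mult_self)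
  qed
  finally show ?thesis by (simp add: h_def ennreal_leI)
qed

text \<open>Substitute \<open>s - u\<close> for s and exchange the integrals; the inner integral
  over \<open>{0..s}\<close> is the one in \<open>nn_integral_shift_weight\<close>.\<close>

lemma nn_integral_weight_shift:
  assumes [measurable]: "g \<in> borel_measurable borel"
  shows "(\<integral>\<^sup>+u\<in>{0..}. ennreal (shift_weight u) * wt_norm (\<lambda>s. 1 / sqrt s) (\<lambda>s. g (s + u)) \<partial>lborel) \<le>
    3 * wt_norm (\<lambda>s. 1 / (1 + sqrt s)) g"
proof -
  have shift: "wt_norm (\<lambda>s. 1 / sqrt s) (\<lambda>s. g (s + u)) =
      (\<integral>\<^sup>+s. ennreal (\<bar>g s\<bar> * (1 / sqrt (s - u))) * indicator {u..} s \<partial>lborel)" for u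
    by (subst nn_integral_real_affine[where c = 1 and t = u])
      (auto simp: wt_norm_def indicator_def add.commute intro!: nn_integral_cong)
  have "(\<integral>\<^sup>+u\<in>{0..}. ennreal (shift_weight u) * wt_norm (\<lambda>s. 1 / sqrt s) (\<lambda>s. g (s + u)) \<partial>lborel) =
    (\<integral>\<^sup>+u. \<integral>\<^sup>+s. ennreal (shift_weight u) * (ennreal (\<bar>g s\<bar> * (1 / sqrt (s - u))) * indicator {u..} s) * indicator {0..} u \<partial>lborel \<partial>lborel)"
    unfolding shift by (simp add: nn_integral_cmult nn_integral_multc)
  also have "\<dots> = (\<integral>\<^sup>+s. \<integral>\<^sup>+u. ennreal (shift_weight u) * (ennreal (\<bar>g s\<bar> * (1 / sqrt (s - u))) * indicator {u..} s) * indicator {0..} u \<partial>lborel \<partial>lborel)"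
    by (rule lborel_pair.Fubini') (simp add: indicator_def, measurable)
  also have "\<dots> = (\<integral>\<^sup>+s. \<integral>\<^sup>+u. ennreal \<bar>g s\<bar> * indicator {0..} s * (ennreal (shift_weight u * (1 / sqrt (s - u))) * indicator {0..s} u) \<partial>lborel \<partial>lborel)"
  proof (intro nn_integral_cong)
    fix s u :: real
    show "ennreal (shift_weight u) * (ennreal (\<bar>g s\<bar> * (1 / sqrt (s - u))) * indicator {u..} s) * indicator {0..} u =
       ennreal \<bar>g s\<bar> * indicator {0..} s * (ennreal (shift_weight u * (1 / sqrt (s - u))) * indicator {0..s} u)"
    proof (cases "0 \<le> u \<and> u \<le> s")
      case True
      then show ?thesis using shift_weight_pos[of u]
        by (simp add: ennreal_mult[symmetric] mult.left_commute)
    qed (auto simp: indicator_def)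
  qed
  also have "\<dots> = (\<integral>\<^sup>+s. ennreal \<bar>g s\<bar> * indicator {0..} s * (\<integral>\<^sup>+u. ennreal (shift_weight u * (1 / sqrt (s - u))) * indicator {0..s} u \<partial>lborel) \<partial>lborel)"
    by (subst nn_integral_cmult) measurable
  also have "\<dots> \<le> (\<integral>\<^sup>+s. 3 * (ennreal (\<bar>g s\<bar> * (1 / (1 + sqrt s))) * indicator {0..} s) \<partial>lborel)"
  proof (intro nn_integral_mono)
    fix s :: real
    show "ennreal \<bar>g s\<bar> * indicator {0..} s * (\<integral>\<^sup>+u. ennreal (shift_weight u * (1 / sqrt (s - u))) * indicator {0..s} u \<partial>lborel)
      \<le> 3 * (ennreal (\<bar>g s\<bar> * (1 / (1 + sqrt s))) * indicator {0..} s)"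
    proof (cases "0 \<le> s")
      case True
      have "ennreal \<bar>g s\<bar> * (\<integral>\<^sup>+u. ennreal (shift_weight u * (1 / sqrt (s - u))) * indicator {0..s} u \<partial>lborel)
        \<le> ennreal \<bar>g s\<bar> * ennreal (3 / (1 + sqrt s))"
        by (intro mult_left_mono nn_integral_shift_weight True) auto
      also have "\<dots> = 3 * ennreal (\<bar>g s\<bar> * (1 / (1 + sqrt s)))"
        using True by (simp add: ennreal_mult[symmetric] mult.commute flip: ennreal_numeral)
      finally show ?thesis using True by simp
    qed simp
  qed
  also have "\<dots> = 3 * wt_norm (\<lambda>s. 1 / (1 + sqrt s)) g"
    unfolding wt_norm_def by (subst nn_integral_cmult) measurable
  finally show ?thesis .
qed

subsection \<open>Density of step functions\<close>

text \<open>It tends to 0 exactly when both convergences in the definition of the Wiener integral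
  under \<open>scrW\<close> hold. The analogue for the Bessel process is \<open>bessel_dist\<close>,
  with weight \<open>1 / sqrt s\<close>.\<close>

definition approx_dist :: "(real \<Rightarrow> real) \<Rightarrow> ennreal" where
  "approx_dist g = sq_norm {0..} g + wt_norm (\<lambda>s. 1 / (1 + sqrt s)) g"

lemma approx_dist_diff:
  assumes "f \<in> borel_measurable borel" "g \<in> borel_measurable borel" "h \<in> borel_measurable borel"
  shows "approx_dist (\<lambda>s. f s - g s) \<le> 2 * (approx_dist (\<lambda>s. f s - h s) + approx_dist (\<lambda>s. g s - h s))"
proof -
  let ?w = "\<lambda>s. 1 / (1 + sqrt s)"
  have "wt_norm ?w (\<lambda>s. f s - g s) \<le> wt_norm ?w (\<lambda>s. f s - h s) + wt_norm ?w (\<lambda>s. g s - h s)"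
    using assms by (intro wt_norm_diff) auto
  also have "\<dots> \<le> 2 * (wt_norm ?w (\<lambda>s. f s - h s) + wt_norm ?w (\<lambda>s. g s - h s))"
    by (simp add: mult_2)
  finally have "wt_norm ?w (\<lambda>s. f s - g s) \<le> 2 * (wt_norm ?w (\<lambda>s. f s - h s) + wt_norm ?w (\<lambda>s. g s - h s))" .
  from add_mono[OF sq_norm_diff[OF assms, of "{0..}"] this] show ?thesis
    unfolding approx_dist_def by (simp add: distrib_left ac_simps)
qed

lemma approx_dist_tendsto_0:
  assumes [measurable]: "\<And>n. h n \<in> borel_measurable borel" "H \<in> borel_measurable borel"
    and le: "\<And>n s. 0 \<le> s \<Longrightarrow> \<bar>h n s\<bar> \<le> H s"
    and ae: "AE s in lborel. 0 \<le> s \<longrightarrow> (\<lambda>n. h n s) \<longlonglongrightarrow> 0"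
    and fin: "approx_dist H < \<infinity>"
  shows "(\<lambda>n. approx_dist (h n)) \<longlonglongrightarrow> 0"
proof -
  have "(\<lambda>n. sq_norm {0..} (h n)) \<longlonglongrightarrow> integral\<^sup>N lborel (\<lambda>s::real. 0)"
    unfolding sq_norm_def
  proof (rule nn_integral_dominated_convergence[where w = "\<lambda>s. ennreal ((H s)\<^sup>2) * indicator {0..} s"])
    show "AE s in lborel. (\<lambda>n. ennreal ((h n s)\<^sup>2) * indicator {0..} s) \<longlonglongrightarrow> 0"
      using ae
    proof eventually_elim
      case (elim s)
      have "(\<lambda>n. ennreal ((h n s)\<^sup>2)) \<longlonglongrightarrow> ennreal (0\<^sup>2)" if "0 \<le> s"
        using elim that by (intro tendsto_ennrealI tendsto_power) simp
      then show ?case by (cases "0 \<le> s") simp_all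
    qed
    show "AE s in lborel. ennreal ((h n s)\<^sup>2) * indicator {0..} s \<le> ennreal ((H s)\<^sup>2) * indicator {0..} s" for n
      using le[of _ n] by (intro AE_I2) (auto simp: indicator_def abs_le_square_iff[symmetric] intro!: ennreal_leI order_trans[OF _ abs_ge_self])
    show "(\<integral>\<^sup>+s. ennreal ((H s)\<^sup>2) * indicator {0..} s \<partial>lborel) < \<infinity>"
      using fin by (simp add: approx_dist_def sq_norm_def)
  qed measurable
  moreover have "(\<lambda>n. wt_norm (\<lambda>s. 1 / (1 + sqrt s)) (h n)) \<longlonglongrightarrow> integral\<^sup>N lborel (\<lambda>s::real. 0)"
    unfolding wt_norm_def
  proof (rule nn_integral_dominated_convergence[where w = "\<lambda>s. ennreal (\<bar>H s\<bar> * (1 / (1 + sqrt s))) * indicator {0..} s"])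
    show "AE s in lborel. (\<lambda>n. ennreal (\<bar>h n s\<bar> * (1 / (1 + sqrt s))) * indicator {0..} s) \<longlonglongrightarrow> 0"
      using ae
    proof eventually_elim
      case (elim s)
      have "(\<lambda>n. ennreal (\<bar>h n s\<bar> * (1 / (1 + sqrt s)))) \<longlonglongrightarrow> ennreal (\<bar>0\<bar> * (1 / (1 + sqrt s)))" if "0 \<le> s"
        using elim that by (intro tendsto_ennrealI tendsto_mult tendsto_rabs tendsto_const) simp
      then show ?case by (cases "0 \<le> s") simp_all
    qed
    show "AE s in lborel. ennreal (\<bar>h n s\<bar> * (1 / (1 + sqrt s))) * indicator {0..} s \<le> ennreal (\<bar>H s\<bar> * (1 / (1 + sqrt s))) * indicator {0..} s" for n
      using order_trans[OF le[of _ n] abs_ge_self]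
      by (intro AE_I2) (auto simp: indicator_def intro!: ennreal_leI divide_right_mono)
    show "(\<integral>\<^sup>+s. ennreal (\<bar>H s\<bar> * (1 / (1 + sqrt s))) * indicator {0..} s \<partial>lborel) < \<infinity>"
      using fin by (simp add: approx_dist_def wt_norm_def)
  qed measurable
  ultimately show ?thesis
    unfolding approx_dist_def using tendsto_add by fastforce
qed

lemma approx_dist_const_finite: "approx_dist (\<lambda>s. B * indicator {0..<real N} s) < \<infinity>"
proof -
  have "sq_norm {0..} (\<lambda>s. B * indicator {0..<real N} s) = (\<integral>\<^sup>+s. ennreal (B\<^sup>2) * indicator {0..<real N} s \<partial>lborel)"
    unfolding sq_norm_def by (intro nn_integral_cong) (auto simp: indicator_def)
  also have "\<dots> < \<infinity>"
    by (subst nn_integral_cmult_indicator) (auto simp: ennreal_mult_less_top)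
  finally have "sq_norm {0..} (\<lambda>s. B * indicator {0..<real N} s) < \<infinity>" .
  moreover have "\<bar>B\<bar> * (1 / (1 + sqrt s)) \<le> \<bar>B\<bar>" if "0 \<le> s" for s
    using that by (intro mult_left_le) (auto simp: divide_le_eq_1_pos add_pos_nonneg)
  then have "wt_norm (\<lambda>s. 1 / (1 + sqrt s)) (\<lambda>s. B * indicator {0..<real N} s)
      \<le> (\<integral>\<^sup>+s. ennreal \<bar>B\<bar> * indicator {0..<real N} s \<partial>lborel)"
    unfolding wt_norm_def by (intro nn_integral_mono) (auto simp: indicator_def intro!: ennreal_leI)
  moreover have "(\<integral>\<^sup>+s. ennreal \<bar>B\<bar> * indicator {0..<real N} s \<partial>lborel) < \<infinity>"
    by (subst nn_integral_cmult_indicator) (auto simp: ennreal_mult_less_top)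
  ultimately show ?thesis unfolding approx_dist_def by (auto simp: less_top[symmetric] top_unique)
qed

text \<open>Sample \<open>g\<close> at the left ends of cells of length \<open>1 / Suc m\<close> in
  \<open>[0, N)\<close>. Continuity gives pointwise convergence, and \<open>2 * B\<close> on
  \<open>[0, N)\<close> dominates the error.\<close>

lemma approx_dist_step_continuous:
  assumes cont: "continuous_on UNIV g" and B: "\<And>s. \<bar>g s\<bar> \<le> B" and e: "0 < e"
  shows "\<exists>\<phi>. is_step \<phi> \<and> approx_dist (\<lambda>s. step_fun \<phi> s - g s * indicator {0..<real N} s) < e"
proof -
  have [measurable]: "g \<in> borel_measurable borel"
    using cont by (rule borel_measurable_continuous_onI)
  define \<phi> where "\<phi> m = (Suc m * N, \<lambda>k. real k / real (Suc m), \<lambda>k. g (real k / real (Suc m)))" for m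
  have step: "is_step (\<phi> m)" for m
    by (auto simp: \<phi>_def is_step_def divide_strict_right_mono)
  have val: "step_fun (\<phi> m) s = g (real_of_int \<lfloor>real (Suc m) * s\<rfloor> / real (Suc m)) * indicator {0..<real N} s" if "0 \<le> s" for m s
  proof (cases "s < real N")
    case True
    define k where "k = nat \<lfloor>real (Suc m) * s\<rfloor>"
    have k: "real k = real_of_int \<lfloor>real (Suc m) * s\<rfloor>" using that by (simp add: k_def)
    have "real k \<le> real (Suc m) * s" "real (Suc m) * s < real k + 1" unfolding k by linarith+
    then have s: "s \<in> {real k / real (Suc m)..<real (Suc k) / real (Suc m)}" by (simp add: field_simps)
    have "real (Suc m) * s < real (Suc m) * real N" using True by (intro mult_strict_left_mono) auto
    then have "real k < real (Suc m * N)" using \<open>real k \<le> real (Suc m) * s\<close> unfolding of_nat_mult by linarith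
    then have "k < Suc m * N" by (simp only: of_nat_less_iff)
    from step_fun_on(1)[OF step[of m, unfolded \<phi>_def] this s] show ?thesis
      using True that by (simp add: \<phi>_def k)
  next
    case False
    have "step_fun (\<phi> m) s = 0"
      unfolding \<phi>_def step_fun_def prod.case
    proof (intro sum.neutral ballI)
      fix k assume "k \<in> {..<Suc m * N}"
      then have "Suc k \<le> Suc m * N" by simp
      then have "real (Suc k) \<le> real (Suc m) * real N" by (metis of_nat_mono of_nat_mult)
      then have "real (Suc k) / real (Suc m) \<le> real N" by (simp add: field_simps)
      then show "g (real k / real (Suc m)) * indicator {real k / real (Suc m)..<real (Suc k) / real (Suc m)} s = 0"
        using False by (auto simp: indicator_def)
    qed
    then show ?thesis using False by simp
  qed
  have B0: "0 \<le> B" using B[of 0] by simp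
  have "(\<lambda>m. approx_dist (\<lambda>s. step_fun (\<phi> m) s - g s * indicator {0..<real N} s)) \<longlonglongrightarrow> 0"
  proof (rule approx_dist_tendsto_0[where H = "\<lambda>s. (2 * B) * indicator {0..<real N} s"])
    show "\<bar>step_fun (\<phi> m) s - g s * indicator {0..<real N} s\<bar> \<le> 2 * B * indicator {0..<real N} s" if "0 \<le> s" for m s
      using B[of s] B[of "real_of_int \<lfloor>real (Suc m) * s\<rfloor> / real (Suc m)"] B0
      by (auto simp: val[OF that] indicator_def)
    show "AE s in lborel. 0 \<le> s \<longrightarrow> (\<lambda>m. step_fun (\<phi> m) s - g s * indicator {0..<real N} s) \<longlonglongrightarrow> 0"
    proof (intro AE_I2 impI)
      fix s :: real assume s: "0 \<le> s"
      have "(\<lambda>m. real_of_int \<lfloor>real (Suc m) * s\<rfloor> / real (Suc m)) \<longlonglongrightarrow> s"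
      proof (rule LIMSEQ_I)
        fix r :: real assume "0 < r"
        then obtain M where M: "inverse (real (Suc M)) < r" using reals_Archimedean by blast
        show "\<exists>no. \<forall>n\<ge>no. norm (real_of_int \<lfloor>real (Suc n) * s\<rfloor> / real (Suc n) - s) < r"
        proof (intro exI allI impI)
          fix n assume "M \<le> n"
          have "\<bar>real_of_int \<lfloor>real (Suc n) * s\<rfloor> - real (Suc n) * s\<bar> \<le> 1" by linarith
          then have "\<bar>real_of_int \<lfloor>real (Suc n) * s\<rfloor> - real (Suc n) * s\<bar> / real (Suc n) \<le> inverse (real (Suc n))"
            by (simp add: divide_right_mono inverse_eq_divide del: of_nat_Suc)
          also have "\<bar>real_of_int \<lfloor>real (Suc n) * s\<rfloor> - real (Suc n) * s\<bar> / real (Suc n) = \<bar>(real_of_int \<lfloor>real (Suc n) * s\<rfloor> - real (Suc n) * s) / real (Suc n)\<bar>"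
            by (simp add: abs_divide del: of_nat_Suc)
          also have "(real_of_int \<lfloor>real (Suc n) * s\<rfloor> - real (Suc n) * s) / real (Suc n) = real_of_int \<lfloor>real (Suc n) * s\<rfloor> / real (Suc n) - s"
            by (simp add: diff_divide_distrib del: of_nat_Suc)
          also have "inverse (real (Suc n)) \<le> inverse (real (Suc M))" using \<open>M \<le> n\<close> by (intro le_imp_inverse_le) auto
          finally show "norm (real_of_int \<lfloor>real (Suc n) * s\<rfloor> / real (Suc n) - s) < r" using M by simp
        qed
      qed
      moreover have "isCont g s" using cont by (simp add: continuous_on_eq_continuous_at)
      ultimately have "(\<lambda>m. g (real_of_int \<lfloor>real (Suc m) * s\<rfloor> / real (Suc m))) \<longlonglongrightarrow> g s"
        by (rule isCont_tendsto_compose[rotated])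
      then have "(\<lambda>m. g (real_of_int \<lfloor>real (Suc m) * s\<rfloor> / real (Suc m)) * indicator {0..<real N} s - g s * indicator {0..<real N} s)
         \<longlonglongrightarrow> g s * indicator {0..<real N} s - g s * indicator {0..<real N} s"
        by (intro tendsto_diff tendsto_mult tendsto_const)
      then show "(\<lambda>m. step_fun (\<phi> m) s - g s * indicator {0..<real N} s) \<longlonglongrightarrow> 0"
        by (simp only: val[OF s] diff_self)
    qed
    show "approx_dist (\<lambda>s. 2 * B * indicator {0..<real N} s) < \<infinity>" by (rule approx_dist_const_finite)
  qed measurable
  from order_tendstoD(2)[OF this e] obtain m where
    "approx_dist (\<lambda>s. step_fun (\<phi> m) s - g s * indicator {0..<real N} s) < e"
    by (auto simp: eventually_sequentially)
  with step show ?thesis by blast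
qed

lemma approx_dist_minus_commute: "approx_dist (\<lambda>s. f s - g s) = approx_dist (\<lambda>s. g s - f s)"
  unfolding approx_dist_def sq_norm_def wt_norm_def by (simp add: power2_commute abs_minus_commute)

text \<open>Quarters instead of halves, because \<open>approx_dist\<close> satisfies the triangle
  inequality only up to the factor 2.\<close>

lemma approx_dist_triangle_half:
  assumes "f \<in> borel_measurable borel" "g \<in> borel_measurable borel" "h \<in> borel_measurable borel"
    and "approx_dist (\<lambda>s. f s - h s) < ennreal (e / 4)" "approx_dist (\<lambda>s. h s - g s) < ennreal (e / 4)" "0 < e"
  shows "approx_dist (\<lambda>s. f s - g s) < ennreal e"
proof -
  have "approx_dist (\<lambda>s. f s - g s) \<le> 2 * (approx_dist (\<lambda>s. f s - h s) + approx_dist (\<lambda>s. h s - g s))"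
    using approx_dist_diff[OF assms(1-3)] by (simp add: approx_dist_minus_commute[of g h])
  also have "\<dots> < 2 * (ennreal (e / 4) + ennreal (e / 4))"
    using assms(4,5) by (intro ennreal_mult_strict_left_mono add_strict_mono) auto
  also have "\<dots> = ennreal e"
    using \<open>0 < e\<close> by (simp add: ennreal_plus[symmetric] ennreal_mult[symmetric] flip: ennreal_numeral del: ennreal_plus)
  finally show ?thesis .
qed

text \<open>A measurable function is almost everywhere a limit of continuous ones. Clipping these at
  \<open>B\<close> keeps them continuous, leaves the limit unchanged and supplies the dominating
  function.\<close>

lemma approx_dist_step_bounded:
  assumes [measurable]: "f \<in> borel_measurable borel" and B: "\<And>s. \<bar>f s\<bar> \<le> B" and e: "0 < e"
  shows "\<exists>\<phi>. is_step \<phi> \<and> approx_dist (\<lambda>s. step_fun \<phi> s - f s * indicator {0..<real N} s) < ennreal e"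
proof -
  have "f measurable_on UNIV"
    by (rule lebesgue_measurable_imp_measurable_on) (auto intro: measurable_completion)
  then obtain A g where A: "negligible A" and cont: "\<And>n. continuous_on UNIV (g n)"
    and lim: "\<And>s. s \<notin> A \<Longrightarrow> (\<lambda>n. g n s) \<longlonglongrightarrow> f s"
    by (auto simp: measurable_on_def)
  have B0: "0 \<le> B" using B[of 0] by simp
  define h where "h n s = max (- B) (min B (g n s))" for n and s :: real
  have hc: "continuous_on UNIV (h n)" for n unfolding h_def by (intro continuous_intros cont)
  have [measurable]: "h n \<in> borel_measurable borel" for n
    using hc by (rule borel_measurable_continuous_onI)
  have hB: "\<bar>h n s\<bar> \<le> B" for n s using B0 by (auto simp: h_def)
  have "(\<lambda>n. approx_dist (\<lambda>s. h n s * indicator {0..<real N} s - f s * indicator {0..<real N} s)) \<longlonglongrightarrow> 0"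
  proof (rule approx_dist_tendsto_0[where H = "\<lambda>s. (2 * B) * indicator {0..<real N} s"])
    show "\<bar>h n s * indicator {0..<real N} s - f s * indicator {0..<real N} s\<bar> \<le> 2 * B * indicator {0..<real N} s" for n s
      using B[of s] hB[of n s] B0 by (auto simp: indicator_def)
    have "AE s in lebesgue. s \<notin> A" using A by (intro AE_not_in) (simp add: negligible_iff_null_sets)
    then have "AE s in lborel. s \<notin> A" by (simp add: AE_completion_iff)
    then show "AE s in lborel. 0 \<le> s \<longrightarrow> (\<lambda>n. h n s * indicator {0..<real N} s - f s * indicator {0..<real N} s) \<longlonglongrightarrow> 0"
    proof eventually_elim
      case (elim s)
      have "(\<lambda>n. h n s) \<longlonglongrightarrow> max (- B) (min B (f s))"
        unfolding h_def by (intro tendsto_max tendsto_min tendsto_const lim elim)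
      also have "max (- B) (min B (f s)) = f s" using B[of s] by (auto simp: abs_le_iff)
      finally have "(\<lambda>n. h n s * indicator {0..<real N} s - f s * indicator {0..<real N} s)
         \<longlonglongrightarrow> f s * indicator {0..<real N} s - f s * indicator {0..<real N} s"
        by (intro tendsto_diff tendsto_mult tendsto_const)
      then show ?case by simp
    qed
    show "approx_dist (\<lambda>s. 2 * B * indicator {0..<real N} s) < \<infinity>" by (rule approx_dist_const_finite)
  qed measurable
  from order_tendstoD(2)[OF this, of "ennreal (e / 4)"] e obtain n where
    1: "approx_dist (\<lambda>s. h n s * indicator {0..<real N} s - f s * indicator {0..<real N} s) < ennreal (e / 4)"
    by (auto simp: eventually_sequentially)
  have e4: "0 < ennreal (e / 4)" using e by simp
  obtain \<phi> where \<phi>: "is_step \<phi>" and 2: "approx_dist (\<lambda>s. step_fun \<phi> s - h n s * indicator {0..<real N} s) < ennreal (e / 4)"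
    using approx_dist_step_continuous[OF hc hB e4] by blast
  have "approx_dist (\<lambda>s. step_fun \<phi> s - f s * indicator {0..<real N} s) < ennreal e"
    by (rule approx_dist_triangle_half[OF _ _ _ 2 1 e]) measurable
  with \<phi> show ?thesis by blast
qed

text \<open>Truncation at level \<open>n\<close> in value and in time moves \<open>f\<close> towards
  0, so the error is dominated by \<open>\<bar>f s\<bar>\<close> and vanishes for large
  \<open>n\<close> at each point.\<close>

lemma approx_dist_step:
  assumes [measurable]: "f \<in> borel_measurable borel" and fin: "approx_dist f < \<infinity>" and e: "0 < e"
  shows "\<exists>\<phi>. is_step \<phi> \<and> approx_dist (\<lambda>s. step_fun \<phi> s - f s) < ennreal e"
proof -
  define h where "h n s = max (- real n) (min (real n) (f s))" for n s
  have [measurable]: "h n \<in> borel_measurable borel" for n unfolding h_def by measurable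
  have "(\<lambda>n. approx_dist (\<lambda>s. h n s * indicator {0..<real n} s - f s)) \<longlonglongrightarrow> 0"
  proof (rule approx_dist_tendsto_0[where H = "\<lambda>s. \<bar>f s\<bar>"])
    show "\<bar>h n s * indicator {0..<real n} s - f s\<bar> \<le> \<bar>f s\<bar>" for n s
      by (auto simp: h_def indicator_def)
    show "AE s in lborel. 0 \<le> s \<longrightarrow> (\<lambda>n. h n s * indicator {0..<real n} s - f s) \<longlonglongrightarrow> 0"
    proof (intro AE_I2 impI)
      fix s :: real assume s: "0 \<le> s"
      obtain n0 where n0: "max \<bar>f s\<bar> (s + 1) \<le> real n0" using real_arch_simple by blast
      have "h n s * indicator {0..<real n} s - f s = 0" if "n0 \<le> n" for n
        using that n0 s by (auto simp: h_def indicator_def)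
      then have "\<forall>\<^sub>F n in sequentially. h n s * indicator {0..<real n} s - f s = 0"
        by (auto simp: eventually_sequentially)
      then show "(\<lambda>n. h n s * indicator {0..<real n} s - f s) \<longlonglongrightarrow> 0" by (rule tendsto_eventually)
    qed
    show "approx_dist (\<lambda>s. \<bar>f s\<bar>) < \<infinity>" using fin by (simp add: approx_dist_def sq_norm_def wt_norm_def)
  qed measurable
  from order_tendstoD(2)[OF this, of "ennreal (e / 4)"] e obtain n where
    1: "approx_dist (\<lambda>s. h n s * indicator {0..<real n} s - f s) < ennreal (e / 4)"
    by (auto simp: eventually_sequentially)
  have e4: "0 < e / 4" using e by simp
  have hn: "\<bar>h n s\<bar> \<le> real n" for s by (auto simp: h_def)
  obtain \<phi> where \<phi>: "is_step \<phi>" and 2: "approx_dist (\<lambda>s. step_fun \<phi> s - h n s * indicator {0..<real n} s) < ennreal (e / 4)"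
    using approx_dist_step_bounded[of "h n" "real n" "e / 4" n] e4 hn by (auto simp del: split_paired_Ex)
  have "approx_dist (\<lambda>s. step_fun \<phi> s - f s) < ennreal e"
    by (rule approx_dist_triangle_half[OF _ _ _ 2 1 e]) measurable
  with \<phi> show ?thesis by blast
qed

subsection \<open>Measurability of path functionals\<close>

lemma space_path_space: "space (path_space I) = {X \<in> extensional I. continuous_on I X}"
  by (auto simp: path_space_def space_restrict_space space_PiM PiE_def)

lemma measurable_eval: "s \<in> I \<Longrightarrow> (\<lambda>X. X s) \<in> borel_measurable (path_space I)"
  unfolding path_space_def by (intro measurable_restrict_space1 measurable_component_singleton)

lemma measurable_path_spaceI:
  assumes "\<And>t. t \<in> I \<Longrightarrow> (\<lambda>x. f x t) \<in> borel_measurable M"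
    and "\<And>x. x \<in> space M \<Longrightarrow> f x \<in> extensional I"
    and "\<And>x. x \<in> space M \<Longrightarrow> continuous_on I (f x)"
  shows "f \<in> measurable M (path_space I)"
  unfolding path_space_def
proof (rule measurable_restrict_space2)
  show "f \<in> M \<rightarrow>\<^sub>M Pi\<^sub>M I (\<lambda>s. borel)"
    using assms(1,2) by (intro measurable_PiM_single'[of I "\<lambda>i x. f x i"]) (auto simp: PiE_def)
qed (use assms(3) in auto)

text \<open>Continuity of paths is essential: replace the time by its lower neighbour on the grid of
  mesh \<open>1 / Suc n\<close>, which has countably many values, and pass to the limit.\<close>

lemma measurable_eval_joint:
  "(\<lambda>(u, X :: real \<Rightarrow> 'a::euclidean_space). X u) \<in>
    borel_measurable (restrict_space borel {0..} \<Otimes>\<^sub>M path_space {0..})"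
proof -
  let ?M = "restrict_space borel {0..} \<Otimes>\<^sub>M path_space {0..} :: (real \<times> (real \<Rightarrow> 'a)) measure"
  define k where "k n u = real (nat \<lfloor>real (Suc n) * u\<rfloor>) / real (Suc n)" for n u
  show ?thesis
  proof (rule borel_measurable_LIMSEQ_metric[where f = "\<lambda>n (u, X). X (k n u)"])
    show "(\<lambda>(u, X). X (k n u)) \<in> borel_measurable ?M" for n
    proof -
      have "(\<lambda>p. (\<lambda>i p. snd p (real i / real (Suc n))) (nat \<lfloor>real (Suc n) * fst p\<rfloor>) p) \<in> borel_measurable ?M"
      proof (rule measurable_compose_countable[where f = "\<lambda>i p. snd p (real i / real (Suc n))"])
        show "(\<lambda>p. snd p (real i / real (Suc n))) \<in> borel_measurable ?M" for i
          by (rule measurable_compose[OF measurable_snd measurable_eval]) simp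
        have "(\<lambda>p. fst p) \<in> borel_measurable ?M"
          by (rule measurable_compose[OF measurable_fst]) (simp add: measurable_restrict_space1)
        then show "(\<lambda>p. nat \<lfloor>real (Suc n) * fst p\<rfloor>) \<in> ?M \<rightarrow>\<^sub>M count_space UNIV" by measurable
      qed
      then show ?thesis by (simp add: k_def case_prod_beta')
    qed
    fix p assume "p \<in> space ?M"
    then obtain u X where p: "p = (u, X)" and u: "0 \<le> u" and X: "continuous_on {0..} X"
      by (auto simp: space_pair_measure space_restrict_space space_path_space)
    have kb: "0 \<le> k n u" "\<bar>k n u - u\<bar> \<le> inverse (real (Suc n))" for n
    proof -
      have "real (nat \<lfloor>real (Suc n) * u\<rfloor>) = real_of_int \<lfloor>real (Suc n) * u\<rfloor>" using u by simp
      then have "\<bar>real (nat \<lfloor>real (Suc n) * u\<rfloor>) - real (Suc n) * u\<bar> \<le> 1" by linarith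
      then have "\<bar>real (nat \<lfloor>real (Suc n) * u\<rfloor>) - real (Suc n) * u\<bar> / real (Suc n) \<le> inverse (real (Suc n))"
        by (simp add: divide_right_mono inverse_eq_divide del: of_nat_Suc)
      also have "\<bar>real (nat \<lfloor>real (Suc n) * u\<rfloor>) - real (Suc n) * u\<bar> / real (Suc n) = \<bar>(real (nat \<lfloor>real (Suc n) * u\<rfloor>) - real (Suc n) * u) / real (Suc n)\<bar>"
        by (simp add: abs_divide del: of_nat_Suc)
      also have "(real (nat \<lfloor>real (Suc n) * u\<rfloor>) - real (Suc n) * u) / real (Suc n) = k n u - u"
        by (simp add: k_def diff_divide_distrib del: of_nat_Suc)
      finally show "\<bar>k n u - u\<bar> \<le> inverse (real (Suc n))" .
      show "0 \<le> k n u" by (simp add: k_def)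
    qed
    have "(\<lambda>n. k n u - u) \<longlonglongrightarrow> 0"
      by (rule Lim_null_comparison[OF _ LIMSEQ_inverse_real_of_nat]) (simp add: kb(2) del: of_nat_Suc)
    then have "(\<lambda>n. k n u) \<longlonglongrightarrow> u" by (simp add: LIM_zero_iff)
    then have "(\<lambda>n. X (k n u)) \<longlonglongrightarrow> X u"
      using X u kb(1) by (intro continuous_on_tendsto_compose[OF X]) auto
    then show "(\<lambda>n. case p of (u, X) \<Rightarrow> X (k n u)) \<longlonglongrightarrow> (case p of (u, X) \<Rightarrow> X u)"
      by (simp add: p)
  qed
qed

lemma measurable_step_integral:
  assumes "is_step \<phi>"
  shows "step_integral \<phi> \<in> borel_measurable (path_space {0..})"
proof -
  obtain n t c where \<phi>: "\<phi> = (n, t, c)" by (cases \<phi>)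
  show ?thesis
    using is_step_nonneg[OF assms[unfolded \<phi>]] unfolding \<phi> step_integral_def prod.case
    by (intro borel_measurable_sum borel_measurable_times borel_measurable_diff borel_measurable_const measurable_eval) auto
qed

lemma measurable_step_integral_upto:
  assumes "is_step \<phi>" "0 \<le> u"
  shows "step_integral_upto u \<phi> \<in> borel_measurable (path_space {0..u})"
proof -
  obtain n t c where \<phi>: "\<phi> = (n, t, c)" by (cases \<phi>)
  show ?thesis
    using is_step_nonneg[OF assms(1)[unfolded \<phi>]] assms(2)
    unfolding \<phi> step_integral_def step_integral_upto_def prod.case
    by (intro borel_measurable_sum borel_measurable_times borel_measurable_diff borel_measurable_const measurable_eval) auto
qed

section \<open>Measurable maps between path spaces\<close>

definition bridge_path :: "real \<Rightarrow> (real \<Rightarrow> real) \<Rightarrow> real \<Rightarrow> real" where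
  "bridge_path u X = (\<lambda>s\<in>{0..u}. X s - s / u * X u)"

lemma brownian_bridge_eq: "brownian_bridge W u = distr W (path_space {0..u}) (bridge_path u)"
  by (simp add: brownian_bridge_def bridge_path_def[abs_def])

lemma measurable_bridge_path:
  assumes "0 \<le> u"
  shows "bridge_path u \<in> path_space {0..} \<rightarrow>\<^sub>M path_space {0..u}"
proof (rule measurable_path_spaceI)
  show "(\<lambda>X. bridge_path u X t) \<in> borel_measurable (path_space {0..})" if "t \<in> {0..u}" for t
    using that assms unfolding bridge_path_def
    by (simp, intro borel_measurable_times borel_measurable_divide borel_measurable_diff borel_measurable_const measurable_eval) auto
  fix X :: "real \<Rightarrow> real" assume "X \<in> space (path_space {0..})"
  then have "continuous_on {0..u} X" by (auto simp: space_path_space elim: continuous_on_subset)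
  then have "continuous_on {0..u} (\<lambda>s. X s - s / u * X u)"
    unfolding divide_inverse by (intro continuous_intros) auto
  then show "continuous_on {0..u} (bridge_path u X)"
    by (rule continuous_on_eq) (simp add: bridge_path_def)
qed (simp add: bridge_path_def)

lemma concat_path_measurable:
  assumes "0 \<le> u"
  shows "(\<lambda>(X, Y). concat_path u X Y) \<in> path_space {0..u} \<Otimes>\<^sub>M path_space {0..} \<rightarrow>\<^sub>M path_space {0..}"
proof (rule measurable_path_spaceI)
  let ?M = "path_space {0..u} \<Otimes>\<^sub>M path_space {0..} :: ((real \<Rightarrow> real) \<times> (real \<Rightarrow> real)) measure"
  have [measurable]: "(\<lambda>p. fst p s) \<in> borel_measurable ?M" if "s \<in> {0..u}" for s
    by (rule measurable_compose[OF measurable_fst measurable_eval[OF that]])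
  have [measurable]: "(\<lambda>p. snd p s) \<in> borel_measurable ?M" if "s \<in> {0..}" for s
    by (rule measurable_compose[OF measurable_snd measurable_eval[OF that]])
  fix t :: real assume t: "t \<in> {0..}"
  have "(\<lambda>p. concat_path u (fst p) (snd p) t) \<in> borel_measurable ?M"
  proof (cases "t < u")
    case True
    then have "(\<lambda>p. concat_path u (fst p) (snd p) t) = (\<lambda>p. fst p t)"
      using t by (auto simp: concat_path_def)
    then show ?thesis using True t by simp
  next
    case False
    then have "(\<lambda>p. concat_path u (fst p) (snd p) t) = (\<lambda>p. if fst p u = snd p 0 then snd p (t - u) else fst p u)"
      using t by (auto simp: concat_path_def)
    moreover have "(\<lambda>p. if fst p u = snd p 0 then snd p (t - u) else fst p u) \<in> borel_measurable ?M"
      using False t assms by (intro measurable_If borel_measurable_eq) measurable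
    ultimately show ?thesis by simp
  qed
  then show "(\<lambda>p. (case p of (X, Y) \<Rightarrow> concat_path u X Y) t) \<in> borel_measurable ?M"
    by (simp add: case_prod_beta')
next
  fix p :: "(real \<Rightarrow> real) \<times> (real \<Rightarrow> real)"
  assume "p \<in> space (path_space {0..u} \<Otimes>\<^sub>M path_space {0..})"
  then obtain X Y where p: "p = (X, Y)" and X: "continuous_on {0..u} X" and Y: "continuous_on {0..} Y"
    by (auto simp: space_pair_measure space_path_space)
  \<comment> \<open>\<open>h u = X u\<close> in both cases of the conditional, so the two pieces
    meet continuously at \<open>u\<close>.\<close>
  define h where "h = (\<lambda>t. if X u = Y 0 then Y (t - u) else X u)"
  have "continuous_on {0..} (\<lambda>t. if t \<le> u then X t else h t)"
  proof (rule continuous_on_cases_le[where h = "\<lambda>t. t"])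
    show "continuous_on {t \<in> {0..}. t \<le> u} X" by (rule continuous_on_subset[OF X]) auto
    have "continuous_on {t \<in> {0..}. u \<le> t} (\<lambda>t. Y (t - u))"
      by (rule continuous_on_compose2[OF Y]) (auto intro: continuous_intros)
    then show "continuous_on {t \<in> {0..}. u \<le> t} h" by (cases "X u = Y 0") (simp_all add: h_def)
  qed (auto simp: h_def intro: continuous_intros)
  moreover have "(if t \<le> u then X t else h t) = concat_path u X Y t" if "t \<in> {0..}" for t
    using that by (auto simp: concat_path_def h_def)
  ultimately have "continuous_on {0..} (concat_path u X Y)"
    by (rule continuous_on_eq)
  then show "continuous_on {0..} (case p of (X, Y) \<Rightarrow> concat_path u X Y)"
    by (simp add: p)
  show "(case p of (X, Y) \<Rightarrow> concat_path u X Y) \<in> extensional {0..}"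
    by (simp add: p concat_path_def)
qed

definition neg_path :: "(real \<Rightarrow> real) \<Rightarrow> real \<Rightarrow> real" where
  "neg_path X = (\<lambda>t\<in>{0..}. - X t)"

lemma measurable_neg_path: "neg_path \<in> path_space {0..} \<rightarrow>\<^sub>M path_space {0..}"
proof (rule measurable_path_spaceI)
  show "(\<lambda>X. neg_path X t) \<in> borel_measurable (path_space {0..})" if "t \<in> {0..}" for t
    using that unfolding neg_path_def
    by (simp, intro borel_measurable_uminus measurable_eval) auto
  fix X :: "real \<Rightarrow> real" assume "X \<in> space (path_space {0..})"
  then have "continuous_on {0..} (\<lambda>s. - X s)" by (auto simp: space_path_space intro: continuous_intros)
  then show "continuous_on {0..} (neg_path X)" by (rule continuous_on_eq) (simp add: neg_path_def)
qed (simp add: neg_path_def)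

definition norm_path :: "(real \<Rightarrow> 'b::euclidean_space) \<Rightarrow> real \<Rightarrow> real" where
  "norm_path X = (\<lambda>t\<in>{0..}. norm (X t))"

lemma measurable_norm_path:
  "(norm_path :: (real \<Rightarrow> 'a::euclidean_space) \<Rightarrow> _) \<in> path_space {0..} \<rightarrow>\<^sub>M path_space {0..}"
proof (rule measurable_path_spaceI)
  show "(\<lambda>X. norm_path X t) \<in> borel_measurable (path_space {0..})" if "t \<in> {0..}" for t
    using measurable_compose[OF measurable_eval[OF that], of norm borel] that by (simp add: norm_path_def)
  fix X :: "real \<Rightarrow> 'a" assume "X \<in> space (path_space {0..})"
  then have "continuous_on {0..} (\<lambda>s. norm (X s))" by (auto simp: space_path_space intro: continuous_intros)
  then show "continuous_on {0..} (norm_path X)" by (rule continuous_on_eq) (simp add: norm_path_def)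
qed (simp add: norm_path_def)

lemma measurable_cong_path: "sets W = sets (path_space I) \<Longrightarrow> f \<in> path_space I \<rightarrow>\<^sub>M N \<Longrightarrow> f \<in> W \<rightarrow>\<^sub>M N"
  using measurable_cong_sets by blast

lemma sets_sym_bessel3 [simp]: "sets (sym_bessel3 W) = sets (path_space {0..})"
  and space_sym_bessel3 [simp]: "space (sym_bessel3 W) = space (path_space {0..})"
  unfolding sym_bessel3_def by (simp_all add: sets.space_closed)

lemma emeasure_sym_bessel3:
  assumes "A \<in> sets (path_space {0..})"
  shows "emeasure (sym_bessel3 W) A = (emeasure (bessel3 W) A + emeasure (bessel3_minus W) A) / 2"
  unfolding sym_bessel3_def
proof (rule emeasure_measure_of_sigma[OF sets.sigma_algebra_axioms _ _ assms])
  let ?P = "sets (path_space {0..} :: (real \<Rightarrow> real) measure)"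
  show "positive ?P (\<lambda>A. (emeasure (bessel3 W) A + emeasure (bessel3_minus W) A) / 2)"
    by (simp add: positive_def)
  show "countably_additive ?P (\<lambda>A. (emeasure (bessel3 W) A + emeasure (bessel3_minus W) A) / 2)"
  proof (rule countably_additiveI)
    fix F :: "nat \<Rightarrow> (real \<Rightarrow> real) set" assume F: "range F \<subseteq> ?P" "disjoint_family F"
    have "range F \<subseteq> sets (bessel3 W)" "range F \<subseteq> sets (bessel3_minus W)"
      using F by (simp_all add: bessel3_def bessel3_minus_def)
    then have "(\<Sum>i. emeasure (bessel3 W) (F i)) = emeasure (bessel3 W) (\<Union>i. F i)"
        "(\<Sum>i. emeasure (bessel3_minus W) (F i)) = emeasure (bessel3_minus W) (\<Union>i. F i)"
      using F(2) by (auto intro: suminf_emeasure)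
    then show "(\<Sum>i. (emeasure (bessel3 W) (F i) + emeasure (bessel3_minus W) (F i)) / 2) =
      (emeasure (bessel3 W) (\<Union>i. F i) + emeasure (bessel3_minus W) (\<Union>i. F i)) / 2"
      by (simp add: divide_ennreal_def suminf_add[symmetric])
  qed
qed

text \<open>For an event invariant under a change of sign both halves of the mixture agree. The
  events used later, on the size of a step integral, the size of the path at a time, and its start,
  are all of this kind.\<close>

lemma emeasure_sym_bessel3_symmetric:
  fixes W :: "(real \<Rightarrow> real ^ 3) measure"
  assumes W: "sets W = sets (path_space {0..})" and A: "A \<in> sets (path_space {0..})"
    and sym: "\<And>X. X \<in> space (path_space {0..}) \<Longrightarrow> neg_path X \<in> A \<longleftrightarrow> X \<in> A"
  shows "emeasure (sym_bessel3 W) A = emeasure W {X \<in> space W. norm_path X \<in> A}"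
proof -
  have n: "norm_path \<in> W \<rightarrow>\<^sub>M path_space {0..}" using measurable_norm_path W by (rule measurable_cong_path[rotated])
  have 1: "bessel3 W = distr W (path_space {0..}) norm_path"
    by (simp add: bessel3_def norm_path_def[abs_def])
  have "emeasure (bessel3_minus W) A = emeasure (distr (bessel3 W) (path_space {0..}) neg_path) A"
    by (simp add: bessel3_minus_def neg_path_def[abs_def])
  also have "\<dots> = emeasure (bessel3 W) (neg_path -` A \<inter> space (bessel3 W))"
    using A measurable_neg_path by (intro emeasure_distr) (auto simp: 1)
  also have "neg_path -` A \<inter> space (bessel3 W) = A"
    using sym sets.sets_into_space[OF A] by (auto simp: 1)
  finally have "emeasure (sym_bessel3 W) A = (emeasure (bessel3 W) A + emeasure (bessel3 W) A) / 2"
    using A by (simp add: emeasure_sym_bessel3)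
  also have "\<dots> = emeasure (bessel3 W) A"
    by (simp add: mult_2[symmetric] ennreal_mult_divide_eq mult.commute[of 2])
  also have "\<dots> = emeasure W {X \<in> space W. norm_path X \<in> A}"
    unfolding 1 using n A by (subst emeasure_distr) (auto intro!: arg_cong2[where f = emeasure])
  finally show ?thesis .
qed

section \<open>The bridge, Bessel and concatenated laws\<close>

lemma wiener_lawD:
  assumes "wiener_law W"
  shows "prob_space W" "sets W = sets (path_space {0..})" "AE X in W. X 0 = 0"
    "\<And>n t. (\<And>k. k < n \<Longrightarrow> 0 \<le> t k \<and> t k \<le> t (Suc k)) \<Longrightarrow>
        prob_space.indep_vars W (\<lambda>_. borel) (\<lambda>k X. X (t (Suc k)) - X (t k)) {..<n}"
    "\<And>s t. 0 \<le> s \<Longrightarrow> s < t \<Longrightarrow> distributed W lborel (\<lambda>X. X t - X s)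
          (\<lambda>x. ennreal (\<Prod>b\<in>Basis. normal_density 0 (sqrt (t - s)) (x \<bullet> b)))"
  using assms by (auto simp: wiener_law_def)

lemma prob_space_brownian_bridge:
  assumes "wiener_law W" "0 \<le> u"
  shows "prob_space (brownian_bridge W u)"
  unfolding brownian_bridge_eq
  using wiener_lawD(1,2)[OF assms(1)] measurable_bridge_path[OF assms(2)]
  by (intro prob_space.prob_space_distr) (auto intro: measurable_cong_path)

lemma prob_space_sym_bessel3:
  assumes "wiener_law W"
  shows "prob_space (sym_bessel3 W)"
proof (rule prob_spaceI)
  have "emeasure (sym_bessel3 W) (space (path_space {0..})) = emeasure W {X \<in> space W. norm_path X \<in> space (path_space {0..})}"
    using wiener_lawD(2)[OF assms] measurable_space[OF measurable_neg_path]
    by (intro emeasure_sym_bessel3_symmetric) auto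
  also have "{X \<in> space W. norm_path X \<in> space (path_space {0..})} = space W"
    using measurable_space[OF measurable_cong_path[OF wiener_lawD(2)[OF assms] measurable_norm_path]] by auto
  finally show "emeasure (sym_bessel3 W) (space (sym_bessel3 W)) = 1"
    using prob_space.emeasure_space_1[OF wiener_lawD(1)[OF assms]] by simp
qed

text \<open>Moves the dependence on \<open>u\<close> from the measure into the map: the source
  \<open>W1 \<Otimes>\<^sub>M R\<close> is the same for all \<open>u\<close>. This is what makes the
  kernel accessible to \<open>measurable_distr2\<close>.\<close>

lemma concat_law_eq:
  assumes W: "wiener_law W1" and R: "prob_space R" "sets R = sets (path_space {0..})" and u: "0 \<le> u"
  shows "concat_law u (brownian_bridge W1 u) R =
    distr (W1 \<Otimes>\<^sub>M R) (path_space {0..}) (\<lambda>(B, Y). concat_path u (bridge_path u B) Y)"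
proof -
  interpret R: prob_space R by fact
  have b: "bridge_path u \<in> W1 \<rightarrow>\<^sub>M path_space {0..u}"
    using measurable_bridge_path[OF u] wiener_lawD(2)[OF W] by (rule measurable_cong_path[rotated])
  have c: "(\<lambda>(X, Y). concat_path u X Y) \<in> path_space {0..u} \<Otimes>\<^sub>M R \<rightarrow>\<^sub>M path_space {0..}"
    using concat_path_measurable[OF u] R(2) by (simp cong: measurable_cong_sets sets_pair_measure_cong)
  have "brownian_bridge W1 u \<Otimes>\<^sub>M R = distr W1 (path_space {0..u}) (bridge_path u) \<Otimes>\<^sub>M distr R R (\<lambda>x. x)"
    by (simp add: brownian_bridge_eq)
  also have "\<dots> = distr (W1 \<Otimes>\<^sub>M R) (path_space {0..u} \<Otimes>\<^sub>M R) (\<lambda>(x, y). (bridge_path u x, y))"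
    using b by (intro pair_measure_distr) (auto simp: R.sigma_finite_measure_axioms)
  finally have eq: "brownian_bridge W1 u \<Otimes>\<^sub>M R = distr (W1 \<Otimes>\<^sub>M R) (path_space {0..u} \<Otimes>\<^sub>M R) (\<lambda>(x, y). (bridge_path u x, y))" .
  have "(\<lambda>(x, y). (bridge_path u x, y)) \<in> W1 \<Otimes>\<^sub>M R \<rightarrow>\<^sub>M path_space {0..u} \<Otimes>\<^sub>M R"
    using b by measurable
  then show ?thesis
    unfolding concat_law_def eq by (subst distr_distr[OF c]) (simp_all add: comp_def case_prod_beta')
qed

text \<open>By \<open>concat_law_eq\<close> it suffices that the path is measurable jointly in
  \<open>u\<close> and the two source paths. Coordinates at times depending on \<open>u\<close> are
  handled by \<open>measurable_eval_joint\<close>.\<close>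

lemma concat_law_kernel:
  assumes W: "wiener_law W1" and R: "prob_space R" "sets R = sets (path_space {0..})"
  shows "(\<lambda>u. concat_law u (brownian_bridge W1 u) R) \<in>
    restrict_space lborel {0<..} \<rightarrow>\<^sub>M subprob_algebra (path_space {0..})"
proof -
  let ?U = "restrict_space lborel {0<..} :: real measure"
  let ?M = "?U \<Otimes>\<^sub>M (W1 \<Otimes>\<^sub>M R)"
  interpret W: prob_space W1 using wiener_lawD(1)[OF W] .
  interpret R: prob_space R by fact
  interpret WR: pair_prob_space W1 R ..
  define T where "T u = (\<lambda>(B, Y). concat_path u (bridge_path u B) Y)" for u
  have fst_m: "(\<lambda>p. fst p) \<in> ?M \<rightarrow>\<^sub>M restrict_space borel {0..}"
  proof -
    have "fst \<in> ?M \<rightarrow>\<^sub>M ?U" by (rule measurable_fst)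
    moreover have "(\<lambda>x. x) \<in> ?U \<rightarrow>\<^sub>M restrict_space borel {0..}"
      by (intro measurable_restrict_space2 measurable_restrict_space1) (auto simp: space_restrict_space)
    ultimately show ?thesis by (rule measurable_compose)
  qed
  have fst_b [measurable]: "(\<lambda>p. fst p) \<in> borel_measurable ?M"
    by (rule measurable_compose[OF fst_m]) (simp add: measurable_restrict_space1)
  have B_m: "(\<lambda>p. fst (snd p)) \<in> ?M \<rightarrow>\<^sub>M path_space {0..}"
    unfolding measurable_cong_sets[OF refl wiener_lawD(2)[OF W], symmetric] by measurable
  have Y_m: "(\<lambda>p. snd (snd p)) \<in> ?M \<rightarrow>\<^sub>M path_space {0..}"
    unfolding measurable_cong_sets[OF refl R(2), symmetric] by measurable
  have ev: "(\<lambda>p. h p (g p)) \<in> borel_measurable ?M"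
    if "g \<in> borel_measurable ?M" "\<And>p. p \<in> space ?M \<Longrightarrow> 0 \<le> g p" "h \<in> ?M \<rightarrow>\<^sub>M path_space {0..}"
    for g and h :: "_ \<Rightarrow> real \<Rightarrow> real"
  proof -
    have "(\<lambda>p. (g p, h p)) \<in> ?M \<rightarrow>\<^sub>M restrict_space borel {0..} \<Otimes>\<^sub>M path_space {0..}"
      using that by (intro measurable_Pair measurable_restrict_space2) auto
    from measurable_compose[OF this measurable_eval_joint] show ?thesis by simp
  qed
  have sp: "0 < fst p" if "p \<in> space ?M" for p
    using that by (auto simp: space_pair_measure space_restrict_space)
  have "case_prod T \<in> ?M \<rightarrow>\<^sub>M path_space {0..}"
  proof (rule measurable_path_spaceI)
    fix t :: real assume t: "t \<in> {0..}"
    have [measurable]: "(\<lambda>p. fst (snd p) t) \<in> borel_measurable ?M"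
      "(\<lambda>p. snd (snd p) 0) \<in> borel_measurable ?M"
      using t by (auto intro: ev[of "\<lambda>_. t", OF _ _ B_m] ev[of "\<lambda>_. 0", OF _ _ Y_m])
    have [measurable]: "(\<lambda>p. fst (snd p) (fst p)) \<in> borel_measurable ?M"
      by (rule ev[OF fst_b _ B_m]) (auto dest: sp)
    \<comment> \<open>\<open>max 0\<close> keeps the time in the domain of the path also for
      \<open>t < u\<close>, where the conditional below takes its other branch.\<close>
    have [measurable]: "(\<lambda>p. snd (snd p) (max 0 (t - fst p))) \<in> borel_measurable ?M"
      by (rule ev[OF _ _ Y_m]) auto
    \<comment> \<open>The two constants 0 are the end value of the bridge, which vanishes for every
      source path because \<open>u > 0\<close>.\<close>
    have "(\<lambda>p. if t < fst p then fst (snd p) t - t / fst p * fst (snd p) (fst p)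
        else if 0 = snd (snd p) 0 then snd (snd p) (max 0 (t - fst p)) else 0) \<in> borel_measurable ?M"
      by measurable
    moreover have "case_prod T p t = (if t < fst p then fst (snd p) t - t / fst p * fst (snd p) (fst p)
        else if 0 = snd (snd p) 0 then snd (snd p) (max 0 (t - fst p)) else 0)" if "p \<in> space ?M" for p
      using sp[OF that] t by (cases p) (auto simp: T_def concat_path_def bridge_path_def)
    ultimately show "(\<lambda>p. case_prod T p t) \<in> borel_measurable ?M"
      by (simp cong: measurable_cong)
  next
    fix p assume p: "p \<in> space ?M"
    obtain u B Y where [simp]: "p = (u, B, Y)" by (cases p)
    have u: "0 \<le> u" using sp[OF p] by simp
    have "B \<in> space (path_space {0..})" "Y \<in> space (path_space {0..})"
      using p sets_eq_imp_space_eq[OF wiener_lawD(2)[OF W]] sets_eq_imp_space_eq[OF R(2)] by (auto simp: space_pair_measure)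
    then have "(bridge_path u B, Y) \<in> space (path_space {0..u} \<Otimes>\<^sub>M path_space {0..})"
      using measurable_space[OF measurable_bridge_path[OF u]] by (auto simp: space_pair_measure)
    from measurable_space[OF concat_path_measurable[OF u] this]
    show "case_prod T p \<in> extensional {0..}" "continuous_on {0..} (case_prod T p)"
      by (auto simp: T_def space_path_space)
  qed
  moreover have "(\<lambda>u. W1 \<Otimes>\<^sub>M R) \<in> ?U \<rightarrow>\<^sub>M subprob_algebra (W1 \<Otimes>\<^sub>M R)"
    using WR.subprob_space_axioms by (intro measurable_const) (simp add: space_subprob_algebra)
  ultimately have "(\<lambda>u. distr (W1 \<Otimes>\<^sub>M R) (path_space {0..}) (T u)) \<in> ?U \<rightarrow>\<^sub>M subprob_algebra (path_space {0..})"
    by (rule measurable_distr2)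
  then show ?thesis
    by (subst measurable_cong) (auto simp: concat_law_eq[OF W R] T_def space_restrict_space)
qed

subsection \<open>Increments of Brownian motion\<close>

lemma lborel_distr_uminus_euclidean:
  "distr lborel borel uminus = (lborel :: 'a::euclidean_space measure)"
proof -
  have "(\<lambda>x. 0 + (- 1) *\<^sub>R x) = (uminus :: 'a \<Rightarrow> 'a)" by auto
  then show ?thesis using lborel_affine[of "-1" "0::'a"] by (simp add: density_1)
qed

definition gauss_density :: "real \<Rightarrow> 'b::euclidean_space \<Rightarrow> real" where
  "gauss_density v x = (\<Prod>b\<in>Basis. normal_density 0 (sqrt v) (x \<bullet> b))"

lemma gauss_density_measurable [measurable]: "gauss_density v \<in> borel_measurable borel"
  unfolding gauss_density_def by measurable

lemma gauss_density_nonneg: "0 \<le> gauss_density v x"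
  unfolding gauss_density_def by (intro prod_nonneg) simp

lemma nn_integral_normal_density:
  assumes "0 < \<sigma>"
  shows "(\<integral>\<^sup>+x. ennreal (normal_density 0 \<sigma> x) \<partial>lborel) = 1"
    and "(\<integral>\<^sup>+x. ennreal (normal_density 0 \<sigma> x * x\<^sup>2) \<partial>lborel) = ennreal (\<sigma>\<^sup>2)"
proof -
  show "(\<integral>\<^sup>+x. ennreal (normal_density 0 \<sigma> x) \<partial>lborel) = 1"
    using assms by (subst nn_integral_eq_integral) auto
  have "has_bochner_integral lborel (\<lambda>x. normal_density 0 \<sigma> x * x\<^sup>2) (\<sigma>\<^sup>2)"
    using normal_moment_even[OF assms, of 0 1] by (simp add: fact_numeral)
  then show "(\<integral>\<^sup>+x. ennreal (normal_density 0 \<sigma> x * x\<^sup>2) \<partial>lborel) = ennreal (\<sigma>\<^sup>2)"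
    by (subst nn_integral_eq_integral) (auto simp: has_bochner_integral_iff)
qed

lemma gauss_density_second_moment:
  fixes b :: "'b::euclidean_space"
  assumes "0 < v" "b \<in> Basis"
  shows "(\<integral>\<^sup>+x. ennreal (gauss_density v x) * ennreal ((x \<bullet> b)\<^sup>2) \<partial>lborel) = ennreal v"
proof -
  \<comment> \<open>The square sits in the factor of coordinate \<open>b\<close> only, so the
    integral factorizes into one second moment and otherwise total masses 1.\<close>
  define f where "f c y = ennreal (normal_density 0 (sqrt v) y * (if c = b then y\<^sup>2 else 1))" for c :: 'b and y
  have [measurable]: "f c \<in> borel_measurable borel" for c
    unfolding f_def by measurable
  have prod: "(\<Prod>c\<in>Basis. normal_density 0 (sqrt v) (x \<bullet> c) * (if c = b then (x \<bullet> c)\<^sup>2 else 1)) = gauss_density v x * (x \<bullet> b)\<^sup>2" for x :: 'b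
    using assms(2) by (simp add: prod.distrib gauss_density_def)
  have "ennreal (gauss_density v x) * ennreal ((x \<bullet> b)\<^sup>2) = (\<Prod>c\<in>Basis. f c (x \<bullet> c))" for x :: 'b
    unfolding f_def by (subst prod_ennreal) (auto simp: prod ennreal_mult gauss_density_nonneg)
  then have "(\<integral>\<^sup>+x. ennreal (gauss_density v x) * ennreal ((x \<bullet> b)\<^sup>2) \<partial>lborel) = (\<Prod>c\<in>Basis. \<integral>\<^sup>+y. f c y \<partial>lborel)"
    by (simp add: nn_integral_lborel_prod)
  also have "\<dots> = (\<Prod>c\<in>Basis. if c = b then ennreal v else 1)"
    using nn_integral_normal_density[of "sqrt v"] assms(1)
    by (intro prod.cong refl) (auto simp: f_def)
  also have "\<dots> = ennreal v" using assms(2) by simp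
  finally show ?thesis .
qed

lemma gauss_density_scale:
  assumes "0 < v"
  shows "gauss_density v (sqrt v *\<^sub>R x) * sqrt v ^ DIM('b::euclidean_space) = gauss_density 1 (x :: 'b)"
proof -
  have "normal_density 0 (sqrt v) (sqrt v * y) * sqrt v = normal_density 0 1 y" for y
  proof -
    have "- (sqrt v * y)\<^sup>2 / (2 * v) = - y\<^sup>2 / 2" using assms by (simp add: power_mult_distrib)
    moreover have "sqrt (2 * pi * v) = sqrt (2 * pi) * sqrt v" by (simp add: real_sqrt_mult)
    ultimately show ?thesis using assms by (simp add: normal_density_def)
  qed
  then have "(\<Prod>b\<in>Basis. normal_density 0 (sqrt v) (sqrt v * (x \<bullet> b)) * sqrt v) = (\<Prod>b\<in>Basis. normal_density 0 1 (x \<bullet> b))"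
    by simp
  then show ?thesis
    by (simp add: gauss_density_def prod.distrib)
qed

text \<open>The mean length of a standard Gaussian vector. Only its finiteness and Brownian scaling
  matter, so it stays unevaluated.\<close>

definition gauss_norm :: "'b::euclidean_space itself \<Rightarrow> ennreal" where
  "gauss_norm _ = (\<integral>\<^sup>+(x::'b). ennreal (gauss_density 1 x) * ennreal (norm x) \<partial>lborel)"

lemma gauss_density_norm:
  assumes "0 < v"
  shows "(\<integral>\<^sup>+x. ennreal (gauss_density v x) * ennreal (norm (x :: 'b::euclidean_space)) \<partial>lborel) = ennreal (sqrt v) * gauss_norm TYPE('b)"
proof -
  have "(lborel :: 'b measure) = density (distr lborel borel (\<lambda>x. 0 + sqrt v *\<^sub>R x)) (\<lambda>_. ennreal (\<bar>sqrt v\<bar> ^ DIM('b)))"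
    using assms by (intro lborel_affine) auto
  then have "(\<integral>\<^sup>+x. ennreal (gauss_density v x) * ennreal (norm (x :: 'b)) \<partial>lborel)
    = (\<integral>\<^sup>+x. ennreal (gauss_density v x) * ennreal (norm (x :: 'b)) \<partial>density (distr lborel borel (\<lambda>x. 0 + sqrt v *\<^sub>R x)) (\<lambda>_. ennreal (\<bar>sqrt v\<bar> ^ DIM('b))))"
    by simp
  also have "\<dots> = (\<integral>\<^sup>+x. ennreal (\<bar>sqrt v\<bar> ^ DIM('b)) * (ennreal (gauss_density v (sqrt v *\<^sub>R x)) * ennreal (norm (sqrt v *\<^sub>R (x :: 'b)))) \<partial>lborel)"
    by (subst nn_integral_density) (simp_all add: nn_integral_distr)
  also have "\<dots> = (\<integral>\<^sup>+x. ennreal (sqrt v) * (ennreal (gauss_density 1 x) * ennreal (norm (x :: 'b))) \<partial>lborel)"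
  proof (intro nn_integral_cong)
    fix x :: 'b
    show "ennreal (\<bar>sqrt v\<bar> ^ DIM('b)) * (ennreal (gauss_density v (sqrt v *\<^sub>R x)) * ennreal (norm (sqrt v *\<^sub>R (x :: 'b))))
       = ennreal (sqrt v) * (ennreal (gauss_density 1 x) * ennreal (norm (x :: 'b)))"
      using assms by (simp add: ennreal_mult[symmetric] gauss_density_nonneg gauss_density_scale[symmetric] mult_ac)
  qed
  also have "\<dots> = ennreal (sqrt v) * gauss_norm TYPE('b)"
    unfolding gauss_norm_def by (rule nn_integral_cmult) measurable
  finally show ?thesis .
qed

locale brownian =
  fixes W :: "(real \<Rightarrow> 'b::euclidean_space) measure"
  assumes W: "wiener_law W"
begin

sublocale prob_space W by (rule wiener_lawD(1)[OF W])

lemma eval_measurable: "0 \<le> s \<Longrightarrow> (\<lambda>X. X s) \<in> borel_measurable W"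
  by (rule measurable_cong_path[OF wiener_lawD(2)[OF W]]) (rule measurable_eval, simp)

lemma increment_measurable: "0 \<le> s \<Longrightarrow> 0 \<le> t \<Longrightarrow> (\<lambda>X. X t - X s) \<in> borel_measurable W"
  by (intro borel_measurable_diff eval_measurable)

lemma increment_nn_integral:
  assumes "0 \<le> s" "s < t" "g \<in> borel_measurable borel"
  shows "(\<integral>\<^sup>+X. g (X t - X s) \<partial>W) = (\<integral>\<^sup>+x. ennreal (gauss_density (t - s) x) * g x \<partial>lborel)"
  using distributed_nn_integral[OF wiener_lawD(5)[OF W assms(1,2)], of g] assms(3)
  by (simp add: gauss_density_def)

lemma increment_component_square:
  assumes "0 \<le> s" "s \<le> t" "b \<in> Basis"
  shows "(\<integral>\<^sup>+X. ennreal (((X t - X s) \<bullet> b)\<^sup>2) \<partial>W) = ennreal (t - s)"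
proof (cases "s = t")
  case False
  then show ?thesis
    using assms increment_nn_integral[of s t "\<lambda>x. ennreal ((x \<bullet> b)\<^sup>2)"]
    by (simp add: gauss_density_second_moment)
qed (simp add: assms)

lemma increment_norm_square:
  assumes "0 \<le> s" "s \<le> t"
  shows "(\<integral>\<^sup>+X. ennreal ((norm (X t - X s))\<^sup>2) \<partial>W) = ennreal (real DIM('b) * (t - s))"
proof -
  have [measurable]: "(\<lambda>X. X t - X s) \<in> borel_measurable W" using assms by (intro increment_measurable) auto
  have "(norm x)\<^sup>2 = (\<Sum>b\<in>Basis. (x \<bullet> b)\<^sup>2)" for x :: 'b
    unfolding power2_norm_eq_inner by (subst euclidean_inner) (simp add: power2_eq_square)
  then have "(\<integral>\<^sup>+X. ennreal ((norm (X t - X s))\<^sup>2) \<partial>W) = (\<integral>\<^sup>+X. (\<Sum>b\<in>Basis. ennreal (((X t - X s) \<bullet> b)\<^sup>2)) \<partial>W)"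
    by (simp add: sum_ennreal)
  also have "\<dots> = (\<Sum>b\<in>(Basis::'b set). ennreal (t - s))"
    by (subst nn_integral_sum) (measurable, rule sum.cong[OF refl], rule increment_component_square[OF assms])
  also have "\<dots> = ennreal (real DIM('b) * (t - s))"
    using assms by (subst sum_ennreal) auto
  finally show ?thesis .
qed

lemma increment_norm_square_integral:
  assumes "0 \<le> s" "s \<le> t"
  shows "integrable W (\<lambda>X. (norm (X t - X s))\<^sup>2)" "(\<integral>X. (norm (X t - X s))\<^sup>2 \<partial>W) = real DIM('b) * (t - s)"
proof -
  have m [measurable]: "(\<lambda>X. X t - X s) \<in> borel_measurable W" using assms by (intro increment_measurable) auto
  have "has_bochner_integral W (\<lambda>X. (norm (X t - X s))\<^sup>2) (real DIM('b) * (t - s))"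
    using assms by (intro has_bochner_integral_nn_integral increment_norm_square) auto
  then show "integrable W (\<lambda>X. (norm (X t - X s))\<^sup>2)" "(\<integral>X. (norm (X t - X s))\<^sup>2 \<partial>W) = real DIM('b) * (t - s)"
    by (auto simp: has_bochner_integral_iff)
qed

lemma increment_integrable:
  assumes "0 \<le> s" "s \<le> t"
  shows "integrable W (\<lambda>X. X t - X s)"
proof -
  have [measurable]: "(\<lambda>X. X t - X s) \<in> borel_measurable W" using assms by (intro increment_measurable) auto
  have "norm x \<le> 1 + (norm x)\<^sup>2" for x :: 'b
  proof -
    have "2 * norm x \<le> 1 + (norm x)\<^sup>2" using sum_squares_bound[of 1 "norm x"] by simp
    then show ?thesis using norm_ge_zero[of x] by linarith
  qed
  from order_trans[OF this abs_ge_self]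
  have le: "norm (X t - X s) \<le> norm (1 + (norm (X t - X s))\<^sup>2)" for X :: "real \<Rightarrow> 'b"
    unfolding real_norm_def .
  have "integrable W (\<lambda>X. 1 + (norm (X t - X s))\<^sup>2)"
    by (intro Bochner_Integration.integrable_add increment_norm_square_integral assms) simp
  then show ?thesis
    by (rule Bochner_Integration.integrable_bound) (measurable, rule AE_I2, rule le)
qed

text \<open>The Gaussian law is invariant under \<open>uminus\<close>, so its mean equals its own
  negative.\<close>

lemma increment_integral:
  assumes "0 \<le> s" "s \<le> t"
  shows "(\<integral>X. X t - X s \<partial>W) = 0"
proof (cases "s = t")
  case False
  then have st: "s < t" using assms by simp
  have [measurable]: "(\<lambda>X. X t - X s) \<in> borel_measurable W" using assms by (intro increment_measurable) auto
  define \<mu> where "\<mu> = density lborel (\<lambda>x :: 'b. ennreal (gauss_density (t - s) x))"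
  have d: "distr W borel (\<lambda>X. X t - X s) = \<mu>"
    using distributed_distr_eq_density[OF wiener_lawD(5)[OF W assms(1) st]]
    by (simp add: \<mu>_def gauss_density_def cong: distr_cong)
  have even: "gauss_density (t - s) (- x) = gauss_density (t - s) x" for x :: 'b
    by (simp add: gauss_density_def normal_density_def)
  have "\<mu> = density (distr lborel borel uminus) (\<lambda>x :: 'b. ennreal (gauss_density (t - s) x))"
    by (simp add: \<mu>_def lborel_distr_uminus_euclidean)
  also have "\<dots> = distr \<mu> borel uminus"
    by (subst density_distr) (simp_all add: even \<mu>_def)
  finally have e: "distr \<mu> borel uminus = \<mu>" ..
  have eq: "(\<integral>X. X t - X s \<partial>W) = (\<integral>x. x \<partial>\<mu>)"
    by (simp add: d[symmetric] integral_distr)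
  also have "\<dots> = (\<integral>x. x \<partial>distr \<mu> borel uminus)" by (simp add: e)
  also have "\<dots> = - (\<integral>x. x \<partial>\<mu>)" by (subst integral_distr) (simp_all add: \<mu>_def)
  finally have "2 *\<^sub>R (\<integral>X. X t - X s \<partial>W) = 0"
    unfolding scaleR_2 eq by (simp add: eq_neg_iff_add_eq_0)
  then show ?thesis by simp
qed simp

lemma increment_norm:
  assumes "0 \<le> s" "s \<le> t"
  shows "(\<integral>\<^sup>+X. ennreal (norm (X t - X s)) \<partial>W) = ennreal (sqrt (t - s)) * gauss_norm TYPE('b)"
  using assms increment_nn_integral[of s t "\<lambda>x. ennreal (norm x)"]
  by (cases "s = t") (simp_all add: gauss_density_norm)

text \<open>The increment over \<open>[0, 1]\<close> has scaling factor 1, and it is integrable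
  because its square is.\<close>

lemma gauss_norm_finite: "gauss_norm TYPE('b) < \<infinity>"
  using increment_norm[of 0 1] increment_integrable[of 0 1] by (simp add: integrable_iff_bounded)

lemma increment_norm_integral:
  assumes "0 \<le> s" "s \<le> t"
  shows "(\<integral>X. norm (X t - X s) \<partial>W) = enn2real (gauss_norm TYPE('b)) * sqrt (t - s)"
proof -
  have "ennreal (\<integral>X. norm (X t - X s) \<partial>W) = (\<integral>\<^sup>+X. ennreal (norm (X t - X s)) \<partial>W)"
    using increment_integrable[OF assms] by (intro nn_integral_eq_integral[symmetric]) auto
  also have "\<dots> = ennreal (enn2real (gauss_norm TYPE('b)) * sqrt (t - s))"
    using gauss_norm_finite assms by (simp add: increment_norm ennreal_mult mult.commute)
  finally show ?thesis using assms by (subst (asm) ennreal_inj) auto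
qed

text \<open>The density is at most \<open>(1 / sqrt (t - s)) ^ DIM('b)\<close> and the ball lies in
  a cube of side \<open>2 * r\<close>. In dimension 3 this power expresses transience strongly
  enough for \<open>measure_K_away\<close>.\<close>

lemma increment_small_ball:
  assumes "0 \<le> s" "s < t" "0 < r"
  shows "emeasure W {X \<in> space W. norm (X t - X s) < r} \<le> ennreal ((2 * r / sqrt (t - s)) ^ DIM('b))"
proof -
  have [measurable]: "(\<lambda>X. X t - X s) \<in> borel_measurable W" using assms by (intro increment_measurable) auto
  define v where "v = t - s"
  have v: "0 < v" using assms by (simp add: v_def)
  have le: "normal_density 0 (sqrt v) y \<le> 1 / sqrt v" for y
  proof -
    have "1 / sqrt (2 * pi * v) \<le> 1 / sqrt v"
      using v pi_gt3 by (intro divide_left_mono) (auto simp: mult_le_cancel_right1)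
    moreover have "exp (- (y\<^sup>2) / (2 * v)) \<le> 1" using v by simp
    ultimately have "1 / sqrt (2 * pi * v) * exp (- (y\<^sup>2) / (2 * v)) \<le> 1 / sqrt v * 1"
      using v by (intro mult_mono) auto
    then show ?thesis using v by (simp add: normal_density_def)
  qed
  have D: "gauss_density v x \<le> (1 / sqrt v) ^ DIM('b)" for x :: 'b
  proof -
    have "gauss_density v x \<le> (\<Prod>b\<in>(Basis :: 'b set). 1 / sqrt v)"
      unfolding gauss_density_def by (intro prod_mono conjI le) simp
    then show ?thesis by (simp only: prod_constant)
  qed
  have "emeasure W {X \<in> space W. norm (X t - X s) < r} = (\<integral>\<^sup>+X. indicator {x. norm x < r} (X t - X s) \<partial>W)"
  proof -
    have "(\<integral>\<^sup>+X. indicator {x. norm x < r} (X t - X s) \<partial>W) = (\<integral>\<^sup>+X. indicator {X \<in> space W. norm (X t - X s) < r} X \<partial>W)"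
      by (intro nn_integral_cong) (simp add: indicator_def)
    also have "\<dots> = emeasure W {X \<in> space W. norm (X t - X s) < r}"
      by (rule nn_integral_indicator) measurable
    finally show ?thesis ..
  qed
  also have "\<dots> = (\<integral>\<^sup>+x. ennreal (gauss_density v x) * indicator {x :: 'b. norm x < r} x \<partial>lborel)"
    using increment_nn_integral[of s t "indicator {x. norm x < r}"] assms by (simp add: v_def)
  also have "\<dots> \<le> (\<integral>\<^sup>+x. ennreal ((1 / sqrt v) ^ DIM('b)) * indicator (cbox (- r *\<^sub>R One) (r *\<^sub>R One)) (x :: 'b) \<partial>lborel)"
  proof (intro nn_integral_mono mult_mono ennreal_leI D)
    fix x :: 'b
    show "indicator {x. norm x < r} x \<le> (indicator (cbox (- r *\<^sub>R One) (r *\<^sub>R One)) x :: ennreal)"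
      using Basis_le_norm[of _ x] by (force simp: indicator_def mem_box inner_sum_left_Basis abs_le_iff)
  qed auto
  also have "\<dots> = ennreal ((1 / sqrt v) ^ DIM('b)) * ennreal ((2 * r) ^ DIM('b))"
  proof -
    have "emeasure lborel (cbox (- r *\<^sub>R One) (r *\<^sub>R One) :: 'b set) = ennreal (\<Prod>b\<in>(Basis :: 'b set). (r *\<^sub>R One - - r *\<^sub>R One) \<bullet> b)"
      using assms by (subst emeasure_lborel_cbox) auto
    also have "(\<Prod>b\<in>(Basis :: 'b set). (r *\<^sub>R One - - r *\<^sub>R One) \<bullet> b) = (\<Prod>b\<in>(Basis :: 'b set). 2 * r)"
      by (intro prod.cong refl) (simp add: inner_add_left)
    finally show ?thesis by (subst nn_integral_cmult_indicator) auto
  qed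
  also have "\<dots> = ennreal ((2 * r / sqrt (t - s)) ^ DIM('b))"
    using assms v by (simp add: ennreal_mult[symmetric] v_def power_divide)
  finally show ?thesis .
qed

end

section \<open>Orthogonal sums and integration over independent variables\<close>

lemma (in prob_space) integral_square_sum_orthogonal:
  fixes X :: "nat \<Rightarrow> 'a \<Rightarrow> real"
  assumes int: "\<And>j k. j < n \<Longrightarrow> k < n \<Longrightarrow> integrable M (\<lambda>\<omega>. X j \<omega> * X k \<omega>)"
    and orth: "\<And>j k. j < k \<Longrightarrow> k < n \<Longrightarrow> (\<integral>\<omega>. X j \<omega> * X k \<omega> \<partial>M) = 0"
  shows "integrable M (\<lambda>\<omega>. (\<Sum>k<n. X k \<omega>)\<^sup>2)"
    and "(\<integral>\<omega>. (\<Sum>k<n. X k \<omega>)\<^sup>2 \<partial>M) = (\<Sum>k<n. \<integral>\<omega>. (X k \<omega>)\<^sup>2 \<partial>M)"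
proof -
  have sq: "(\<Sum>k<n. X k \<omega>)\<^sup>2 = (\<Sum>j<n. \<Sum>k<n. X j \<omega> * X k \<omega>)" for \<omega>
    by (simp add: power2_eq_square sum_product)
  show "integrable M (\<lambda>\<omega>. (\<Sum>k<n. X k \<omega>)\<^sup>2)"
    unfolding sq using int by (intro Bochner_Integration.integrable_sum) auto
  have "(\<integral>\<omega>. (\<Sum>k<n. X k \<omega>)\<^sup>2 \<partial>M) = (\<Sum>j<n. \<Sum>k<n. \<integral>\<omega>. X j \<omega> * X k \<omega> \<partial>M)"
  proof -
    have "(\<integral>\<omega>. (\<Sum>k<n. X k \<omega>)\<^sup>2 \<partial>M) = (\<Sum>j<n. \<integral>\<omega>. (\<Sum>k<n. X j \<omega> * X k \<omega>) \<partial>M)"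
      unfolding sq by (rule Bochner_Integration.integral_sum) (auto intro!: Bochner_Integration.integrable_sum int)
    also have "\<dots> = (\<Sum>j<n. \<Sum>k<n. \<integral>\<omega>. X j \<omega> * X k \<omega> \<partial>M)"
      by (intro sum.cong refl Bochner_Integration.integral_sum) (auto intro: int)
    finally show ?thesis .
  qed
  also have "\<dots> = (\<Sum>j<n. \<Sum>k<n. if k = j then \<integral>\<omega>. (X j \<omega>)\<^sup>2 \<partial>M else 0)"
  proof (intro sum.cong refl)
    fix j k assume jk: "j \<in> {..<n}" "k \<in> {..<n}"
    consider "j = k" | "j < k" | "k < j" by linarith
    then show "(\<integral>\<omega>. X j \<omega> * X k \<omega> \<partial>M) = (if k = j then \<integral>\<omega>. (X j \<omega>)\<^sup>2 \<partial>M else 0)"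
    proof cases
      case 3 then show ?thesis using orth[of k j] jk by (simp add: mult.commute)
    qed (use orth[of j k] jk in \<open>auto simp: power2_eq_square\<close>)
  qed
  also have "\<dots> = (\<Sum>k<n. \<integral>\<omega>. (X k \<omega>)\<^sup>2 \<partial>M)" by simp
  finally show "(\<integral>\<omega>. (\<Sum>k<n. X k \<omega>)\<^sup>2 \<partial>M) = (\<Sum>k<n. \<integral>\<omega>. (X k \<omega>)\<^sup>2 \<partial>M)" .
qed

text \<open>Fubini for the joint law of \<open>P\<close> and \<open>D\<close>. It replaces
  conditional expectation given the past: \<open>P\<close> will be the past increments and
  \<open>D\<close> the next one.\<close>

lemma (in prob_space) integral_indep_var_iterated:
  fixes g :: "'b \<times> 'b \<Rightarrow> real"
  assumes ind: "indep_var N P L D" and g [measurable]: "g \<in> borel_measurable (N \<Otimes>\<^sub>M L)"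
    and int: "integrable M (\<lambda>\<omega>. g (P \<omega>, D \<omega>))"
  shows "(\<integral>\<omega>. g (P \<omega>, D \<omega>) \<partial>M) = (\<integral>\<omega>. (\<integral>\<omega>'. g (P \<omega>, D \<omega>') \<partial>M) \<partial>M)"
proof -
  have [measurable]: "P \<in> M \<rightarrow>\<^sub>M N" "D \<in> M \<rightarrow>\<^sub>M L"
    and eq: "distr M N P \<Otimes>\<^sub>M distr M L D = distr M (N \<Otimes>\<^sub>M L) (\<lambda>\<omega>. (P \<omega>, D \<omega>))"
    using ind by (auto simp: indep_var_distribution_eq)
  interpret NP: prob_space "distr M N P" by (rule prob_space_distr) measurable
  interpret LD: prob_space "distr M L D" by (rule prob_space_distr) measurable
  interpret pair_prob_space "distr M N P" "distr M L D" ..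
  have "integrable (distr M N P \<Otimes>\<^sub>M distr M L D) g"
    unfolding eq by (subst integrable_distr_eq) (use int in auto)
  have "(\<integral>\<omega>. g (P \<omega>, D \<omega>) \<partial>M) = (\<integral>p. g p \<partial>(distr M N P \<Otimes>\<^sub>M distr M L D))"
    unfolding eq by (subst integral_distr) auto
  also have "\<dots> = (\<integral>p. (\<integral>d. g (p, d) \<partial>distr M L D) \<partial>distr M N P)"
    by (rule integral_fst'[symmetric]) fact
  also have "\<dots> = (\<integral>p. (\<integral>\<omega>'. g (p, D \<omega>') \<partial>M) \<partial>distr M N P)"
    by (intro Bochner_Integration.integral_cong refl integral_distr) auto
  also have "\<dots> = (\<integral>\<omega>. (\<integral>\<omega>'. g (P \<omega>, D \<omega>') \<partial>M) \<partial>M)"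
    by (rule integral_distr) measurable
  finally show ?thesis .
qed

subsection \<open>Moment bounds for step integrals\<close>

lemma abs_mult_le_sum_squares: "\<bar>x * y\<bar> \<le> x\<^sup>2 + y\<^sup>2" for x y :: real
proof -
  have "0 \<le> (\<bar>x\<bar> - \<bar>y\<bar>)\<^sup>2" "0 \<le> \<bar>x\<bar> * \<bar>y\<bar>" by simp_all
  then show ?thesis unfolding power2_diff abs_mult power2_abs mult.assoc by linarith
qed

context brownian
begin

lemma increment_prod_integrable:
  assumes "0 \<le> s" "s \<le> t" "0 \<le> s'" "s' \<le> t'" "norm a \<le> 1" "norm b \<le> 1"
  shows "integrable W (\<lambda>X. ((X t - X s) \<bullet> a) * ((X t' - X s') \<bullet> b))"
proof (rule Bochner_Integration.integrable_bound)
  have [measurable]: "(\<lambda>X. X t - X s) \<in> borel_measurable W" "(\<lambda>X. X t' - X s') \<in> borel_measurable W"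
    using assms by (auto intro!: increment_measurable)
  show "integrable W (\<lambda>X. (norm (X t - X s))\<^sup>2 + (norm (X t' - X s'))\<^sup>2)"
    using assms by (intro Bochner_Integration.integrable_add increment_norm_square_integral) auto
  show "(\<lambda>X. ((X t - X s) \<bullet> a) * ((X t' - X s') \<bullet> b)) \<in> borel_measurable W"
    by measurable
  have "\<bar>(x \<bullet> a) * (y \<bullet> b)\<bar> \<le> \<bar>(norm x)\<^sup>2 + (norm y)\<^sup>2\<bar>" for x y :: 'b
  proof -
    have "\<bar>x \<bullet> a\<bar> \<le> norm x" "\<bar>y \<bullet> b\<bar> \<le> norm y"
      using Cauchy_Schwarz_ineq2[of x a] Cauchy_Schwarz_ineq2[of y b] mult_left_le[OF assms(5), of "norm x"] mult_left_le[OF assms(6), of "norm y"]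
      by auto
    then have "\<bar>x \<bullet> a\<bar> * \<bar>y \<bullet> b\<bar> \<le> norm x * norm y" by (intro mult_mono) auto
    also have "\<dots> \<le> (norm x)\<^sup>2 + (norm y)\<^sup>2"
      using sum_squares_bound[of "norm x" "norm y"] mult_nonneg_nonneg[OF norm_ge_zero[of x] norm_ge_zero[of y]]
      unfolding mult.assoc by linarith
    finally show ?thesis by (simp add: abs_mult)
  qed
  then show "AE X in W. norm (((X t - X s) \<bullet> a) * ((X t' - X s') \<bullet> b)) \<le> norm ((norm (X t - X s))\<^sup>2 + (norm (X t' - X s'))\<^sup>2)"
    by (intro AE_I2) (simp only: real_norm_def)
qed

end

text \<open>The Ito isometry for step functions. Equal consecutive times are allowed, as they occur
  when a partition is clipped at the end of the bridge.\<close>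

lemma wiener_sum_square:
  fixes W :: "(real \<Rightarrow> real) measure"
  assumes "wiener_law W" and \<tau>: "\<And>k. k < n \<Longrightarrow> 0 \<le> \<tau> k \<and> \<tau> k \<le> \<tau> (Suc k)"
  shows "integrable W (\<lambda>X. (\<Sum>k<n. c k * (X (\<tau> (Suc k)) - X (\<tau> k)))\<^sup>2)"
    and "(\<integral>X. (\<Sum>k<n. c k * (X (\<tau> (Suc k)) - X (\<tau> k)))\<^sup>2 \<partial>W) = (\<Sum>k<n. (c k)\<^sup>2 * (\<tau> (Suc k) - \<tau> k))"
proof -
  interpret brownian W by unfold_locales fact
  define D where "D k X = X (\<tau> (Suc k)) - X (\<tau> k)" for k and X :: "real \<Rightarrow> real"
  have D: "integrable W (D k)" "(\<integral>X. D k X \<partial>W) = 0" "(\<integral>X. (D k X)\<^sup>2 \<partial>W) = \<tau> (Suc k) - \<tau> k" if "k < n" for k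
    using \<tau>[OF that] increment_integrable[of "\<tau> k" "\<tau> (Suc k)"] increment_integral[of "\<tau> k" "\<tau> (Suc k)"]
      increment_norm_square_integral(2)[of "\<tau> k" "\<tau> (Suc k)"]
    by (simp_all add: D_def[abs_def])
  have DD: "integrable W (\<lambda>X. D j X * D k X)" if "j < n" "k < n" for j k
    using \<tau>[OF that(1)] \<tau>[OF that(2)] increment_prod_integrable[of "\<tau> j" "\<tau> (Suc j)" "\<tau> k" "\<tau> (Suc k)" 1 1]
    by (simp add: D_def)
  have ind: "indep_vars (\<lambda>_. borel) D {..<n}"
    using wiener_lawD(4)[OF W, of n \<tau>] \<tau> by (simp add: D_def[abs_def])
  have orth: "(\<integral>X. D j X * D k X \<partial>W) = 0" if "j < k" "k < n" for j k
  proof -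
    have "indep_vars (\<lambda>_. borel) D {j, k}" using that by (intro indep_vars_subset[OF ind]) auto
    then have "(\<integral>X. (\<Prod>i\<in>{j, k}. D i X) \<partial>W) = (\<Prod>i\<in>{j, k}. \<integral>X. D i X \<partial>W)"
      using that D by (intro indep_vars_lebesgue_integral) auto
    then show ?thesis using that D by simp
  qed
  have I: "integrable W (\<lambda>X. (c j * D j X) * (c k * D k X))" if "j < n" "k < n" for j k
  proof -
    have "(\<lambda>X. (c j * D j X) * (c k * D k X)) = (\<lambda>X. (c j * c k) * (D j X * D k X))" by (simp add: mult_ac)
    then show ?thesis using DD[OF that] by simp
  qed
  have O: "(\<integral>X. (c j * D j X) * (c k * D k X) \<partial>W) = 0" if "j < k" "k < n" for j k
  proof -
    have "(\<lambda>X. (c j * D j X) * (c k * D k X)) = (\<lambda>X. (c j * c k) * (D j X * D k X))" by (simp add: mult_ac)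
    then show ?thesis using orth[OF that] by simp
  qed
  note sum = integral_square_sum_orthogonal[of n "\<lambda>k X. c k * D k X", OF I O]
  show "integrable W (\<lambda>X. (\<Sum>k<n. c k * (X (\<tau> (Suc k)) - X (\<tau> k)))\<^sup>2)"
    using sum(1) by (simp add: D_def)
  show "(\<integral>X. (\<Sum>k<n. c k * (X (\<tau> (Suc k)) - X (\<tau> k)))\<^sup>2 \<partial>W) = (\<Sum>k<n. (c k)\<^sup>2 * (\<tau> (Suc k) - \<tau> k))"
    using sum(2) D(3) by (simp add: D_def[symmetric] power_mult_distrib)
qed

text \<open>The bridge integral is \<open>S X - a * (X u - X 0)\<close>, where \<open>a\<close> is
  the mean of the step function over \<open>[0, u]\<close>. Each of the two terms has second moment
  at most \<open>V\<close>, so \<open>2 * V + 2 * V\<close> bounds the whole. The exact value would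
  be \<open>V - a\<^sup>2 * u\<close>, but the crude constant 4 is enough.\<close>

lemma bridge_step_bound:
  assumes W: "wiener_law W" and u: "0 < u" and st: "is_step \<phi>"
  shows "(\<integral>\<^sup>+X. ennreal ((step_integral_upto u \<phi> X)\<^sup>2) \<partial>brownian_bridge W u) \<le> 4 * sq_norm {0..u} (step_fun \<phi>)"
proof -
  interpret brownian W by unfold_locales fact
  obtain n t c where \<phi>: "\<phi> = (n, t, c)" by (cases \<phi>)
  note st' = st[unfolded \<phi>]
  define \<tau> where "\<tau> k = min (t k) u" for k
  have \<tau>: "0 \<le> \<tau> k \<and> \<tau> k \<le> \<tau> (Suc k)" if "k < n" for k
    using is_step_nonneg[OF st', of k] is_step_mono[OF st', of k "Suc k"] that u by (auto simp: \<tau>_def)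
  define V where "V = (\<Sum>k<n. (c k)\<^sup>2 * (\<tau> (Suc k) - \<tau> k))"
  \<comment> \<open>Subtracting \<open>s / u * X u\<close> from the path contributes this multiple
    of the end value; Cauchy-Schwarz then gives \<open>a\<^sup>2 * u \<le> V\<close>.\<close>
  define a where "a = (\<Sum>k<n. c k * (\<tau> (Suc k) - \<tau> k)) / u"
  define S where "S X = (\<Sum>k<n. c k * (X (\<tau> (Suc k)) - X (\<tau> k)))" for X :: "real \<Rightarrow> real"
  have V0: "0 \<le> V" using \<tau> unfolding V_def by (intro sum_nonneg mult_nonneg_nonneg) auto
  have a: "a\<^sup>2 * u \<le> V"
  proof -
    have "(\<Sum>k<n. c k * (\<tau> (Suc k) - \<tau> k)) = (\<Sum>k<n. (c k * sqrt (\<tau> (Suc k) - \<tau> k)) * sqrt (\<tau> (Suc k) - \<tau> k))"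
      using \<tau> by (intro sum.cong refl) (simp add: mult.assoc)
    then have "(\<Sum>k<n. c k * (\<tau> (Suc k) - \<tau> k))\<^sup>2 \<le> (\<Sum>k<n. (c k * sqrt (\<tau> (Suc k) - \<tau> k))\<^sup>2) * (\<Sum>k<n. (sqrt (\<tau> (Suc k) - \<tau> k))\<^sup>2)"
      using Cauchy_Schwarz_ineq_sum[of "\<lambda>k. c k * sqrt (\<tau> (Suc k) - \<tau> k)" "\<lambda>k. sqrt (\<tau> (Suc k) - \<tau> k)" "{..<n}"] by simp
    also have "(\<Sum>k<n. (c k * sqrt (\<tau> (Suc k) - \<tau> k))\<^sup>2) = V"
      unfolding V_def using \<tau> by (intro sum.cong refl) (simp add: power_mult_distrib)
    also have "(\<Sum>k<n. (sqrt (\<tau> (Suc k) - \<tau> k))\<^sup>2) = (\<Sum>k<n. \<tau> (Suc k) - \<tau> k)"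
      using \<tau> by (intro sum.cong refl) simp
    also have "\<dots> = \<tau> n - \<tau> 0" by (rule sum_lessThan_telescope)
    also have "V * (\<tau> n - \<tau> 0) \<le> V * u"
      using V0 u st' by (intro mult_left_mono) (auto simp: \<tau>_def is_step_def)
    finally have "(a * u)\<^sup>2 \<le> V * u" using u by (simp add: a_def)
    then have "(a\<^sup>2 * u) * u \<le> V * u" by (simp add: power2_eq_square mult_ac)
    then show ?thesis using u by simp
  qed
  have bm: "bridge_path u \<in> W \<rightarrow>\<^sub>M path_space {0..u}"
    using u by (intro measurable_cong_path[OF wiener_lawD(2)[OF W]] measurable_bridge_path) simp
  \<comment> \<open>Almost everywhere only, since \<open>X u\<close> is rewritten as the increment
    \<open>X u - X 0\<close>, whose law is known.\<close>
  have eq: "AE X in W. step_integral_upto u \<phi> (bridge_path u X) = S X - a * (X u - X 0)"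
    using wiener_lawD(3)[OF W]
  proof eventually_elim
    case (elim X)
    have "step_integral_upto u \<phi> (bridge_path u X) = (\<Sum>k<n. c k * (bridge_path u X (\<tau> (Suc k)) - bridge_path u X (\<tau> k)))"
      by (simp add: \<phi> step_integral_upto_def step_integral_def \<tau>_def)
    also have "\<dots> = (\<Sum>k<n. c k * (X (\<tau> (Suc k)) - X (\<tau> k)) - (c k * (\<tau> (Suc k) - \<tau> k)) * (X u / u))"
    proof (intro sum.cong refl)
      fix k assume "k \<in> {..<n}"
      then have "\<tau> k \<in> {0..u}" "\<tau> (Suc k) \<in> {0..u}" using \<tau>[of k] by (auto simp: \<tau>_def)
      then show "c k * (bridge_path u X (\<tau> (Suc k)) - bridge_path u X (\<tau> k)) = c k * (X (\<tau> (Suc k)) - X (\<tau> k)) - (c k * (\<tau> (Suc k) - \<tau> k)) * (X u / u)"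
        using u by (simp add: bridge_path_def field_simps)
    qed
    also have "\<dots> = S X - a * X u"
      unfolding sum_subtractf sum_distrib_right[symmetric] S_def a_def by simp
    finally show ?case using elim by simp
  qed
  have Sm [measurable]: "S \<in> borel_measurable W"
  proof -
    have "\<tau> k \<ge> 0" if "k \<le> n" for k using is_step_nonneg[OF st' that] u by (auto simp: \<tau>_def)
    then show ?thesis unfolding S_def by (intro borel_measurable_sum borel_measurable_times borel_measurable_const increment_measurable) auto
  qed
  have [measurable]: "(\<lambda>X. X u - X 0) \<in> borel_measurable W" using u by (intro increment_measurable) auto
  have S2: "(\<integral>\<^sup>+X. ennreal ((S X)\<^sup>2) \<partial>W) = ennreal V"
    using wiener_sum_square[OF W, of n \<tau> c] \<tau> unfolding S_def V_def
    by (subst nn_integral_eq_integral) auto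
  have U2: "(\<integral>\<^sup>+X. ennreal ((X u - X 0)\<^sup>2) \<partial>W) = ennreal u"
    using increment_norm_square[of 0 u] u by simp
  have "(\<integral>\<^sup>+X. ennreal ((step_integral_upto u \<phi> X)\<^sup>2) \<partial>brownian_bridge W u) = (\<integral>\<^sup>+X. ennreal ((step_integral_upto u \<phi> (bridge_path u X))\<^sup>2) \<partial>W)"
    unfolding brownian_bridge_eq using measurable_step_integral_upto[OF st, of u] u
    by (subst nn_integral_distr[OF bm]) auto
  also have "\<dots> = (\<integral>\<^sup>+X. ennreal ((S X - a * (X u - X 0))\<^sup>2) \<partial>W)"
  proof (rule nn_integral_cong_AE)
    show "AE X in W. ennreal ((step_integral_upto u \<phi> (bridge_path u X))\<^sup>2) = ennreal ((S X - a * (X u - X 0))\<^sup>2)"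
      using eq by eventually_elim simp
  qed
  also have "\<dots> \<le> (\<integral>\<^sup>+X. 2 * ennreal ((S X)\<^sup>2) + ennreal (2 * a\<^sup>2) * ennreal ((X u - X 0)\<^sup>2) \<partial>W)"
  proof (intro nn_integral_mono)
    fix X :: "real \<Rightarrow> real"
    have "(S X - a * (X u - X 0))\<^sup>2 \<le> 2 * (S X)\<^sup>2 + 2 * a\<^sup>2 * (X u - X 0)\<^sup>2"
      using sum_squares_ge_zero[of "S X + a * (X u - X 0)" 0] by (simp add: power2_eq_square algebra_simps)
    then have "ennreal ((S X - a * (X u - X 0))\<^sup>2) \<le> ennreal (2 * (S X)\<^sup>2 + 2 * a\<^sup>2 * (X u - X 0)\<^sup>2)" by (rule ennreal_leI)
    also have "\<dots> = 2 * ennreal ((S X)\<^sup>2) + ennreal (2 * a\<^sup>2) * ennreal ((X u - X 0)\<^sup>2)"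
      by (simp add: ennreal_mult)
    finally show "ennreal ((S X - a * (X u - X 0))\<^sup>2) \<le> \<dots>" .
  qed
  also have "\<dots> = 2 * ennreal V + ennreal (2 * a\<^sup>2) * ennreal u"
    by (simp add: nn_integral_add nn_integral_cmult S2 U2)
  also have "\<dots> = ennreal (2 * V + 2 * (a\<^sup>2 * u))"
    using V0 u by (simp add: ennreal_mult mult.assoc)
  also have "\<dots> \<le> ennreal (4 * V)" using a by (intro ennreal_leI) simp
  also have "\<dots> = 4 * (\<Sum>k<n. ennreal ((c k)\<^sup>2 * (\<tau> (Suc k) - \<tau> k)))"
  proof -
    have "(\<Sum>k<n. ennreal ((c k)\<^sup>2 * (\<tau> (Suc k) - \<tau> k))) = ennreal V"
      unfolding V_def using \<tau> by (intro sum_ennreal) auto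
    then show ?thesis using V0 by (simp only: ennreal_mult) simp
  qed
  also have "\<dots> \<le> 4 * sq_norm {0..u} (step_fun \<phi>)"
    using sum_step_sq_norm_upto[OF st', of u] u unfolding \<tau>_def \<phi> by (intro mult_left_mono) auto
  finally show ?thesis .
qed

section \<open>Doob decomposition of the norm of a Brownian motion along a partition\<close>

locale brownian_step = brownian W for W :: "(real \<Rightarrow> 'b::euclidean_space) measure" +
  fixes n :: nat and t c :: "nat \<Rightarrow> real"
  assumes st: "is_step (n, t, c)"
begin

definition D :: "nat \<Rightarrow> (real \<Rightarrow> 'b) \<Rightarrow> 'b" where "D k X = X (t (Suc k)) - X (t k)"

text \<open>The path is measured from its starting value, so that it is an exact sum of increments;
  the difference is null.\<close>

definition Bt :: "nat \<Rightarrow> (real \<Rightarrow> 'b) \<Rightarrow> 'b" where "Bt k X = X (t k) - X (t 0)"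

text \<open>By independence of increments this is the conditional expectation of the next increment
  of the norm, given that the path is at \<open>x\<close>. It is a discrete form of the Bessel
  drift.\<close>

definition drift :: "nat \<Rightarrow> 'b \<Rightarrow> real" where "drift k x = (\<integral>X. norm (x + D k X) - norm x \<partial>W)"

definition mart :: "nat \<Rightarrow> (real \<Rightarrow> 'b) \<Rightarrow> real" where
  "mart k X = norm (Bt (Suc k) X) - norm (Bt k X) - drift k (Bt k X)"

lemma t_nonneg: "k \<le> n \<Longrightarrow> 0 \<le> t k" and t_le: "k < n \<Longrightarrow> t k \<le> t (Suc k)" and t_0: "t 0 = 0"
  using is_step_nonneg[OF st] is_step_mono[OF st, of k "Suc k"] st by (auto simp: is_step_def)

lemma D_measurable: "k < n \<Longrightarrow> D k \<in> borel_measurable W"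
  unfolding D_def using t_nonneg[of k] t_nonneg[of "Suc k"] by (intro increment_measurable) auto

lemma Bt_measurable: "k \<le> n \<Longrightarrow> Bt k \<in> borel_measurable W"
  unfolding Bt_def using t_nonneg[of k] t_0 by (intro increment_measurable) auto

lemma D_integral:
  assumes "k < n"
  shows "integrable W (D k)" "(\<integral>X. D k X \<partial>W) = 0" "integrable W (\<lambda>X. (norm (D k X))\<^sup>2)"
    "(\<integral>X. (norm (D k X))\<^sup>2 \<partial>W) = DIM('b) * (t (Suc k) - t k)"
  unfolding D_def using t_nonneg[of k] t_le[of k] assms
  by (auto intro: increment_integrable increment_integral increment_norm_square_integral)

lemma norm_diff_integrable: "k < n \<Longrightarrow> integrable W (\<lambda>X. norm (x + D k X) - norm x)"
  using D_measurable[of k] D_integral(1)[of k] by simp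

text \<open>The increment is centred, so nonnegativity is Jensen's inequality for the norm; the
  upper bound is the triangle inequality.\<close>

lemma drift_bounds:
  assumes k: "k < n"
  shows "0 \<le> drift k x" "drift k x \<le> (\<integral>X. norm (D k X) \<partial>W)"
proof -
  have i: "integrable W (D k)" by (rule D_integral[OF k])
  have "norm x = norm (\<integral>X. x + D k X \<partial>W)" using i D_integral(2)[OF k] by (simp add: prob_space)
  also have "\<dots> \<le> (\<integral>X. norm (x + D k X) \<partial>W)" by (rule integral_norm_bound)
  finally show "0 \<le> drift k x" using i by (simp add: drift_def prob_space)
  show "drift k x \<le> (\<integral>X. norm (D k X) \<partial>W)"
  proof -
    have "norm (x + D k X) - norm x \<le> norm (D k X)" for X using norm_triangle_ineq[of x "D k X"] by simp
    then show ?thesis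
      unfolding drift_def using i by (intro integral_mono norm_diff_integrable k) auto
  qed
qed

lemma drift_measurable: "k < n \<Longrightarrow> drift k \<in> borel_measurable borel"
proof -
  assume k: "k < n"
  have [measurable]: "D k \<in> borel_measurable W" by (rule D_measurable[OF k])
  show ?thesis unfolding drift_def by (rule borel_measurable_lebesgue_integral) measurable
qed

lemma Bt_Suc: "Bt (Suc k) X = Bt k X + D k X"
  by (simp add: Bt_def D_def)

lemma mart_measurable: "k < n \<Longrightarrow> mart k \<in> borel_measurable W"
proof -
  assume k: "k < n"
  have [measurable]: "Bt k \<in> borel_measurable W" "Bt (Suc k) \<in> borel_measurable W" "drift k \<in> borel_measurable borel"
    using k by (auto intro: Bt_measurable drift_measurable)
  show ?thesis unfolding mart_def by measurable
qed

lemma mart_bound: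
  assumes "k < n"
  shows "\<bar>mart k X\<bar> \<le> norm (D k X) + (\<integral>X. norm (D k X) \<partial>W)"
proof -
  have "\<bar>norm (Bt k X + D k X) - norm (Bt k X)\<bar> \<le> norm (D k X)"
    using norm_triangle_ineq3[of "Bt k X + D k X" "Bt k X"] by simp
  then show ?thesis
    using drift_bounds[OF assms, of "Bt k X"] unfolding mart_def Bt_Suc by linarith
qed

text \<open>By \<open>mart_bound\<close> the square is at most twice the squared increment plus
  twice the squared mean length \<open>m\<close>. As \<open>m\<^sup>2\<close> is at most the second
  moment, the constant is 2 + 2 = 4.\<close>

lemma mart_square:
  assumes k: "k < n"
  shows "integrable W (\<lambda>X. (mart k X)\<^sup>2)" "(\<integral>X. (mart k X)\<^sup>2 \<partial>W) \<le> 4 * DIM('b) * (t (Suc k) - t k)"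
proof -
  define m where "m = (\<integral>X. norm (D k X) \<partial>W)"
  have [measurable]: "mart k \<in> borel_measurable W" by (rule mart_measurable[OF k])
  have i: "integrable W (\<lambda>X. norm (D k X))" "integrable W (\<lambda>X. (norm (D k X))\<^sup>2)" using D_integral[OF k] by auto
  have le: "(mart k X)\<^sup>2 \<le> 2 * (norm (D k X))\<^sup>2 + 2 * m\<^sup>2" for X
  proof -
    have "(mart k X)\<^sup>2 \<le> (norm (D k X) + m)\<^sup>2"
      using mart_bound[OF k, of X] unfolding m_def[symmetric] by (metis abs_ge_zero power2_abs power_mono)
    also have "\<dots> \<le> 2 * (norm (D k X))\<^sup>2 + 2 * m\<^sup>2"
      using sum_squares_ge_zero[of "norm (D k X) - m" 0] by (simp add: power2_eq_square algebra_simps)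
    finally show ?thesis .
  qed
  have m2: "m\<^sup>2 \<le> (\<integral>X. (norm (D k X))\<^sup>2 \<partial>W)"
    using variance_positive[of "\<lambda>X. norm (D k X)"] variance_eq[OF i] by (simp add: m_def)
  have I: "integrable W (\<lambda>X. 2 * (norm (D k X))\<^sup>2 + 2 * m\<^sup>2)" using i by simp
  then show "integrable W (\<lambda>X. (mart k X)\<^sup>2)"
    by (rule Bochner_Integration.integrable_bound) (measurable, intro AE_I2, use le in \<open>auto intro: order_trans[OF _ abs_ge_self]\<close>)
  then have "(\<integral>X. (mart k X)\<^sup>2 \<partial>W) \<le> (\<integral>X. 2 * (norm (D k X))\<^sup>2 + 2 * m\<^sup>2 \<partial>W)"
    by (intro integral_mono I le)
  also have "\<dots> = 2 * (\<integral>X. (norm (D k X))\<^sup>2 \<partial>W) + 2 * m\<^sup>2" using i by (simp add: prob_space)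
  also have "\<dots> \<le> 4 * (\<integral>X. (norm (D k X))\<^sup>2 \<partial>W)" using m2 by simp
  finally show "(\<integral>X. (mart k X)\<^sup>2 \<partial>W) \<le> 4 * DIM('b) * (t (Suc k) - t k)"
    using D_integral(4)[OF k] by simp
qed

text \<open>The past is kept as the vector of increments before \<open>k\<close>; the positions
  \<open>Bt j\<close> with \<open>j \<le> k\<close> are its partial sums
  (\<open>Bt_eq_sum\<close>).\<close>

lemma past_indep:
  assumes "k < n"
  shows "indep_var (PiM {..<k} (\<lambda>_. borel)) (\<lambda>X. restrict (\<lambda>i. D i X) {..<k}) (PiM {k} (\<lambda>_. borel)) (\<lambda>X. restrict (\<lambda>i. D i X) {k})"
proof (rule indep_var_restrict)
  show "indep_vars (\<lambda>_. borel) D {..<n}"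
    using wiener_lawD(4)[OF W, of n t] t_nonneg t_le by (simp add: D_def[abs_def])
qed (use assms in auto)

lemma Bt_eq_sum: "j \<le> k \<Longrightarrow> (\<Sum>i<j. restrict (\<lambda>i. D i X) {..<k} i) = Bt j X"
  using sum_lessThan_telescope[of "\<lambda>i. X (t i)" j] by (simp add: D_def Bt_def)

lemma partial_sum_measurable:
  "j \<le> (k :: nat) \<Longrightarrow> (\<lambda>p. \<Sum>i<j. (p i :: 'b)) \<in> borel_measurable (PiM {..<k} (\<lambda>_. borel))"
  by (intro borel_measurable_sum measurable_component_singleton) (auto intro: less_le_trans)

text \<open>Averaging over the next increment and then over the past gives the difference of the
  mean norms at the two times; by scaling each of these is a multiple of the square root of the
  time.\<close>

lemma expectation_drift:
  assumes k: "k < n"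
  shows "(\<integral>X. drift k (Bt k X) \<partial>W) = enn2real (gauss_norm TYPE('b)) * (sqrt (t (Suc k)) - sqrt (t k))"
proof -
  let ?P = "\<lambda>X. restrict (\<lambda>i. D i X) {..<k}" and ?D = "\<lambda>X. restrict (\<lambda>i. D i X) {k}"
  define g where "g = (\<lambda>(p :: nat \<Rightarrow> 'b, d :: nat \<Rightarrow> 'b). norm ((\<Sum>i<k. p i) + d k) - norm (\<Sum>i<k. p i))"
  have [measurable]: "(\<lambda>p. \<Sum>i<k. (p i :: 'b)) \<in> borel_measurable (PiM {..<k} (\<lambda>_. borel))"
    by (rule partial_sum_measurable) simp
  have [measurable]: "g \<in> borel_measurable (PiM {..<k} (\<lambda>_. borel) \<Otimes>\<^sub>M PiM {k} (\<lambda>_. borel))"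
    unfolding g_def by measurable
  have i: "integrable W (\<lambda>X. norm (Bt j X))" "(\<integral>X. norm (Bt j X) \<partial>W) = enn2real (gauss_norm TYPE('b)) * sqrt (t j)" if "j \<le> n" for j
    unfolding Bt_def using increment_norm_integral[of 0 "t j"] increment_integrable[of 0 "t j"] t_nonneg[OF that] t_0 by auto
  have gP: "g (?P X, ?D Y) = norm (Bt k X + D k Y) - norm (Bt k X)" for X Y
    by (simp add: g_def Bt_eq_sum del: restrict_apply) simp
  have "(\<integral>X. g (?P X, ?D X) \<partial>W) = (\<integral>X. (\<integral>Y. g (?P X, ?D Y) \<partial>W) \<partial>W)"
    by (rule integral_indep_var_iterated[OF past_indep[OF k]])
      (measurable, unfold gP Bt_Suc[symmetric], use i[of k] i[of "Suc k"] k in auto)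
  then have "(\<integral>X. drift k (Bt k X) \<partial>W) = (\<integral>X. norm (Bt (Suc k) X) - norm (Bt k X) \<partial>W)"
    unfolding gP Bt_Suc[symmetric] drift_def[symmetric] by simp
  then show ?thesis using i[of k] i[of "Suc k"] k by (simp add: right_diff_distrib)
qed

lemma mart_prod_integrable:
  assumes "j < n" "k < n"
  shows "integrable W (\<lambda>X. mart j X * mart k X)"
proof (rule Bochner_Integration.integrable_bound)
  show "integrable W (\<lambda>X. (mart j X)\<^sup>2 + (mart k X)\<^sup>2)"
    using assms by (intro Bochner_Integration.integrable_add mart_square) auto
  show "AE X in W. norm (mart j X * mart k X) \<le> norm ((mart j X)\<^sup>2 + (mart k X)\<^sup>2)"
    using abs_mult_le_sum_squares by (intro AE_I2) simp
qed (use assms mart_measurable in auto)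

text \<open>For \<open>j < k\<close> the factor \<open>mart j\<close> is a function of the
  increments before \<open>k\<close>. Integrating the increment \<open>k\<close> alone therefore
  leaves it fixed and turns the other factor into drift minus drift.\<close>

lemma mart_orthogonal:
  assumes j: "j < k" and k: "k < n"
  shows "(\<integral>X. mart j X * mart k X \<partial>W) = 0"
proof -
  let ?P = "\<lambda>X. restrict (\<lambda>i. D i X) {..<k}" and ?D = "\<lambda>X. restrict (\<lambda>i. D i X) {k}"
  define s where "s j p = (\<Sum>i<j. (p i :: 'b))" for j :: nat and p
  define g where "g = (\<lambda>(p, d :: nat \<Rightarrow> 'b). (norm (s (Suc j) p) - norm (s j p) - drift j (s j p)) *
    (norm (s k p + d k) - norm (s k p) - drift k (s k p)))"
  have [measurable]: "s i \<in> borel_measurable (PiM {..<k} (\<lambda>_. borel))" if "i \<le> k" for i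
    unfolding s_def by (rule partial_sum_measurable[OF that])
  have [measurable]: "s j \<in> borel_measurable (PiM {..<k} (\<lambda>_. borel))" "s (Suc j) \<in> borel_measurable (PiM {..<k} (\<lambda>_. borel))"
     "s k \<in> borel_measurable (PiM {..<k} (\<lambda>_. borel))" using j by simp_all
  have [measurable]: "drift j \<in> borel_measurable borel" "drift k \<in> borel_measurable borel"
    using j k by (auto intro: drift_measurable)
  have [measurable]: "mart j \<in> borel_measurable W" "mart k \<in> borel_measurable W"
    using j k by (auto intro: mart_measurable)
  have [measurable]: "g \<in> borel_measurable (PiM {..<k} (\<lambda>_. borel) \<Otimes>\<^sub>M PiM {k} (\<lambda>_. borel))"
    unfolding g_def by measurable
  have sP: "s i (?P X) = Bt i X" if "i \<le> k" for i X unfolding s_def by (rule Bt_eq_sum[OF that])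
  have gP: "g (?P X, ?D Y) = mart j X * (norm (Bt k X + D k Y) - norm (Bt k X) - drift k (Bt k X))" for X Y
    using j by (simp add: g_def sP mart_def)
  have gX: "g (?P X, ?D X) = mart j X * mart k X" for X
    unfolding gP by (simp add: mart_def Bt_Suc)
  have "(\<integral>X. g (?P X, ?D X) \<partial>W) = (\<integral>X. (\<integral>Y. g (?P X, ?D Y) \<partial>W) \<partial>W)"
    by (rule integral_indep_var_iterated[OF past_indep[OF k]]) (measurable, unfold gX, use mart_prod_integrable j k in auto)
  also have "\<dots> = (\<integral>X. 0 \<partial>W)"
  proof (rule Bochner_Integration.integral_cong[OF refl])
    fix X
    have "(\<integral>Y. g (?P X, ?D Y) \<partial>W) = mart j X * (\<integral>Y. (norm (Bt k X + D k Y) - norm (Bt k X)) - drift k (Bt k X) \<partial>W)"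
      unfolding gP by simp
    also have "(\<integral>Y. (norm (Bt k X + D k Y) - norm (Bt k X)) - drift k (Bt k X) \<partial>W) = drift k (Bt k X) - drift k (Bt k X)"
      by (subst Bochner_Integration.integral_diff) (simp_all add: norm_diff_integrable[OF k] prob_space drift_def[symmetric] del: Bochner_Integration.integral_diff)
    also have "mart j X * (drift k (Bt k X) - drift k (Bt k X)) = 0" by simp
    finally show "(\<integral>Y. g (?P X, ?D Y) \<partial>W) = 0" .
  qed
  finally show ?thesis unfolding gX by simp
qed

lemma mart_sum:
  "(\<integral>\<^sup>+X. ennreal ((\<Sum>k<n. c k * mart k X)\<^sup>2) \<partial>W) \<le> ennreal (4 * DIM('b)) * sq_norm {0..} (step_fun (n, t, c))"
proof -
  have eq: "(\<lambda>X. (c j * mart j X) * (c k * mart k X)) = (\<lambda>X. (c j * c k) * (mart j X * mart k X))" for j k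
    by (simp add: mult_ac)
  have I: "integrable W (\<lambda>X. (c j * mart j X) * (c k * mart k X))" if "j < n" "k < n" for j k
    unfolding eq using mart_prod_integrable[OF that] by simp
  have O: "(\<integral>X. (c j * mart j X) * (c k * mart k X) \<partial>W) = 0" if "j < k" "k < n" for j k
    unfolding eq using mart_orthogonal[OF that] by simp
  note sum = integral_square_sum_orthogonal[of n "\<lambda>k X. c k * mart k X", OF I O]
  have "(\<integral>\<^sup>+X. ennreal ((\<Sum>k<n. c k * mart k X)\<^sup>2) \<partial>W) = ennreal (\<Sum>k<n. \<integral>X. (c k * mart k X)\<^sup>2 \<partial>W)"
  proof -
    have "integrable W (\<lambda>X. (\<Sum>k<n. c k * mart k X)\<^sup>2)" by (rule sum(1)) simp_all
    moreover have "(\<integral>X. (\<Sum>k<n. c k * mart k X)\<^sup>2 \<partial>W) = (\<Sum>k<n. \<integral>X. (c k * mart k X)\<^sup>2 \<partial>W)"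
      by (rule sum(2)) simp_all
    ultimately show ?thesis using nn_integral_eq_integral[of W "\<lambda>X. (\<Sum>k<n. c k * mart k X)\<^sup>2"] by simp
  qed
  also have "\<dots> \<le> ennreal (\<Sum>k<n. 4 * DIM('b) * ((c k)\<^sup>2 * (t (Suc k) - t k)))"
  proof (intro ennreal_leI sum_mono)
    fix k assume "k \<in> {..<n}"
    then have "(c k)\<^sup>2 * (\<integral>X. (mart k X)\<^sup>2 \<partial>W) \<le> (c k)\<^sup>2 * (4 * DIM('b) * (t (Suc k) - t k))"
      by (intro mult_left_mono mart_square) auto
    also have "\<dots> = 4 * DIM('b) * ((c k)\<^sup>2 * (t (Suc k) - t k))"
      by (simp only: mult_ac)
    also have "(c k)\<^sup>2 * (\<integral>X. (mart k X)\<^sup>2 \<partial>W) = (\<integral>X. (c k * mart k X)\<^sup>2 \<partial>W)"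
      by (simp add: power_mult_distrib)
    finally show "(\<integral>X. (c k * mart k X)\<^sup>2 \<partial>W) \<le> 4 * DIM('b) * ((c k)\<^sup>2 * (t (Suc k) - t k))" .
  qed
  also have "\<dots> = ennreal (4 * DIM('b)) * (\<Sum>k<n. ennreal ((c k)\<^sup>2 * (t (Suc k) - t k)))"
  proof -
    have nn: "0 \<le> (c k)\<^sup>2 * (t (Suc k) - t k)" if "k \<in> {..<n}" for k using t_le that by simp
    have "(\<Sum>k<n. ennreal ((c k)\<^sup>2 * (t (Suc k) - t k))) = ennreal (\<Sum>k<n. (c k)\<^sup>2 * (t (Suc k) - t k))"
      by (intro sum_ennreal nn)
    moreover have "0 \<le> (\<Sum>k<n. (c k)\<^sup>2 * (t (Suc k) - t k))" by (intro sum_nonneg nn)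
    ultimately show ?thesis by (simp only: sum_distrib_left[symmetric] ennreal_mult of_nat_0_le_iff)
  qed
  also have "\<dots> \<le> ennreal (4 * DIM('b)) * sq_norm {0..} (step_fun (n, t, c))"
    by (intro mult_left_mono sum_step_sq_norm st) auto
  finally show ?thesis .
qed

lemma drift_sum:
  "(\<integral>\<^sup>+X. ennreal \<bar>\<Sum>k<n. c k * drift k (Bt k X)\<bar> \<partial>W) \<le> gauss_norm TYPE('b) * wt_norm (\<lambda>s. 1 / sqrt s) (step_fun (n, t, c))"
proof -
  have m: "(\<lambda>X. drift k (Bt k X)) \<in> borel_measurable W" if "k < n" for k
    using that by (intro measurable_compose[OF Bt_measurable drift_measurable]) auto
  have i: "integrable W (\<lambda>X. drift k (Bt k X))" if "k < n" for k
    by (rule Bochner_Integration.integrable_bound[of W "\<lambda>_. \<integral>X. norm (D k X) \<partial>W"])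
      (use m drift_bounds that in auto)
  have "ennreal \<bar>\<Sum>k<n. c k * drift k (Bt k X)\<bar> \<le> (\<Sum>k<n. ennreal \<bar>c k\<bar> * ennreal (drift k (Bt k X)))" for X
  proof -
    have "\<bar>\<Sum>k<n. c k * drift k (Bt k X)\<bar> \<le> (\<Sum>k<n. \<bar>c k\<bar> * drift k (Bt k X))"
      by (rule order_trans[OF sum_abs]) (intro sum_mono, simp add: abs_mult drift_bounds)
    then have "ennreal \<bar>\<Sum>k<n. c k * drift k (Bt k X)\<bar> \<le> ennreal (\<Sum>k<n. \<bar>c k\<bar> * drift k (Bt k X))"
      by (rule ennreal_leI)
    also have "\<dots> = (\<Sum>k<n. ennreal \<bar>c k\<bar> * ennreal (drift k (Bt k X)))"
      by (subst sum_ennreal[symmetric]) (auto simp: drift_bounds ennreal_mult)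
    finally show ?thesis .
  qed
  then have "(\<integral>\<^sup>+X. ennreal \<bar>\<Sum>k<n. c k * drift k (Bt k X)\<bar> \<partial>W) \<le> (\<integral>\<^sup>+X. (\<Sum>k<n. ennreal \<bar>c k\<bar> * ennreal (drift k (Bt k X))) \<partial>W)"
    by (intro nn_integral_mono)
  also have "\<dots> = (\<Sum>k<n. \<integral>\<^sup>+X. ennreal \<bar>c k\<bar> * ennreal (drift k (Bt k X)) \<partial>W)"
    using m by (intro nn_integral_sum) auto
  also have "\<dots> = (\<Sum>k<n. gauss_norm TYPE('b) * ennreal (\<bar>c k\<bar> * (sqrt (t (Suc k)) - sqrt (t k))))"
  proof (intro sum.cong refl)
    fix k assume "k \<in> {..<n}"
    then have k: "k < n" by simp
    have "(\<integral>\<^sup>+X. ennreal \<bar>c k\<bar> * ennreal (drift k (Bt k X)) \<partial>W) = ennreal \<bar>c k\<bar> * (\<integral>\<^sup>+X. ennreal (drift k (Bt k X)) \<partial>W)"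
      using m[OF k] by (intro nn_integral_cmult) auto
    also have "(\<integral>\<^sup>+X. ennreal (drift k (Bt k X)) \<partial>W) = ennreal (enn2real (gauss_norm TYPE('b)) * (sqrt (t (Suc k)) - sqrt (t k)))"
      unfolding expectation_drift[OF k, symmetric] using i[OF k] drift_bounds[OF k] by (intro nn_integral_eq_integral) auto
    also have "\<dots> = gauss_norm TYPE('b) * ennreal (sqrt (t (Suc k)) - sqrt (t k))"
      using gauss_norm_finite t_le[OF k] by (simp add: ennreal_mult)
    finally show "(\<integral>\<^sup>+X. ennreal \<bar>c k\<bar> * ennreal (drift k (Bt k X)) \<partial>W) = gauss_norm TYPE('b) * ennreal (\<bar>c k\<bar> * (sqrt (t (Suc k)) - sqrt (t k)))"
      using t_le[OF k] by (simp add: ennreal_mult mult_ac)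
  qed
  also have "\<dots> = gauss_norm TYPE('b) * (\<Sum>k<n. ennreal (\<bar>c k\<bar> * (sqrt (t (Suc k)) - sqrt (t k))))"
    by (simp only: sum_distrib_left)
  also have "\<dots> \<le> gauss_norm TYPE('b) * wt_norm (\<lambda>s. 1 / sqrt s) (step_fun (n, t, c))"
    by (intro mult_left_mono sum_step_wt_norm st) auto
  finally show ?thesis .
qed

lemma step_integral_norm_path:
  "AE X in W. step_integral (n, t, c) (norm_path X) = (\<Sum>k<n. c k * mart k X) + (\<Sum>k<n. c k * drift k (Bt k X))"
  using wiener_lawD(3)[OF W]
proof eventually_elim
  case (elim X)
  have "norm_path X (t (Suc k)) - norm_path X (t k) = mart k X + drift k (Bt k X)" if "k < n" for k
    using t_nonneg[of k] t_nonneg[of "Suc k"] that elim by (simp add: norm_path_def mart_def Bt_def t_0)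
  then have "step_integral (n, t, c) (norm_path X) = (\<Sum>k<n. c k * mart k X + c k * drift k (Bt k X))"
    by (simp add: step_integral_def distrib_left)
  then show ?case by (simp add: sum.distrib)
qed

end

text \<open>The constant 16 is 4 from halving the tolerance in Chebyshev's inequality times 4 from
  \<open>mart_sum\<close>; the second summand comes from the drift.\<close>

definition bessel_const :: "'b::euclidean_space itself \<Rightarrow> real" where
  "bessel_const _ = 16 * DIM('b) + enn2real (gauss_norm TYPE('b))"

lemma bessel_step_bound:
  fixes W :: "(real \<Rightarrow> 'b::euclidean_space) measure"
  assumes W: "wiener_law W" and step: "is_step \<phi>" and \<epsilon>: "0 < \<epsilon>"
  shows "emeasure W {X \<in> space W. \<epsilon> \<le> \<bar>step_integral \<phi> (norm_path X)\<bar>} \<le>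
    ennreal (bessel_const TYPE('b) * (1 + 1 / \<epsilon>\<^sup>2)) * (sq_norm {0..} (step_fun \<phi>) + wt_norm (\<lambda>s. 1 / sqrt s) (step_fun \<phi>))"
proof -
  obtain n t c where \<phi>: "\<phi> = (n, t, c)" by (cases \<phi>)
  interpret brownian_step W n t c by unfold_locales (use W step \<phi> in auto)
  define M where "M X = (\<Sum>k<n. c k * mart k X)" for X
  define A where "A X = (\<Sum>k<n. c k * drift k (Bt k X))" for X
  have [measurable]: "M \<in> borel_measurable W" "A \<in> borel_measurable W"
    unfolding M_def A_def
    by (intro borel_measurable_sum borel_measurable_times borel_measurable_const mart_measurable measurable_compose[OF Bt_measurable drift_measurable]; simp)+
  let ?q = "sq_norm {0..} (step_fun \<phi>)" and ?w = "wt_norm (\<lambda>s. 1 / sqrt s) (step_fun \<phi>)"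
  define K where "K = enn2real (gauss_norm TYPE('b))"
  have K: "gauss_norm TYPE('b) = ennreal K" "0 \<le> K" using gauss_norm_finite by (auto simp: K_def)
  have "emeasure W {X \<in> space W. \<epsilon> \<le> \<bar>step_integral \<phi> (norm_path X)\<bar>} = emeasure W {X \<in> space W. \<epsilon> \<le> \<bar>M X + A X\<bar>}"
  proof (rule emeasure_eq_AE)
    show "AE X in W. (X \<in> {X \<in> space W. \<epsilon> \<le> \<bar>step_integral \<phi> (norm_path X)\<bar>}) = (X \<in> {X \<in> space W. \<epsilon> \<le> \<bar>M X + A X\<bar>})"
      using step_integral_norm_path by eventually_elim (simp add: \<phi> M_def A_def)
    have "(\<lambda>X. step_integral \<phi> (norm_path X)) \<in> borel_measurable W"
      by (rule measurable_compose[OF measurable_cong_path[OF wiener_lawD(2)[OF W] measurable_norm_path] measurable_step_integral[OF step]])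
    then show "{X \<in> space W. \<epsilon> \<le> \<bar>step_integral \<phi> (norm_path X)\<bar>} \<in> sets W" by measurable
  qed measurable
  also have "\<dots> \<le> emeasure W {X \<in> space W. \<epsilon> / 2 \<le> \<bar>M X\<bar>} + emeasure W {X \<in> space W. \<epsilon> / 2 \<le> \<bar>A X\<bar>}"
    by (rule emeasure_abs_ge_triangle) auto
  also have "\<dots> \<le> ennreal (1 / (\<epsilon> / 2)\<^sup>2) * (ennreal (4 * DIM('b)) * ?q) + ennreal (1 / (\<epsilon> / 2)) * (ennreal K * ?w)"
  proof (intro add_mono)
    have "emeasure W {X \<in> space W. \<epsilon> / 2 \<le> \<bar>M X\<bar>} \<le> ennreal (1 / (\<epsilon> / 2)\<^sup>2) * (\<integral>\<^sup>+X. ennreal ((M X)\<^sup>2) \<partial>W)"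
      using \<epsilon> by (intro emeasure_abs_ge_le_square) auto
    also have "\<dots> \<le> ennreal (1 / (\<epsilon> / 2)\<^sup>2) * (ennreal (4 * DIM('b)) * ?q)"
      unfolding M_def \<phi> by (intro mult_left_mono mart_sum) auto
    finally show "emeasure W {X \<in> space W. \<epsilon> / 2 \<le> \<bar>M X\<bar>} \<le> \<dots>" .
    have "emeasure W {X \<in> space W. \<epsilon> / 2 \<le> \<bar>A X\<bar>} \<le> ennreal (1 / (\<epsilon> / 2)) * (\<integral>\<^sup>+X. ennreal \<bar>A X\<bar> \<partial>W)"
      using \<epsilon> by (intro emeasure_abs_ge_le_abs) auto
    also have "\<dots> \<le> ennreal (1 / (\<epsilon> / 2)) * (ennreal K * ?w)"
      unfolding A_def \<phi> K(1)[symmetric] by (intro mult_left_mono drift_sum) auto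
    finally show "emeasure W {X \<in> space W. \<epsilon> / 2 \<le> \<bar>A X\<bar>} \<le> \<dots>" .
  qed
  also have "\<dots> = ennreal (16 * DIM('b) * (1 / \<epsilon>\<^sup>2)) * ?q + ennreal (K * (2 / \<epsilon>)) * ?w"
  proof -
    have e: "ennreal x * (ennreal y * z) = ennreal (x * y) * z" if "0 \<le> x" "0 \<le> y" for x y z
      using that by (simp add: ennreal_mult mult.assoc)
    have "ennreal (1 / (\<epsilon> / 2)\<^sup>2) * (ennreal (4 * DIM('b)) * ?q) = ennreal (1 / (\<epsilon> / 2)\<^sup>2 * (4 * DIM('b))) * ?q"
      by (rule e) auto
    moreover have "ennreal (1 / (\<epsilon> / 2)) * (ennreal K * ?w) = ennreal (1 / (\<epsilon> / 2) * K) * ?w"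
      using K(2) \<epsilon> by (intro e) auto
    moreover have "1 / (\<epsilon> / 2)\<^sup>2 * (4 * DIM('b)) = 16 * DIM('b) * (1 / \<epsilon>\<^sup>2)" "1 / (\<epsilon> / 2) * K = K * (2 / \<epsilon>)"
      by (simp_all add: power_divide)
    ultimately show ?thesis by (simp only:)
  qed
  also have "\<dots> \<le> ennreal (bessel_const TYPE('b) * (1 + 1 / \<epsilon>\<^sup>2)) * ?q + ennreal (bessel_const TYPE('b) * (1 + 1 / \<epsilon>\<^sup>2)) * ?w"
  proof (intro add_mono mult_right_mono ennreal_leI)
    show "16 * DIM('b) * (1 / \<epsilon>\<^sup>2) \<le> bessel_const TYPE('b) * (1 + 1 / \<epsilon>\<^sup>2)"
      unfolding bessel_const_def K_def[symmetric] using K(2) by (intro mult_mono) auto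
    \<comment> \<open>The inequality \<open>2 / \<epsilon> \<le> 1 + 1 / \<epsilon>\<^sup>2\<close>
      fits the Markov bound for the drift into the same form as the Chebyshev bound for the
      martingale part.\<close>
    have "0 \<le> (1 - 1 / \<epsilon>)\<^sup>2" by simp
    then have "2 / \<epsilon> \<le> 1 + 1 / \<epsilon>\<^sup>2" by (simp add: power2_eq_square algebra_simps)
    then show "K * (2 / \<epsilon>) \<le> bessel_const TYPE('b) * (1 + 1 / \<epsilon>\<^sup>2)"
      unfolding bessel_const_def K_def[symmetric] using K(2) \<epsilon> by (intro mult_mono) auto
  qed auto
  finally show ?thesis by (simp add: distrib_left)
qed

subsection \<open>Wiener integrals for the bridge and the Bessel process\<close>

lemma sq_norm_cong: "(\<And>s. s \<in> A \<Longrightarrow> f s = g s) \<Longrightarrow> sq_norm A f = sq_norm A g"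
  unfolding sq_norm_def by (intro nn_integral_cong) (auto simp: indicator_def)

lemma wt_norm_cong: "(\<And>s. 0 \<le> s \<Longrightarrow> f s = g s) \<Longrightarrow> wt_norm w f = wt_norm w g"
  unfolding wt_norm_def by (intro nn_integral_cong) (auto simp: indicator_def)

lemma sq_norm_shift_le:
  assumes [measurable]: "g \<in> borel_measurable borel" and "0 \<le> u"
  shows "sq_norm {0..} (\<lambda>s. g (s + u)) \<le> sq_norm {0..} g"
proof -
  have "sq_norm {0..} (\<lambda>s. g (s + u)) \<le> (\<integral>\<^sup>+s. ennreal ((g (u + 1 * s))\<^sup>2) * indicator {0..} (u + 1 * s) \<partial>lborel)"
    unfolding sq_norm_def using assms(2) by (intro nn_integral_mono) (auto simp: indicator_def add.commute)
  also have "\<dots> = sq_norm {0..} g"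
    using nn_integral_real_affine[of "\<lambda>s. ennreal ((g s)\<^sup>2) * indicator {0..} s" 1 u] by (simp add: sq_norm_def)
  finally show ?thesis .
qed

lemma wt_norm_shift_measurable:
  assumes [measurable]: "g \<in> borel_measurable borel" "w \<in> borel_measurable borel"
  shows "(\<lambda>u. wt_norm w (\<lambda>s. g (s + u))) \<in> borel_measurable borel"
  unfolding wt_norm_def by measurable

text \<open>Integrate the whole series against \<open>shift_weight\<close>: a finite integral forces
  almost everywhere finite values, and the weight is positive. With \<open>a n = 4 ^ n\<close> it
  makes one sequence fast for almost every \<open>u\<close>; a one-term series gives the
  integrability of f(. + u).\<close>

lemma AE_wt_norm_shift_finite:
  assumes [measurable]: "\<And>n. g n \<in> borel_measurable borel"
    and fin: "(\<Sum>n. a n * wt_norm (\<lambda>s. 1 / (1 + sqrt s)) (g n)) < \<infinity>"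
  shows "AE u in lborel. 0 \<le> u \<longrightarrow> (\<Sum>n. a n * wt_norm (\<lambda>s. 1 / sqrt s) (\<lambda>s. g n (s + u))) < \<infinity>"
proof -
  let ?W = "\<lambda>n u. wt_norm (\<lambda>s. 1 / sqrt s) (\<lambda>s. g n (s + u))"
  have [measurable]: "?W n \<in> borel_measurable borel" for n by (rule wt_norm_shift_measurable) measurable
  have "(\<integral>\<^sup>+u. (\<Sum>n. a n * (ennreal (shift_weight u) * ?W n u * indicator {0..} u)) \<partial>lborel)
     = (\<Sum>n. a n * (\<integral>\<^sup>+u. ennreal (shift_weight u) * ?W n u * indicator {0..} u \<partial>lborel))"
    by (subst nn_integral_suminf) (simp_all add: nn_integral_cmult)
  also have "\<dots> \<le> (\<Sum>n. a n * (3 * wt_norm (\<lambda>s. 1 / (1 + sqrt s)) (g n)))"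
    by (intro suminf_le mult_left_mono nn_integral_weight_shift) auto
  also have "\<dots> = 3 * (\<Sum>n. a n * wt_norm (\<lambda>s. 1 / (1 + sqrt s)) (g n))"
    unfolding mult.left_commute[of _ 3] by (rule ennreal_suminf_cmult)
  also have "\<dots> < \<infinity>" using fin by (simp add: ennreal_mult_less_top)
  finally have "AE u in lborel. (\<Sum>n. a n * (ennreal (shift_weight u) * ?W n u * indicator {0..} u)) \<noteq> \<infinity>"
    by (intro nn_integral_PInf_AE) auto
  then show ?thesis
  proof eventually_elim
    case (elim u)
    show ?case
    proof
      assume u: "0 \<le> u"
      then have "(\<Sum>n. a n * (ennreal (shift_weight u) * ?W n u * indicator {0..} u)) = ennreal (shift_weight u) * (\<Sum>n. a n * ?W n u)"
        by (simp add: mult.left_commute[of _ "ennreal (shift_weight u)"])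
      with elim have "ennreal (shift_weight u) * (\<Sum>n. a n * ?W n u) < \<top>" by (simp add: less_top)
      then show "(\<Sum>n. a n * ?W n u) < \<infinity>"
        using shift_weight_pos[OF u] by (auto simp: ennreal_mult_less_top)
    qed
  qed
qed

lemma sets_brownian_bridge [simp]: "sets (brownian_bridge W u) = sets (path_space {0..u})"
  and space_brownian_bridge [simp]: "space (brownian_bridge W u) = space (path_space {0..u})"
  by (simp_all add: brownian_bridge_def)

lemma sets_concat_law [simp]: "sets (concat_law u P Q) = sets (path_space {0..})"
  and space_concat_law [simp]: "space (concat_law u P Q) = space (path_space {0..})"
  by (simp_all add: concat_law_def)

lemma measurable_restrict_path:
  assumes "0 \<le> u"
  shows "(\<lambda>X. restrict X {0..u}) \<in> path_space {0..} \<rightarrow>\<^sub>M path_space {0..u}"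
proof (rule measurable_path_spaceI)
  show "(\<lambda>X. restrict X {0..u} t) \<in> borel_measurable (path_space {0..})" if "t \<in> {0..u}" for t
    using that measurable_eval[of t "{0..}"] by simp
  fix X :: "real \<Rightarrow> 'a" assume "X \<in> space (path_space {0..})"
  then have "continuous_on {0..u} X" by (auto simp: space_path_space elim: continuous_on_subset)
  then show "continuous_on {0..u} (restrict X {0..u})" by (rule continuous_on_eq) simp
qed simp

lemma measurable_shift_path:
  assumes "0 \<le> u"
  shows "shift_path u \<in> path_space {0..} \<rightarrow>\<^sub>M path_space {0..}"
proof (rule measurable_path_spaceI)
  show "(\<lambda>X. shift_path u X t) \<in> borel_measurable (path_space {0..})" if "t \<in> {0..}" for t
    using that assms measurable_eval[of "u + t" "{0..}"] by (simp add: shift_path_def)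
  fix X :: "real \<Rightarrow> real" assume "X \<in> space (path_space {0..})"
  then have X: "continuous_on {0..} X" by (simp add: space_path_space)
  have "continuous_on {0..} (\<lambda>s. X (u + s))"
    by (rule continuous_on_compose2[OF X]) (use assms in \<open>auto intro: continuous_intros\<close>)
  then show "continuous_on {0..} (shift_path u X)" by (rule continuous_on_eq) (simp add: shift_path_def)
qed (simp add: shift_path_def)

lemma step_integral_neg_path: "is_step \<phi> \<Longrightarrow> step_integral \<phi> (neg_path X) = - step_integral \<phi> X"
  using is_step_nonneg
  by (cases \<phi>) (auto simp: step_integral_def neg_path_def sum_negf[symmetric] algebra_simps intro!: sum.cong)

lemma sym_bessel3_step_bound:
  assumes W: "wiener_law W" and st: "is_step \<phi>" and \<epsilon>: "0 < \<epsilon>"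
  shows "emeasure (sym_bessel3 W) {X \<in> space (sym_bessel3 W). \<epsilon> \<le> \<bar>step_integral \<phi> X\<bar>} \<le>
    ennreal (bessel_const TYPE(real ^ 3) * (1 + 1 / \<epsilon>\<^sup>2)) * (sq_norm {0..} (step_fun \<phi>) + wt_norm (\<lambda>s. 1 / sqrt s) (step_fun \<phi>))"
proof -
  have [measurable]: "step_integral \<phi> \<in> borel_measurable (path_space {0..})" by (rule measurable_step_integral[OF st])
  let ?A = "{X \<in> space (path_space {0..}). \<epsilon> \<le> \<bar>step_integral \<phi> X\<bar>}"
  have "emeasure (sym_bessel3 W) ?A = emeasure W {X \<in> space W. norm_path X \<in> ?A}"
  proof (rule emeasure_sym_bessel3_symmetric[OF wiener_lawD(2)[OF W]])
    show "?A \<in> sets (path_space {0..})" by measurable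
    show "neg_path X \<in> ?A \<longleftrightarrow> X \<in> ?A" if "X \<in> space (path_space {0..})" for X
      using that measurable_space[OF measurable_neg_path that] by (simp add: step_integral_neg_path[OF st])
  qed
  also have "{X \<in> space W. norm_path X \<in> ?A} = {X \<in> space W. \<epsilon> \<le> \<bar>step_integral \<phi> (norm_path X)\<bar>}"
    using measurable_space[OF measurable_cong_path[OF wiener_lawD(2)[OF W] measurable_norm_path]] by auto
  finally show ?thesis using bessel_step_bound[OF W st \<epsilon>] by simp
qed

definition bessel_dist :: "(real \<Rightarrow> real) \<Rightarrow> ennreal" where
  "bessel_dist g = sq_norm {0..} g + wt_norm (\<lambda>s. 1 / sqrt s) g"

lemma bessel_functional:
  assumes W: "wiener_law W"
  shows "step_functional (sym_bessel3 W) step_integral bessel_dist (bessel_const TYPE(real ^ 3))"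
proof (intro step_functional.intro step_functional_axioms.intro)
  show "prob_space (sym_bessel3 W)" by (rule prob_space_sym_bessel3[OF W])
  show "step_integral \<phi> \<in> borel_measurable (sym_bessel3 W)" if "is_step \<phi>" for \<phi>
    using measurable_step_integral[OF that] by (simp cong: measurable_cong_sets)
  show "step_integral (step_diff \<phi> \<psi>) x = step_integral \<phi> x - step_integral \<psi> x" if "is_step \<phi>" "is_step \<psi>" for \<phi> \<psi> x
    by (rule step_integral_diff[OF that])
  show "emeasure (sym_bessel3 W) {x \<in> space (sym_bessel3 W). \<epsilon> \<le> \<bar>step_integral \<phi> x\<bar>}
     \<le> ennreal (bessel_const TYPE(real ^ 3) * (1 + 1 / \<epsilon>\<^sup>2)) * bessel_dist (step_fun \<phi>)" if "is_step \<phi>" "0 < \<epsilon>" for \<phi> \<epsilon>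
    unfolding bessel_dist_def by (rule sym_bessel3_step_bound[OF W that])
  show "bessel_dist (\<lambda>s. f s - g s) \<le> 2 * (bessel_dist (\<lambda>s. f s - h s) + bessel_dist (\<lambda>s. g s - h s))"
    if "f \<in> borel_measurable borel" "g \<in> borel_measurable borel" "h \<in> borel_measurable borel" for f g h
  proof -
    let ?w = "\<lambda>s. 1 / sqrt s"
    have "wt_norm ?w (\<lambda>s. f s - g s) \<le> wt_norm ?w (\<lambda>s. f s - h s) + wt_norm ?w (\<lambda>s. g s - h s)"
      using that by (intro wt_norm_diff) auto
    also have "\<dots> \<le> 2 * (wt_norm ?w (\<lambda>s. f s - h s) + wt_norm ?w (\<lambda>s. g s - h s))"
      by (simp add: mult_2)
    finally have "wt_norm ?w (\<lambda>s. f s - g s) \<le> 2 * (wt_norm ?w (\<lambda>s. f s - h s) + wt_norm ?w (\<lambda>s. g s - h s))" .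
    from add_mono[OF sq_norm_diff[OF that, of "{0..}"] this] show ?thesis
      unfolding bessel_dist_def by (simp add: distrib_left ac_simps)
  qed
  show "0 \<le> bessel_const TYPE(real ^ 3)" by (simp add: bessel_const_def)
qed

lemma bridge_functional:
  assumes W: "wiener_law W" and u: "0 < u"
  shows "step_functional (brownian_bridge W u) (step_integral_upto u) (sq_norm {0..u}) 4"
proof (intro step_functional.intro step_functional_axioms.intro)
  show "prob_space (brownian_bridge W u)" using u by (intro prob_space_brownian_bridge[OF W]) simp
  show m: "step_integral_upto u \<phi> \<in> borel_measurable (brownian_bridge W u)" if "is_step \<phi>" for \<phi>
    using measurable_step_integral_upto[OF that, of u] u by (simp cong: measurable_cong_sets)
  show "step_integral_upto u (step_diff \<phi> \<psi>) x = step_integral_upto u \<phi> x - step_integral_upto u \<psi> x" if "is_step \<phi>" "is_step \<psi>" for \<phi> \<psi> x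
    by (rule step_integral_upto_diff[OF that])
  show "emeasure (brownian_bridge W u) {x \<in> space (brownian_bridge W u). \<epsilon> \<le> \<bar>step_integral_upto u \<phi> x\<bar>}
     \<le> ennreal (4 * (1 + 1 / \<epsilon>\<^sup>2)) * sq_norm {0..u} (step_fun \<phi>)" if "is_step \<phi>" "0 < \<epsilon>" for \<phi> \<epsilon>
  proof -
    have "emeasure (brownian_bridge W u) {x \<in> space (brownian_bridge W u). \<epsilon> \<le> \<bar>step_integral_upto u \<phi> x\<bar>}
      \<le> ennreal (1 / \<epsilon>\<^sup>2) * (\<integral>\<^sup>+X. ennreal ((step_integral_upto u \<phi> X)\<^sup>2) \<partial>brownian_bridge W u)"
      using that by (intro emeasure_abs_ge_le_square m)
    also have "\<dots> \<le> ennreal (1 / \<epsilon>\<^sup>2) * (4 * sq_norm {0..u} (step_fun \<phi>))"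
      by (intro mult_left_mono bridge_step_bound W u that) auto
    also have "\<dots> = ennreal (1 / \<epsilon>\<^sup>2 * 4) * sq_norm {0..u} (step_fun \<phi>)"
      by (subst ennreal_mult) (simp_all add: mult.assoc)
    also have "\<dots> \<le> ennreal (4 * (1 + 1 / \<epsilon>\<^sup>2)) * sq_norm {0..u} (step_fun \<phi>)"
      by (intro mult_right_mono ennreal_leI) auto
    finally show ?thesis .
  qed
  show "sq_norm {0..u} (\<lambda>s. f s - g s) \<le> 2 * (sq_norm {0..u} (\<lambda>s. f s - h s) + sq_norm {0..u} (\<lambda>s. g s - h s))"
    if "f \<in> borel_measurable borel" "g \<in> borel_measurable borel" "h \<in> borel_measurable borel" for f g h
    using that by (intro sq_norm_diff) auto
qed simp

lemma (in step_functional) limS_tendsto_in_probability: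
  assumes "f \<in> borel_measurable borel" "\<And>n. is_step (\<phi> n)"
    and "(\<Sum>n. 4 ^ n * q (\<lambda>s. step_fun (\<phi> n) s - f s)) < \<infinity>"
    and \<psi>: "\<And>n. is_step (\<psi> n)" "(\<lambda>n. q (\<lambda>s. step_fun (\<psi> n) s - f s)) \<longlonglongrightarrow> 0"
  shows "tendsto_in_probability M (\<lambda>n. S (\<psi> n)) (limS \<phi>)"
  unfolding tendsto_in_probability_def
proof (intro allI impI)
  fix \<epsilon> :: real assume "0 < \<epsilon>"
  from tendsto_0_cmult_ennreal[OF \<psi>(2), of "ennreal (2 * C * (1 + 4 / \<epsilon>\<^sup>2))"]
  have "(\<lambda>n. ennreal (2 * C * (1 + 4 / \<epsilon>\<^sup>2)) * q (\<lambda>s. step_fun (\<psi> n) s - f s)) \<longlonglongrightarrow> 0" by simp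
  then show "(\<lambda>n. emeasure M {x \<in> space M. \<epsilon> \<le> \<bar>S (\<psi> n) x - limS \<phi> x\<bar>}) \<longlonglongrightarrow> 0"
    by (rule tendsto_0_ennreal_le) (rule limS_bound[OF assms(1-3) \<psi>(1) \<open>0 < \<epsilon>\<close>])
qed

lemma tendsto_in_probability_AE_eq:
  assumes "\<And>n. F n \<in> borel_measurable M" "Z \<in> borel_measurable M" "Z' \<in> borel_measurable M"
    and "tendsto_in_probability M F Z" "tendsto_in_probability M F Z'"
  shows "AE x in M. Z x = Z' x"
proof -
  have "space M \<inter> {x \<in> space M. P x} = {x \<in> space M. P x}" for P by auto
  then have "AE x in M. x \<in> space M \<longrightarrow> Z x = Z' x"
    using assms by (intro AE_eq_of_tendsto_in_measure[where F = F]) (auto simp: tendsto_in_probability_def)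
  with AE_space show ?thesis by eventually_elim simp
qed

lemma L2_tendsto_in_probability:
  assumes "\<And>n. F n \<in> borel_measurable M" "Z \<in> borel_measurable M"
    and lim: "(\<lambda>n. \<integral>\<^sup>+x. ennreal ((F n x - Z x)\<^sup>2) \<partial>M) \<longlonglongrightarrow> 0"
  shows "tendsto_in_probability M F Z"
  unfolding tendsto_in_probability_def
proof (intro allI impI)
  fix \<epsilon> :: real assume "0 < \<epsilon>"
  from tendsto_0_cmult_ennreal[OF lim, of "ennreal (1 / \<epsilon>\<^sup>2)"]
  have "(\<lambda>n. ennreal (1 / \<epsilon>\<^sup>2) * (\<integral>\<^sup>+x. ennreal ((F n x - Z x)\<^sup>2) \<partial>M)) \<longlonglongrightarrow> 0" by simp
  then show "(\<lambda>n. emeasure M {x \<in> space M. \<epsilon> \<le> \<bar>F n x - Z x\<bar>}) \<longlonglongrightarrow> 0"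
    by (rule tendsto_0_ennreal_le) (intro emeasure_abs_ge_le_square borel_measurable_diff assms \<open>0 < \<epsilon>\<close>)
qed

text \<open>\<open>limS \<phi>\<close> satisfies the property under \<open>SOME\<close>, so the
  chosen version does too. Both are limits in probability along the admissible sequence
  \<open>\<phi>\<close>, hence equal almost everywhere, and the chosen version inherits almost sure
  convergence.\<close>

lemma wiener_integral_bessel_AE:
  assumes W: "wiener_law W" and f: "f \<in> borel_measurable borel" and \<phi>: "\<And>n. is_step (\<phi> n)"
    and fast: "(\<Sum>n. 4 ^ n * bessel_dist (\<lambda>s. step_fun (\<phi> n) s - f s)) < \<infinity>"
  shows "wiener_integral_bessel (sym_bessel3 W) f \<in> borel_measurable (sym_bessel3 W)"
    and "AE X in sym_bessel3 W. (\<lambda>n. step_integral (\<phi> n) X) \<longlonglongrightarrow> wiener_integral_bessel (sym_bessel3 W) f X"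
proof -
  interpret step_functional "sym_bessel3 W" step_integral bessel_dist "bessel_const TYPE(real ^ 3)"
    by (rule bessel_functional[OF W])
  let ?R = "sym_bessel3 W"
  define Q where "Q Z \<longleftrightarrow> Z \<in> borel_measurable ?R \<and>
     (\<forall>\<phi>. (\<forall>n. is_step (\<phi> n)) \<and>
          L2_tendsto {0..} (\<lambda>n. step_fun (\<phi> n)) f \<and>
          L1_weighted_tendsto (\<lambda>s. 1 / sqrt s) (\<lambda>n. step_fun (\<phi> n)) f \<longrightarrow>
        tendsto_in_probability ?R (\<lambda>n. step_integral (\<phi> n)) Z)" for Z
  have ex: "Q (limS \<phi>)"
    unfolding Q_def
  proof (intro conjI allI impI)
    show "limS \<phi> \<in> borel_measurable ?R" by (rule limS_measurable[OF f \<phi> fast])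
    fix \<psi> :: "nat \<Rightarrow> step_data"
    assume "(\<forall>n. is_step (\<psi> n)) \<and> L2_tendsto {0..} (\<lambda>n. step_fun (\<psi> n)) f \<and>
          L1_weighted_tendsto (\<lambda>s. 1 / sqrt s) (\<lambda>n. step_fun (\<psi> n)) f"
    then have \<psi>: "\<And>n. is_step (\<psi> n)" and lim: "(\<lambda>n. sq_norm {0..} (\<lambda>s. step_fun (\<psi> n) s - f s)) \<longlonglongrightarrow> 0"
      "(\<lambda>n. wt_norm (\<lambda>s. 1 / sqrt s) (\<lambda>s. step_fun (\<psi> n) s - f s)) \<longlonglongrightarrow> 0"
      by (auto simp: L2_tendsto_iff_sq_norm L1_weighted_tendsto_iff_wt_norm)
    have "(\<lambda>n. bessel_dist (\<lambda>s. step_fun (\<psi> n) s - f s)) \<longlonglongrightarrow> 0"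
      unfolding bessel_dist_def using tendsto_add[OF lim] by simp
    then show "tendsto_in_probability ?R (\<lambda>n. step_integral (\<psi> n)) (limS \<phi>)"
      by (rule limS_tendsto_in_probability[OF f \<phi> fast \<psi>])
  qed
  have WI: "Q (wiener_integral_bessel ?R f)"
    unfolding wiener_integral_bessel_def Q_def[symmetric] by (rule someI[where P = Q, OF ex])
  then show m: "wiener_integral_bessel ?R f \<in> borel_measurable ?R" by (simp add: Q_def)
  have q0: "(\<lambda>n. bessel_dist (\<lambda>s. step_fun (\<phi> n) s - f s)) \<longlonglongrightarrow> 0" by (rule q_tendsto_0[OF f \<phi> fast])
  have "L2_tendsto {0..} (\<lambda>n. step_fun (\<phi> n)) f"
    unfolding L2_tendsto_iff_sq_norm by (rule tendsto_0_ennreal_le[OF q0]) (simp add: bessel_dist_def)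
  moreover have "L1_weighted_tendsto (\<lambda>s. 1 / sqrt s) (\<lambda>n. step_fun (\<phi> n)) f"
    unfolding L1_weighted_tendsto_iff_wt_norm by (rule tendsto_0_ennreal_le[OF q0]) (simp add: bessel_dist_def)
  ultimately have "tendsto_in_probability ?R (\<lambda>n. step_integral (\<phi> n)) Z" if "Q Z" for Z
    using that \<phi> by (simp add: Q_def)
  from this[OF ex] this[OF WI] have "AE X in ?R. limS \<phi> X = wiener_integral_bessel ?R f X"
    by (rule tendsto_in_probability_AE_eq[OF S_measurable[OF \<phi>] limS_measurable[OF f \<phi> fast] m])
  then show "AE X in ?R. (\<lambda>n. step_integral (\<phi> n) X) \<longlonglongrightarrow> wiener_integral_bessel ?R f X"
    using limS_AE[OF f \<phi> fast] by eventually_elim simp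
qed

text \<open>The bridge integral is defined by L^2 convergence, so \<open>limS_bound\<close> is too
  weak to show that the limit qualifies. Fatou's lemma applied to \<open>bridge_step_bound\<close>
  for \<open>step_diff (\<psi> n) (\<phi> m)\<close>, as m tends to infinity, gives the L^2 bound
  with constant 8 = 4 * 2.\<close>

lemma wiener_integral_bridge_AE:
  assumes W: "wiener_law W" and u: "0 < u" and f [measurable]: "f \<in> borel_measurable borel" and \<phi>: "\<And>n. is_step (\<phi> n)"
    and fast: "(\<Sum>n. 4 ^ n * sq_norm {0..u} (\<lambda>s. step_fun (\<phi> n) s - f s)) < \<infinity>"
  shows "wiener_integral_bridge (brownian_bridge W u) u f \<in> borel_measurable (brownian_bridge W u)"
    and "AE X in brownian_bridge W u. (\<lambda>n. step_integral_upto u (\<phi> n) X) \<longlonglongrightarrow> wiener_integral_bridge (brownian_bridge W u) u f X"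
proof -
  interpret step_functional "brownian_bridge W u" "step_integral_upto u" "sq_norm {0..u}" 4
    by (rule bridge_functional[OF W u])
  let ?P = "brownian_bridge W u"
  define Q where "Q Z \<longleftrightarrow> Z \<in> borel_measurable ?P \<and>
     (\<forall>\<phi>. (\<forall>n. is_step (\<phi> n)) \<and> L2_tendsto {0..u} (\<lambda>n. step_fun (\<phi> n)) f \<longrightarrow>
        (\<lambda>n. \<integral>\<^sup>+X. ennreal ((step_integral_upto u (\<phi> n) X - Z X)\<^sup>2) \<partial>?P) \<longlonglongrightarrow> 0)" for Z
  have q0: "(\<lambda>n. sq_norm {0..u} (\<lambda>s. step_fun (\<phi> n) s - f s)) \<longlonglongrightarrow> 0" by (rule q_tendsto_0[OF f \<phi> fast])
  have lm [measurable]: "limS \<phi> \<in> borel_measurable ?P" by (rule limS_measurable[OF f \<phi> fast])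
  have ex: "Q (limS \<phi>)"
    unfolding Q_def
  proof (intro conjI allI impI lm)
    fix \<psi> :: "nat \<Rightarrow> step_data"
    assume "(\<forall>n. is_step (\<psi> n)) \<and> L2_tendsto {0..u} (\<lambda>n. step_fun (\<psi> n)) f"
    then have \<psi>: "\<And>n. is_step (\<psi> n)" and lim: "(\<lambda>n. sq_norm {0..u} (\<lambda>s. step_fun (\<psi> n) s - f s)) \<longlonglongrightarrow> 0"
      by (auto simp: L2_tendsto_iff_sq_norm)
    have [measurable]: "step_integral_upto u (\<phi> n) \<in> borel_measurable ?P" "step_integral_upto u (\<psi> n) \<in> borel_measurable ?P" for n
      using \<phi> \<psi> by (auto intro: S_measurable)
    have "(\<integral>\<^sup>+X. ennreal ((step_integral_upto u (\<psi> n) X - limS \<phi> X)\<^sup>2) \<partial>?P) \<le> 8 * sq_norm {0..u} (\<lambda>s. step_fun (\<psi> n) s - f s)" for n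
    proof -
      let ?b = "\<lambda>m. 4 * (2 * (sq_norm {0..u} (\<lambda>s. step_fun (\<psi> n) s - f s) + sq_norm {0..u} (\<lambda>s. step_fun (\<phi> m) s - f s)))"
      have b: "(\<integral>\<^sup>+X. ennreal ((step_integral_upto u (\<psi> n) X - step_integral_upto u (\<phi> m) X)\<^sup>2) \<partial>?P) \<le> ?b m" for m
      proof -
        have "(\<integral>\<^sup>+X. ennreal ((step_integral_upto u (step_diff (\<psi> n) (\<phi> m)) X)\<^sup>2) \<partial>?P) \<le> 4 * sq_norm {0..u} (step_fun (step_diff (\<psi> n) (\<phi> m)))"
          by (intro bridge_step_bound W u is_step_diff \<phi> \<psi>)
        also have "step_fun (step_diff (\<psi> n) (\<phi> m)) = (\<lambda>s. step_fun (\<psi> n) s - step_fun (\<phi> m) s)"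
          using \<phi> \<psi> by (auto simp: step_fun_diff)
        also have "4 * sq_norm {0..u} (\<lambda>s. step_fun (\<psi> n) s - step_fun (\<phi> m) s) \<le> ?b m"
          by (intro mult_left_mono sq_norm_diff) auto
        finally show ?thesis using \<phi> \<psi> by (simp only: step_integral_upto_diff)
      qed
      have "(\<integral>\<^sup>+X. ennreal ((step_integral_upto u (\<psi> n) X - limS \<phi> X)\<^sup>2) \<partial>?P) =
        (\<integral>\<^sup>+X. liminf (\<lambda>m. ennreal ((step_integral_upto u (\<psi> n) X - step_integral_upto u (\<phi> m) X)\<^sup>2)) \<partial>?P)"
      proof (rule nn_integral_cong_AE)
        show "AE X in ?P. ennreal ((step_integral_upto u (\<psi> n) X - limS \<phi> X)\<^sup>2) = liminf (\<lambda>m. ennreal ((step_integral_upto u (\<psi> n) X - step_integral_upto u (\<phi> m) X)\<^sup>2))"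
          using limS_AE[OF f \<phi> fast]
        proof eventually_elim
          case (elim X)
          then have "(\<lambda>m. ennreal ((step_integral_upto u (\<psi> n) X - step_integral_upto u (\<phi> m) X)\<^sup>2)) \<longlonglongrightarrow> ennreal ((step_integral_upto u (\<psi> n) X - limS \<phi> X)\<^sup>2)"
            by (intro tendsto_ennrealI tendsto_power tendsto_diff tendsto_const)
          then show ?case by (intro lim_imp_Liminf[symmetric]) auto
        qed
      qed
      also have "\<dots> \<le> liminf (\<lambda>m. \<integral>\<^sup>+X. ennreal ((step_integral_upto u (\<psi> n) X - step_integral_upto u (\<phi> m) X)\<^sup>2) \<partial>?P)"
        by (rule nn_integral_liminf) measurable
      also have "\<dots> \<le> liminf ?b" by (intro Liminf_mono always_eventually allI b)
      also have "liminf ?b = 4 * (2 * (sq_norm {0..u} (\<lambda>s. step_fun (\<psi> n) s - f s) + 0))"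
        by (intro lim_imp_Liminf ennreal_tendsto_cmult tendsto_add tendsto_const q0) auto
      finally show ?thesis by (simp add: mult.assoc[symmetric])
    qed
    moreover have "(\<lambda>n. 8 * sq_norm {0..u} (\<lambda>s. step_fun (\<psi> n) s - f s)) \<longlonglongrightarrow> 0"
      using tendsto_0_cmult_ennreal[OF lim, of 8] by simp
    ultimately show "(\<lambda>n. \<integral>\<^sup>+X. ennreal ((step_integral_upto u (\<psi> n) X - limS \<phi> X)\<^sup>2) \<partial>?P) \<longlonglongrightarrow> 0"
      by (rule tendsto_0_ennreal_le[rotated])
  qed
  have WI: "Q (wiener_integral_bridge ?P u f)"
    unfolding wiener_integral_bridge_def Q_def[symmetric] by (rule someI[where P = Q, OF ex])
  then show m: "wiener_integral_bridge ?P u f \<in> borel_measurable ?P" by (simp add: Q_def)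
  have "tendsto_in_probability ?P (\<lambda>n. step_integral_upto u (\<phi> n)) Z" if "Q Z" for Z
  proof (rule L2_tendsto_in_probability)
    show "step_integral_upto u (\<phi> n) \<in> borel_measurable ?P" for n by (rule S_measurable[OF \<phi>])
    show "Z \<in> borel_measurable ?P" using that by (simp add: Q_def)
    show "(\<lambda>n. \<integral>\<^sup>+X. ennreal ((step_integral_upto u (\<phi> n) X - Z X)\<^sup>2) \<partial>?P) \<longlonglongrightarrow> 0"
      using that \<phi> q0 unfolding Q_def L2_tendsto_iff_sq_norm by blast
  qed
  from this[OF ex] this[OF WI] have "AE X in ?P. limS \<phi> X = wiener_integral_bridge ?P u f X"
    by (rule tendsto_in_probability_AE_eq[OF S_measurable[OF \<phi>] lm m])
  then show "AE X in ?P. (\<lambda>n. step_integral_upto u (\<phi> n) X) \<longlonglongrightarrow> wiener_integral_bridge ?P u f X"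
    using limS_AE[OF f \<phi> fast] by eventually_elim simp
qed

subsection \<open>The concatenated laws\<close>

lemma distr_pair_snd:
  assumes "prob_space M" "prob_space N"
  shows "distr (M \<Otimes>\<^sub>M N) N snd = N"
proof (rule measure_eqI)
  interpret M: prob_space M by fact
  interpret N: prob_space N by fact
  fix A assume "A \<in> sets (distr (M \<Otimes>\<^sub>M N) N snd)"
  then have A: "A \<in> sets N" by simp
  then have "emeasure (distr (M \<Otimes>\<^sub>M N) N snd) A = emeasure (M \<Otimes>\<^sub>M N) (space M \<times> A)"
    by (auto simp: emeasure_distr space_pair_measure dest: sets.sets_into_space intro!: arg_cong2[where f = emeasure])
  with A show "emeasure (distr (M \<Otimes>\<^sub>M N) N snd) A = emeasure N A"
    by (simp add: N.emeasure_pair_measure_Times M.emeasure_space_1)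
qed simp

lemma restrict_concat_path:
  assumes "X \<in> extensional {0..u}" "X u = Y 0" "0 \<le> u"
  shows "restrict (concat_path u X Y) {0..u} = X"
proof
  fix s
  show "restrict (concat_path u X Y) {0..u} s = X s"
    using assms(2,3) extensional_arb[OF assms(1)]
    by (cases "s \<in> {0..u}") (auto simp: concat_path_def)
qed

lemma shift_concat_path:
  assumes "Y \<in> extensional {0..}" "X u = Y 0" "0 \<le> u"
  shows "shift_path u (concat_path u X Y) = Y"
proof
  fix s
  show "shift_path u (concat_path u X Y) s = Y s"
    using assms(2,3) extensional_arb[OF assms(1)]
    by (cases "0 \<le> s") (simp_all add: concat_path_def shift_path_def)
qed

lemma brownian_bridge_end:
  assumes "wiener_law W" "0 < u"
  shows "AE X in brownian_bridge W u. X u = 0"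
proof -
  have m: "bridge_path u \<in> W \<rightarrow>\<^sub>M path_space {0..u}"
    using assms(2) by (intro measurable_cong_path[OF wiener_lawD(2)[OF assms(1)]] measurable_bridge_path) simp
  have [measurable]: "(\<lambda>X. X u) \<in> borel_measurable (path_space {0..u} :: (real \<Rightarrow> real) measure)"
    using assms by (intro measurable_eval) simp
  have "{X \<in> space (path_space {0..u}). X u = (0 :: real)} \<in> sets (path_space {0..u})" by measurable
  from AE_distr_iff[OF m this] show ?thesis
    unfolding brownian_bridge_eq using assms by (simp add: bridge_path_def)
qed

lemma sym_bessel3_start:
  assumes W: "wiener_law W"
  shows "AE Y in sym_bessel3 W. Y 0 = 0"
proof (rule AE_I)
  have [measurable]: "(\<lambda>X. X 0) \<in> borel_measurable (path_space {0..} :: (real \<Rightarrow> real) measure)"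
    by (intro measurable_eval) simp
  let ?A = "{X \<in> space (path_space {0..}). X 0 \<noteq> (0::real)}"
  show A: "?A \<in> sets (sym_bessel3 W)" by (simp, measurable)
  show "{X \<in> space (sym_bessel3 W). X 0 \<noteq> 0} \<subseteq> ?A" by simp
  have "emeasure (sym_bessel3 W) ?A = emeasure W {X \<in> space W. norm_path X \<in> ?A}"
    using A measurable_space[OF measurable_neg_path]
    by (intro emeasure_sym_bessel3_symmetric wiener_lawD(2)[OF W]) (auto simp: neg_path_def)
  also have "\<dots> = 0"
  proof -
    have "AE X in W. X \<notin> {X \<in> space W. norm_path X \<in> ?A}"
      using wiener_lawD(3)[OF W] by eventually_elim (simp add: norm_path_def)
    moreover have "{X \<in> space W. norm_path X \<in> ?A} \<in> sets W"
    proof -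
      have "norm_path \<in> W \<rightarrow>\<^sub>M path_space {0..}"
        by (rule measurable_cong_path[OF wiener_lawD(2)[OF W] measurable_norm_path])
      from measurable_sets[OF this, of ?A] A show ?thesis by (simp add: vimage_def Int_def conj_commute)
    qed
    ultimately have "{X \<in> space W. norm_path X \<in> ?A} \<in> null_sets W" by (simp only: AE_iff_null_sets)
    then show ?thesis by (rule null_setsD1)
  qed
  finally show "emeasure (sym_bessel3 W) ?A = 0" .
qed

locale bridge_bessel =
  fixes W1 :: "(real \<Rightarrow> real) measure" and W3 :: "(real \<Rightarrow> real ^ 3) measure"
  assumes W1: "wiener_law W1" and W3: "wiener_law W3"
begin

abbreviation R :: "(real \<Rightarrow> real) measure" where "R \<equiv> sym_bessel3 W3"
abbreviation Br :: "real \<Rightarrow> (real \<Rightarrow> real) measure" where "Br u \<equiv> brownian_bridge W1 u"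
abbreviation K :: "real \<Rightarrow> (real \<Rightarrow> real) measure" where "K u \<equiv> concat_law u (Br u) R"

lemma prob_R: "prob_space R" by (rule prob_space_sym_bessel3[OF W3])

lemma prob_bridge: "0 < u \<Longrightarrow> prob_space (Br u)"
  by (rule prob_space_brownian_bridge[OF W1]) simp

lemma concat_measurable: "0 < u \<Longrightarrow> (\<lambda>(X, Y). concat_path u X Y) \<in> Br u \<Otimes>\<^sub>M R \<rightarrow>\<^sub>M path_space {0..}"
  using concat_path_measurable[of u] by (simp cong: measurable_cong_sets sets_pair_measure_cong)

lemma prob_K: "0 < u \<Longrightarrow> prob_space (K u)"
proof -
  assume u: "0 < u"
  interpret PB: prob_space "Br u" by (rule prob_bridge[OF u])
  interpret R: prob_space R by (rule prob_R)
  interpret pair_prob_space "Br u" R ..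
  show ?thesis unfolding concat_law_def by (rule prob_space_distr[OF concat_measurable[OF u]])
qed

text \<open>Both values are almost surely 0, so the constant branch of \<open>concat_path\<close> is
  null.\<close>

lemma AE_concat_meet:
  assumes u: "0 < u"
  shows "AE p in Br u \<Otimes>\<^sub>M R. fst p u = snd p 0"
proof -
  interpret R: prob_space R by (rule prob_R)
  have "AE p in Br u \<Otimes>\<^sub>M R. fst p u = 0"
    by (rule AE_distrD[OF measurable_fst], unfold R.distr_pair_fst) (rule brownian_bridge_end[OF W1 u])
  moreover have "AE p in Br u \<Otimes>\<^sub>M R. snd p 0 = 0"
    by (rule AE_distrD[OF measurable_snd], unfold distr_pair_snd[OF prob_bridge[OF u] prob_R]) (rule sym_bessel3_start[OF W3])
  ultimately show ?thesis by eventually_elim simp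
qed

text \<open>Where the pieces meet, restriction recovers the first one. Through this lemma and
  \<open>distr_K_shift\<close>, statements about the two component laws are pulled back to
  \<open>K u\<close>.\<close>

lemma distr_K_restrict:
  assumes u: "0 < u"
  shows "distr (K u) (Br u) (\<lambda>X. restrict X {0..u}) = Br u"
proof -
  interpret R: prob_space R by (rule prob_R)
  have m: "(\<lambda>X. restrict X {0..u}) \<in> path_space {0..} \<rightarrow>\<^sub>M Br u"
    using measurable_restrict_path[of u] u by (simp cong: measurable_cong_sets)
  have "distr (K u) (Br u) (\<lambda>X. restrict X {0..u}) = distr (Br u \<Otimes>\<^sub>M R) (Br u) ((\<lambda>X. restrict X {0..u}) \<circ> (\<lambda>(X, Y). concat_path u X Y))"
    unfolding concat_law_def by (rule distr_distr[OF m concat_measurable[OF u]])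
  also have "\<dots> = distr (Br u \<Otimes>\<^sub>M R) (Br u) fst"
  proof (rule distr_cong_AE[OF refl refl])
    show "AE p in Br u \<Otimes>\<^sub>M R. ((\<lambda>X. restrict X {0..u}) \<circ> (\<lambda>(X, Y). concat_path u X Y)) p = fst p"
      using AE_concat_meet[OF u] AE_space
    proof eventually_elim
      case (elim p)
      then show ?case using u
        by (cases p) (auto simp: space_pair_measure space_path_space intro!: restrict_concat_path)
    qed
    show "(\<lambda>X. restrict X {0..u}) \<circ> (\<lambda>(X, Y). concat_path u X Y) \<in> Br u \<Otimes>\<^sub>M R \<rightarrow>\<^sub>M Br u"
      by (rule measurable_comp[OF concat_measurable[OF u] m])
  qed measurable
  also have "\<dots> = Br u" by (rule R.distr_pair_fst)
  finally show ?thesis .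
qed

lemma distr_K_shift:
  assumes u: "0 < u"
  shows "distr (K u) R (shift_path u) = R"
proof -
  have m: "shift_path u \<in> path_space {0..} \<rightarrow>\<^sub>M R"
    using measurable_shift_path[of u] u by (simp cong: measurable_cong_sets)
  have "distr (K u) R (shift_path u) = distr (Br u \<Otimes>\<^sub>M R) R (shift_path u \<circ> (\<lambda>(X, Y). concat_path u X Y))"
    unfolding concat_law_def by (rule distr_distr[OF m concat_measurable[OF u]])
  also have "\<dots> = distr (Br u \<Otimes>\<^sub>M R) R snd"
  proof (rule distr_cong_AE[OF refl refl])
    show "AE p in Br u \<Otimes>\<^sub>M R. (shift_path u \<circ> (\<lambda>(X, Y). concat_path u X Y)) p = snd p"
      using AE_concat_meet[OF u] AE_space
    proof eventually_elim
      case (elim p)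
      then show ?case using u
        by (cases p) (auto simp: space_pair_measure space_path_space intro!: shift_concat_path)
    qed
    show "shift_path u \<circ> (\<lambda>(X, Y). concat_path u X Y) \<in> Br u \<Otimes>\<^sub>M R \<rightarrow>\<^sub>M R"
      by (rule measurable_comp[OF concat_measurable[OF u] m])
  qed measurable
  also have "\<dots> = R" by (rule distr_pair_snd[OF prob_bridge[OF u] prob_R])
  finally show ?thesis .
qed

lemma restrict_measurable_K: "0 < u \<Longrightarrow> (\<lambda>X. restrict X {0..u}) \<in> K u \<rightarrow>\<^sub>M Br u"
  using measurable_restrict_path[of u] by (simp cong: measurable_cong_sets)

lemma shift_measurable_K: "0 < u \<Longrightarrow> shift_path u \<in> K u \<rightarrow>\<^sub>M R"
  using measurable_shift_path[of u] by (simp cong: measurable_cong_sets)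

lemma AE_K_restrict: "0 < u \<Longrightarrow> AE X in Br u. P X \<Longrightarrow> AE X in K u. P (restrict X {0..u})"
  by (rule AE_distrD[OF restrict_measurable_K]) (simp, unfold distr_K_restrict)

lemma AE_K_shift: "0 < u \<Longrightarrow> AE X in R. P X \<Longrightarrow> AE X in K u. P (shift_path u X)"
  by (rule AE_distrD[OF shift_measurable_K]) (simp, unfold distr_K_shift)

lemma emeasure_K_restrict:
  assumes u: "0 < u" and m: "{X \<in> space (Br u). P X} \<in> sets (Br u)"
  shows "emeasure (K u) {X \<in> space (K u). P (restrict X {0..u})} = emeasure (Br u) {X \<in> space (Br u). P X}"
proof -
  have "emeasure (distr (K u) (Br u) (\<lambda>X. restrict X {0..u})) {X \<in> space (Br u). P X}
    = emeasure (K u) ((\<lambda>X. restrict X {0..u}) -` {X \<in> space (Br u). P X} \<inter> space (K u))"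
    by (rule emeasure_distr[OF restrict_measurable_K[OF u] m])
  also have "(\<lambda>X. restrict X {0..u}) -` {X \<in> space (Br u). P X} \<inter> space (K u) = {X \<in> space (K u). P (restrict X {0..u})}"
    using measurable_space[OF restrict_measurable_K[OF u]] by auto
  finally show ?thesis by (simp only: distr_K_restrict[OF u])
qed

lemma emeasure_K_shift:
  assumes u: "0 < u" and m: "{X \<in> space R. P X} \<in> sets R"
  shows "emeasure (K u) {X \<in> space (K u). P (shift_path u X)} = emeasure R {X \<in> space R. P X}"
proof -
  have "emeasure (distr (K u) R (shift_path u)) {X \<in> space R. P X}
    = emeasure (K u) (shift_path u -` {X \<in> space R. P X} \<inter> space (K u))"
    by (rule emeasure_distr[OF shift_measurable_K[OF u] m])
  also have "shift_path u -` {X \<in> space R. P X} \<inter> space (K u) = {X \<in> space (K u). P (shift_path u X)}"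
    using measurable_space[OF shift_measurable_K[OF u]] by auto
  finally show ?thesis by (simp only: distr_K_shift[OF u])
qed

text \<open>Dominates the constants of \<open>limS_bound\<close> for the bridge and the Bessel part
  together; the tolerance is \<open>\<epsilon> / 2\<close> because it is shared between the
  two.\<close>

definition limit_const :: "real \<Rightarrow> real" where
  "limit_const \<epsilon> = 2 * (4 + bessel_const TYPE(real ^ 3)) * (1 + 4 / (\<epsilon> / 2)\<^sup>2)"

text \<open>A shift does not increase the squared norm, so this term is bounded uniformly in
  \<open>u\<close>; only the weighted norm retains its dependence on \<open>u\<close>.\<close>

lemma bessel_dist_step_shift:
  assumes [measurable]: "f \<in> borel_measurable borel" and st: "is_step \<psi>" and u: "0 \<le> u"
  shows "bessel_dist (\<lambda>s. step_fun (step_shift u \<psi>) s - f (s + u)) \<le>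
    sq_norm {0..} (\<lambda>s. step_fun \<psi> s - f s) + wt_norm (\<lambda>s. 1 / sqrt s) (\<lambda>s. step_fun \<psi> (s + u) - f (s + u))"
proof -
  have "bessel_dist (\<lambda>s. step_fun (step_shift u \<psi>) s - f (s + u)) = bessel_dist (\<lambda>s. step_fun \<psi> (s + u) - f (s + u))"
    unfolding bessel_dist_def
    by (intro arg_cong2[where f = "(+)"] sq_norm_cong wt_norm_cong) (simp_all add: step_fun_shift[OF st])
  then show ?thesis
    unfolding bessel_dist_def using sq_norm_shift_le[of "\<lambda>s. step_fun \<psi> s - f s" u] u by (simp add: add_right_mono)
qed

lemma step_integral_split_restrict:
  assumes "is_step \<psi>" "0 \<le> u"
  shows "step_integral \<psi> X = step_integral_upto u \<psi> (restrict X {0..u}) + step_integral (step_shift u \<psi>) (shift_path u X)"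
proof -
  obtain n t c where \<psi>: "\<psi> = (n, t, c)" by (cases \<psi>)
  have "step_integral_upto u \<psi> (restrict X {0..u}) = step_integral_upto u \<psi> X"
    using is_step_nonneg[OF assms(1)[unfolded \<psi>]] assms(2)
    by (auto simp: \<psi> step_integral_upto_def step_integral_def intro!: sum.cong)
  then show ?thesis by (simp only: step_integral_split[OF assms, of X])
qed

context
  fixes f :: "real \<Rightarrow> real" and \<phi> :: "nat \<Rightarrow> step_data" and u :: real
  assumes f [measurable]: "f \<in> borel_measurable borel"
    and \<phi>: "\<And>n. is_step (\<phi> n)"
    and fast: "(\<Sum>n. 4 ^ n * sq_norm {0..} (\<lambda>s. step_fun (\<phi> n) s - f s)) < \<infinity>"
    and u: "0 < u"
    and fast_u: "(\<Sum>n. 4 ^ n * wt_norm (\<lambda>s. 1 / sqrt s) (\<lambda>s. step_fun (\<phi> n) (s + u) - f (s + u))) < \<infinity>"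
begin

lemma fast_bridge: "(\<Sum>n. 4 ^ n * sq_norm {0..u} (\<lambda>s. step_fun (\<phi> n) s - f s)) < \<infinity>"
  by (rule le_less_trans[OF _ fast]) (intro suminf_le mult_left_mono sq_norm_mono, auto)

lemma fast_bessel:
  "(\<Sum>n. 4 ^ n * bessel_dist (\<lambda>s. step_fun (step_shift u (\<phi> n)) s - f (s + u))) < \<infinity>"
proof -
  have "(\<Sum>n. 4 ^ n * bessel_dist (\<lambda>s. step_fun (step_shift u (\<phi> n)) s - f (s + u))) \<le>
    (\<Sum>n. 4 ^ n * (sq_norm {0..} (\<lambda>s. step_fun (\<phi> n) s - f s) + wt_norm (\<lambda>s. 1 / sqrt s) (\<lambda>s. step_fun (\<phi> n) (s + u) - f (s + u))))"
    using u by (intro suminf_le mult_left_mono bessel_dist_step_shift f \<phi>) auto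
  also have "\<dots> < \<infinity>"
    using fast fast_u by (simp add: distrib_left suminf_add[symmetric])
  finally show ?thesis .
qed

lemma AE_K_convergent:
  "AE X in K u. (\<lambda>n. step_integral (\<phi> n) X) \<longlonglongrightarrow>
     wiener_integral_bridge (Br u) u f (restrict X {0..u}) + wiener_integral_bessel R (\<lambda>s. f (s + u)) (shift_path u X)"
proof -
  have fu: "(\<lambda>s. f (s + u)) \<in> borel_measurable borel" by measurable
  have "AE X in K u. (\<lambda>n. step_integral_upto u (\<phi> n) (restrict X {0..u})) \<longlonglongrightarrow> wiener_integral_bridge (Br u) u f (restrict X {0..u})"
    by (rule AE_K_restrict[OF u]) (rule wiener_integral_bridge_AE[OF W1 u f \<phi> fast_bridge])
  moreover have "AE X in K u. (\<lambda>n. step_integral (step_shift u (\<phi> n)) (shift_path u X)) \<longlonglongrightarrow> wiener_integral_bessel R (\<lambda>s. f (s + u)) (shift_path u X)"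
    by (rule AE_K_shift[OF u]) (rule wiener_integral_bessel_AE[OF W3 fu is_step_shift[OF \<phi>] fast_bessel])
  ultimately show ?thesis
  proof eventually_elim
    case (elim X)
    show ?case
      using tendsto_add[OF elim] by (simp add: step_integral_split_restrict[OF \<phi> less_imp_le[OF u]])
  qed
qed

text \<open>The error along an arbitrary \<open>\<psi>\<close>, with explicit dependence on
  \<open>u\<close>; this is the bound that gets integrated over \<open>u\<close>. The limit is
  almost surely the sum of the two component limits, and each of these obeys
  \<open>limS_bound\<close>.\<close>

lemma emeasure_K_limit:
  assumes \<psi>: "is_step \<psi>" and \<epsilon>: "0 < \<epsilon>"
  shows "emeasure (K u) {X \<in> space (K u). \<epsilon> \<le> \<bar>step_integral \<psi> X - lim (\<lambda>n. step_integral (\<phi> n) X)\<bar>} \<le>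
    ennreal (limit_const \<epsilon>) * (2 * sq_norm {0..} (\<lambda>s. step_fun \<psi> s - f s) + wt_norm (\<lambda>s. 1 / sqrt s) (\<lambda>s. step_fun \<psi> (s + u) - f (s + u)))"
proof -
  have fu: "(\<lambda>s. f (s + u)) \<in> borel_measurable borel" by measurable
  interpret b: step_functional "Br u" "step_integral_upto u" "sq_norm {0..u}" 4 by (rule bridge_functional[OF W1 u])
  interpret r: step_functional R step_integral bessel_dist "bessel_const TYPE(real ^ 3)" by (rule bessel_functional[OF W3])
  let ?b = "b.limS \<phi>" and ?r = "r.limS (\<lambda>n. step_shift u (\<phi> n))"
  let ?B = "\<lambda>X. step_integral_upto u \<psi> X - ?b X" and ?R = "\<lambda>X. step_integral (step_shift u \<psi>) X - ?r X"
  have Bm [measurable]: "?B \<in> borel_measurable (Br u)"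
    by (intro borel_measurable_diff b.S_measurable \<psi> b.limS_measurable[OF f \<phi> fast_bridge])
  have Rm [measurable]: "?R \<in> borel_measurable R"
    by (intro borel_measurable_diff r.S_measurable is_step_shift \<psi> r.limS_measurable[OF fu is_step_shift[OF \<phi>] fast_bessel])
  have mB [measurable]: "(\<lambda>X. ?B (restrict X {0..u})) \<in> borel_measurable (K u)"
    by (rule measurable_compose[OF restrict_measurable_K[OF u] Bm])
  have mR [measurable]: "(\<lambda>X. ?R (shift_path u X)) \<in> borel_measurable (K u)"
    by (rule measurable_compose[OF shift_measurable_K[OF u] Rm])
  have sm: "step_integral \<rho> \<in> borel_measurable (K u)" if "is_step \<rho>" for \<rho>
    using measurable_step_integral[OF that] by (simp cong: measurable_cong_sets)
  have [measurable]: "step_integral \<psi> \<in> borel_measurable (K u)" "\<And>n. step_integral (\<phi> n) \<in> borel_measurable (K u)"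
    using sm \<phi> \<psi> by auto
  have "AE X in K u. (\<lambda>n. step_integral_upto u (\<phi> n) (restrict X {0..u})) \<longlonglongrightarrow> ?b (restrict X {0..u})"
    by (rule AE_K_restrict[OF u]) (rule b.limS_AE[OF f \<phi> fast_bridge])
  moreover have "AE X in K u. (\<lambda>n. step_integral (step_shift u (\<phi> n)) (shift_path u X)) \<longlonglongrightarrow> ?r (shift_path u X)"
    by (rule AE_K_shift[OF u]) (rule r.limS_AE[OF fu is_step_shift[OF \<phi>] fast_bessel])
  ultimately have ae: "AE X in K u. step_integral \<psi> X - lim (\<lambda>n. step_integral (\<phi> n) X) = ?B (restrict X {0..u}) + ?R (shift_path u X)"
  proof eventually_elim
    case (elim X)
    have "(\<lambda>n. step_integral (\<phi> n) X) \<longlonglongrightarrow> ?b (restrict X {0..u}) + ?r (shift_path u X)"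
      using tendsto_add[OF elim] by (simp add: step_integral_split_restrict[OF \<phi> less_imp_le[OF u]])
    from limI[OF this] show ?case
      using step_integral_split_restrict[OF \<psi>, of u X] u by simp
  qed
  have "emeasure (K u) {X \<in> space (K u). \<epsilon> \<le> \<bar>step_integral \<psi> X - lim (\<lambda>n. step_integral (\<phi> n) X)\<bar>}
    = emeasure (K u) {X \<in> space (K u). \<epsilon> \<le> \<bar>?B (restrict X {0..u}) + ?R (shift_path u X)\<bar>}"
  proof (rule emeasure_eq_AE)
    show "AE X in K u. (X \<in> {X \<in> space (K u). \<epsilon> \<le> \<bar>step_integral \<psi> X - lim (\<lambda>n. step_integral (\<phi> n) X)\<bar>}) =
      (X \<in> {X \<in> space (K u). \<epsilon> \<le> \<bar>?B (restrict X {0..u}) + ?R (shift_path u X)\<bar>})"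
      using ae by eventually_elim simp
  qed measurable
  also have "\<dots> \<le> emeasure (K u) {X \<in> space (K u). \<epsilon> / 2 \<le> \<bar>?B (restrict X {0..u})\<bar>}
    + emeasure (K u) {X \<in> space (K u). \<epsilon> / 2 \<le> \<bar>?R (shift_path u X)\<bar>}"
    by (rule emeasure_abs_ge_triangle[OF mB mR abs_triangle_ineq])
  also have "\<dots> = emeasure (Br u) {X \<in> space (Br u). \<epsilon> / 2 \<le> \<bar>?B X\<bar>} + emeasure R {X \<in> space R. \<epsilon> / 2 \<le> \<bar>?R X\<bar>}"
    by (intro arg_cong2[where f = "(+)"] emeasure_K_restrict emeasure_K_shift u) measurable
  also have "\<dots> \<le> ennreal (limit_const \<epsilon>) * sq_norm {0..} (\<lambda>s. step_fun \<psi> s - f s)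
    + ennreal (limit_const \<epsilon>) * (sq_norm {0..} (\<lambda>s. step_fun \<psi> s - f s) + wt_norm (\<lambda>s. 1 / sqrt s) (\<lambda>s. step_fun \<psi> (s + u) - f (s + u)))"
  proof (intro add_mono)
    have bc: "0 \<le> bessel_const TYPE(real ^ 3)" by (simp add: bessel_const_def)
    have "emeasure (Br u) {X \<in> space (Br u). \<epsilon> / 2 \<le> \<bar>?B X\<bar>} \<le> ennreal (2 * 4 * (1 + 4 / (\<epsilon> / 2)\<^sup>2)) * sq_norm {0..u} (\<lambda>s. step_fun \<psi> s - f s)"
      using \<epsilon> by (intro b.limS_bound[OF f \<phi> fast_bridge \<psi>]) simp
    also have "\<dots> \<le> ennreal (limit_const \<epsilon>) * sq_norm {0..} (\<lambda>s. step_fun \<psi> s - f s)"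
      unfolding limit_const_def using bc by (intro mult_mono ennreal_leI sq_norm_mono mult_right_mono) auto
    finally show "emeasure (Br u) {X \<in> space (Br u). \<epsilon> / 2 \<le> \<bar>?B X\<bar>} \<le> \<dots>" .
    have "emeasure R {X \<in> space R. \<epsilon> / 2 \<le> \<bar>?R X\<bar>} \<le> ennreal (2 * bessel_const TYPE(real ^ 3) * (1 + 4 / (\<epsilon> / 2)\<^sup>2)) *
       bessel_dist (\<lambda>s. step_fun (step_shift u \<psi>) s - f (s + u))"
      using \<epsilon> by (intro r.limS_bound[OF fu is_step_shift[OF \<phi>] fast_bessel is_step_shift[OF \<psi>]]) simp
    also have "\<dots> \<le> ennreal (limit_const \<epsilon>) * (sq_norm {0..} (\<lambda>s. step_fun \<psi> s - f s) + wt_norm (\<lambda>s. 1 / sqrt s) (\<lambda>s. step_fun \<psi> (s + u) - f (s + u)))"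
      unfolding limit_const_def using bc u by (intro mult_mono ennreal_leI mult_right_mono bessel_dist_step_shift f \<psi>) auto
    finally show "emeasure R {X \<in> space R. \<epsilon> / 2 \<le> \<bar>?R X\<bar>} \<le> \<dots>" .
  qed
  also have "\<dots> = ennreal (limit_const \<epsilon>) * (2 * sq_norm {0..} (\<lambda>s. step_fun \<psi> s - f s) + wt_norm (\<lambda>s. 1 / sqrt s) (\<lambda>s. step_fun \<psi> (s + u) - f (s + u)))"
    by (simp add: distrib_left[symmetric] mult_2 add.assoc)
  finally show ?thesis .
qed

end

end

subsection \<open>Sigma-finiteness\<close>

context bridge_bessel
begin

lemma kernel: "K \<in> restrict_space lborel {0<..} \<rightarrow>\<^sub>M subprob_algebra (path_space {0..})"
  by (rule concat_law_kernel[OF W1 prob_R sets_sym_bessel3])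

abbreviation \<mu> :: "real measure" where
  "\<mu> \<equiv> density (restrict_space lborel {0<..}) (\<lambda>u. ennreal (1 / sqrt (2 * pi * u)))"

lemma density_measurable: "(\<lambda>u. ennreal (1 / sqrt (2 * pi * u))) \<in> borel_measurable (restrict_space lborel {0<..})"
  by (rule measurable_restrict_space1) measurable

lemma kernel_\<mu>: "K \<in> \<mu> \<rightarrow>\<^sub>M subprob_algebra (path_space {0..})"
  using kernel by simp

text \<open>\<open>bind\<close> over an empty space is degenerate, so its rules ask for a
  point.\<close>

lemma space_\<mu>: "space \<mu> \<noteq> {}"
proof -
  have "(1::real) \<in> space \<mu>" by (simp add: space_restrict_space)
  then show ?thesis by blast
qed

lemma sets_scrW: "sets (scrW W1 W3) = sets (path_space {0..})"
  unfolding scrW_def by (rule sets_bind[OF _ space_\<mu>]) simp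

lemma space_scrW: "space (scrW W1 W3) = space (path_space {0..})"
  using sets_scrW by (rule sets_eq_imp_space_eq)

lemma emeasure_K_measurable:
  assumes "A \<in> sets (path_space {0..})"
  shows "(\<lambda>u. emeasure (K u) A) \<in> borel_measurable (restrict_space lborel {0<..})"
  by (rule measurable_compose[OF kernel measurable_emeasure_subprob_algebra[OF assms]])

lemma emeasure_scrW:
  assumes "A \<in> sets (path_space {0..})"
  shows "emeasure (scrW W1 W3) A =
    (\<integral>\<^sup>+u. ennreal (1 / sqrt (2 * pi * u)) * emeasure (K u) A \<partial>restrict_space lborel {0<..})"
  unfolding scrW_def
  using emeasure_bind[OF space_\<mu> kernel_\<mu> assms]
    nn_integral_density[OF density_measurable emeasure_K_measurable[OF assms]] by simp

lemma AE_scrWI: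
  assumes "Measurable.pred (path_space {0..}) P" and ae: "\<And>u. 0 < u \<Longrightarrow> AE X in K u. P X"
  shows "AE X in scrW W1 W3. P X"
  unfolding scrW_def AE_bind[OF kernel_\<mu> assms(1)] AE_density[OF density_measurable]
  by (subst AE_restrict_space_iff) (use ae in auto)

text \<open>The sets \<open>cover m\<close> make \<open>scrW\<close> sigma-finite without any information on the last zero of the
  path. Their \<open>K u\<close>-measure is small for large \<open>u\<close>, because the bridge is small at the last grid
  point before \<open>u\<close>, and they exhaust the path space by transience of the Bessel process along the
  grid. The mesh \<open>1/n^3\<close> and the level \<open>1/n\<close> near time \<open>n\<close> make both estimates summable.\<close>

definition grid :: "nat \<Rightarrow> nat \<Rightarrow> real" where "grid n i = real n + real i / real n ^ 3"

definition away :: "nat \<Rightarrow> (real \<Rightarrow> real) set" where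
  "away n = {X \<in> space (path_space {0..}). \<forall>i\<in>{..<n ^ 3}. 1 / real n \<le> \<bar>X (grid n i)\<bar>}"

definition cover :: "nat \<Rightarrow> (real \<Rightarrow> real) set" where
  "cover m = {X \<in> space (path_space {0..}). \<forall>n. Suc m \<le> n \<longrightarrow> X \<in> away n}"

lemma grid_nonneg: "0 \<le> grid n i" by (simp add: grid_def)

lemma grid_eval: "(\<lambda>X. X (grid n i)) \<in> borel_measurable (path_space {0..})"
  by (rule measurable_eval) (simp add: grid_nonneg)

lemma away_sets [measurable]: "away n \<in> sets (path_space {0..})"
proof -
  note grid_eval[measurable]
  show ?thesis unfolding away_def by measurable
qed

lemma cover_sets [measurable]: "cover m \<in> sets (path_space {0..})"
  unfolding cover_def by measurable

text \<open>The bridge ends at 0, so up to sign its value at \<open>t\<close> is the integral of the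
  indicator of \<open>[t, u)\<close>, to which \<open>bridge_step_bound\<close> applies.\<close>

lemma bridge_near_end:
  assumes t: "0 \<le> t" "t \<le> u" and u: "0 < u"
  shows "(\<integral>\<^sup>+X. ennreal ((X t)\<^sup>2) \<partial>Br u) \<le> 4 * ennreal (u - t)"
proof -
  obtain \<psi> where \<psi>: "is_step \<psi>" and int: "\<And>Y. step_integral \<psi> Y = Y u - Y t"
    using ex_step_sum[of "{()}" "\<lambda>_. t" "\<lambda>_. u" "\<lambda>_. 1"] t by auto
  have "(\<integral>\<^sup>+X. ennreal ((X t)\<^sup>2) \<partial>Br u) = (\<integral>\<^sup>+X. ennreal ((step_integral_upto u \<psi> X)\<^sup>2) \<partial>Br u)"
  proof (rule nn_integral_cong_AE)
    show "AE X in Br u. ennreal ((X t)\<^sup>2) = ennreal ((step_integral_upto u \<psi> X)\<^sup>2)"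
      using brownian_bridge_end[OF W1 u]
      by eventually_elim (use t in \<open>simp add: step_integral_upto_def int min_def\<close>)
  qed
  also have "\<dots> \<le> 4 * sq_norm {0..u} (step_fun \<psi>)" by (rule bridge_step_bound[OF W1 u \<psi>])
  also have "sq_norm {0..u} (step_fun \<psi>) \<le> ennreal (u - t)"
  proof -
    have "sq_norm {0..u} (step_fun \<psi>) \<le> (\<integral>\<^sup>+s. indicator {t..u} s \<partial>lborel)"
      unfolding sq_norm_def using t
      by (intro nn_integral_mono) (auto simp: step_fun_eq_step_integral[OF \<psi>] int indicator_def)
    also have "\<dots> = ennreal (u - t)" using t by simp
    finally show ?thesis .
  qed
  finally show ?thesis by (simp add: mult_left_mono)
qed

text \<open>Let \<open>n\<close> be the integer part of \<open>u\<close> and \<open>t\<close> the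
  last grid point not after \<open>u\<close>. Paths in \<open>cover m\<close> have absolute value at
  least \<open>1 / n\<close> at \<open>t\<close>, while the second moment there is at most
  \<open>4 / n^3\<close>. Chebyshev gives \<open>4 / n\<close>, and
  \<open>u < n + 1 \<le> 2 * n\<close>.\<close>

lemma emeasure_K_cover:
  assumes u: "real (Suc m) < u"
  shows "emeasure (K u) (cover m) \<le> ennreal (8 / u)"
proof -
  define n where "n = nat \<lfloor>u\<rfloor>"
  have u0: "0 < u" using u by linarith
  have n: "real n \<le> u" "u < real n + 1" "Suc m \<le> n" using u u0 by (auto simp: n_def le_nat_floor)
  have n1: "1 \<le> real n" using n(3) by linarith
  define N where "N = real n ^ 3"
  have N: "0 < N" using n1 by (simp add: N_def)
  define i where "i = nat \<lfloor>(u - real n) * N\<rfloor>"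
  have ri: "real i = real_of_int \<lfloor>(u - real n) * N\<rfloor>" using n(1) N by (simp add: i_def)
  have i: "real i \<le> (u - real n) * N" "(u - real n) * N < real i + 1" unfolding ri by linarith+
  define t where "t = grid n i"
  have "real i / N \<le> u - real n" "u - real n < real i / N + 1 / N"
    using i N by (simp_all add: field_simps)
  then have t: "0 \<le> t" "t \<le> u" "u - t \<le> 1 / N"
    using grid_nonneg[of n i] by (simp_all add: t_def grid_def N_def)
  have "(u - real n) * N < 1 * N" using n N by (intro mult_strict_right_mono) auto
  then have "real i < N" using i(1) by linarith
  then have "real i < real (n ^ 3)" by (simp add: N_def)
  then have "i < n ^ 3" by (simp only: of_nat_less_iff)
  then have "cover m \<subseteq> {X \<in> space (K u). 1 / real n \<le> \<bar>X t\<bar>}"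
    using n(3) by (auto simp: cover_def away_def t_def)
  moreover have [measurable]: "(\<lambda>X. X t) \<in> borel_measurable (path_space {0..} :: (real \<Rightarrow> real) measure)"
    using t by (intro measurable_eval) simp
  moreover have "{X \<in> space (K u). 1 / real n \<le> \<bar>X t\<bar>} \<in> sets (K u)" by simp
  ultimately have "emeasure (K u) (cover m) \<le> emeasure (K u) {X \<in> space (K u). 1 / real n \<le> \<bar>X t\<bar>}"
    by (intro emeasure_mono)
  also have "\<dots> = emeasure (K u) {X \<in> space (K u). 1 / real n \<le> \<bar>restrict X {0..u} t\<bar>}"
    using t by simp
  also have "\<dots> = emeasure (Br u) {X \<in> space (Br u). 1 / real n \<le> \<bar>X t\<bar>}"
  proof (rule emeasure_K_restrict[OF u0])
    have "(\<lambda>X. X t) \<in> borel_measurable (path_space {0..u} :: (real \<Rightarrow> real) measure)"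
      using t by (intro measurable_eval) simp
    then show "{X \<in> space (Br u). 1 / real n \<le> \<bar>X t\<bar>} \<in> sets (Br u)" by simp
  qed
  also have "\<dots> \<le> ennreal (1 / (1 / real n)\<^sup>2) * (\<integral>\<^sup>+X. ennreal ((X t)\<^sup>2) \<partial>Br u)"
  proof (rule emeasure_abs_ge_le_square)
    show "(\<lambda>X. X t) \<in> borel_measurable (Br u)"
      using t measurable_eval[of t "{0..u}"] by (simp cong: measurable_cong_sets)
  qed (use n1 in simp)
  also have "\<dots> \<le> ennreal (1 / (1 / real n)\<^sup>2) * (4 * ennreal (1 / N))"
    using t by (intro mult_left_mono order_trans[OF bridge_near_end] ennreal_leI u0) auto
  also have "\<dots> = ennreal (4 / real n)"
    using n1 by (simp add: N_def power_divide ennreal_mult[symmetric] power2_eq_square power3_eq_cube field_simps flip: ennreal_numeral)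
  also have "\<dots> \<le> ennreal (8 / u)"
    using n n1 u0 by (intro ennreal_leI) (simp add: field_simps)
  finally show ?thesis .
qed

text \<open>Reflected at \<open>s\<close>, the integral is compared with that of
  \<open>nn_integral_shift_weight\<close>, since on \<open>{0..s}\<close> the weight is at least
  \<open>shift_weight s > 0\<close>.\<close>

lemma nn_integral_inverse_sqrt_finite:
  assumes "0 \<le> s"
  shows "(\<integral>\<^sup>+u. ennreal (1 / sqrt u) * indicator {0..s} u \<partial>lborel) < \<infinity>"
proof -
  have "(\<integral>\<^sup>+u. ennreal (1 / sqrt u) * indicator {0..s} u \<partial>lborel) =
    (\<integral>\<^sup>+u. ennreal (1 / sqrt (s + - 1 * u)) * indicator {0..s} (s + - 1 * u) \<partial>lborel)"
    by (subst nn_integral_real_affine[where c = "- 1" and t = s]) simp_all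
  also have "\<dots> \<le> (\<integral>\<^sup>+u. ennreal (1 / shift_weight s) * (ennreal (shift_weight u * (1 / sqrt (s - u))) * indicator {0..s} u) \<partial>lborel)"
  proof (intro nn_integral_mono)
    fix u :: real
    show "ennreal (1 / sqrt (s + - 1 * u)) * indicator {0..s} (s + - 1 * u) \<le>
      ennreal (1 / shift_weight s) * (ennreal (shift_weight u * (1 / sqrt (s - u))) * indicator {0..s} u)"
    proof (cases "u \<in> {0..s}")
      case True
      then have u: "0 \<le> u" "u \<le> s" by auto
      have "shift_weight s \<le> shift_weight u"
        unfolding shift_weight_def using u by (intro divide_left_mono mult_mono mult_pos_pos) auto
      then have "1 \<le> 1 / shift_weight s * shift_weight u"
        using shift_weight_pos[OF assms] by (simp add: field_simps)
      then have "1 * (1 / sqrt (s - u)) \<le> 1 / shift_weight s * shift_weight u * (1 / sqrt (s - u))"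
        using u by (intro mult_right_mono) auto
      then have "ennreal (1 / sqrt (s - u)) \<le> ennreal (1 / shift_weight s) * ennreal (shift_weight u * (1 / sqrt (s - u)))"
        using u shift_weight_pos[OF assms] shift_weight_pos[OF u(1)]
        by (subst ennreal_mult[symmetric]) (auto intro!: ennreal_leI)
      then show ?thesis using u by simp
    qed (auto simp: indicator_def)
  qed
  also have "\<dots> = ennreal (1 / shift_weight s) * (\<integral>\<^sup>+u. ennreal (shift_weight u * (1 / sqrt (s - u))) * indicator {0..s} u \<partial>lborel)"
    by (rule nn_integral_cmult) measurable
  also have "\<dots> \<le> ennreal (1 / shift_weight s) * ennreal (3 / (1 + sqrt s))"
    by (intro mult_left_mono nn_integral_shift_weight assms) auto
  also have "\<dots> < \<infinity>" by (simp add: ennreal_mult_less_top)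
  finally show ?thesis .
qed

lemma nn_integral_shift_weight_finite: "(\<integral>\<^sup>+u. ennreal (shift_weight u) * indicator {0..} u \<partial>lborel) < \<infinity>"
proof -
  have "(\<integral>\<^sup>+u. ennreal (shift_weight u) * indicator {0..} u \<partial>lborel) = ennreal (0 - (- 2 / sqrt (1 + 0)))"
  proof (rule nn_integral_FTC_atLeast)
    fix u :: real assume u: "0 \<le> u"
    show "0 \<le> shift_weight u" using shift_weight_pos[OF u] by simp
    have "((\<lambda>u. - 2 / sqrt (1 + u)) has_real_derivative (- (- 2 * (1 * (inverse (sqrt (1 + u)) / 2)) / (sqrt (1 + u) * sqrt (1 + u))))) (at u)"
      using u by (auto intro!: derivative_eq_intros)
    also have "- (- 2 * (1 * (inverse (sqrt (1 + u)) / 2)) / (sqrt (1 + u) * sqrt (1 + u))) = shift_weight u"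
      using u by (simp add: shift_weight_def field_simps)
    finally show "((\<lambda>u. - 2 / sqrt (1 + u)) has_real_derivative shift_weight u) (at u)" .
  next
    show "((\<lambda>u. - 2 / sqrt (1 + u)) \<longlongrightarrow> 0) at_top" by real_asymp
  qed measurable
  then show ?thesis by simp
qed

lemma emeasure_scrW_cover: "emeasure (scrW W1 W3) (cover m) < \<infinity>"
proof -
  let ?v = "\<lambda>u. ennreal (1 / sqrt (2 * pi * u))"
  have v: "1 / sqrt (2 * pi * u) \<le> 1 / sqrt u" if "0 < u" for u
    using that pi_gt3 by (intro divide_left_mono) (auto simp: mult_le_cancel_right1)
  have "emeasure (scrW W1 W3) (cover m) = (\<integral>\<^sup>+u. ?v u * emeasure (K u) (cover m) * indicator {0<..} u \<partial>lborel)"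
    by (simp add: emeasure_scrW nn_integral_restrict_space)
  also have "\<dots> \<le> (\<integral>\<^sup>+u. ennreal (1 / sqrt u) * indicator {0..real (Suc m)} u + 32 * (ennreal (shift_weight u) * indicator {0..} u) \<partial>lborel)"
  proof (intro nn_integral_mono)
    fix u :: real
    consider "u \<le> 0" | "0 < u" "u \<le> real (Suc m)" | "0 < u" "real (Suc m) < u" by linarith
    then show "?v u * emeasure (K u) (cover m) * indicator {0<..} u \<le>
      ennreal (1 / sqrt u) * indicator {0..real (Suc m)} u + 32 * (ennreal (shift_weight u) * indicator {0..} u)"
    proof cases
      case 2
      interpret prob_space "K u" by (rule prob_K[OF 2(1)])
      have "?v u * emeasure (K u) (cover m) \<le> ennreal (1 / sqrt u) * 1"
        using v[OF 2(1)] by (intro mult_mono ennreal_leI emeasure_le_1) auto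
      then show ?thesis using 2 by (simp add: add_increasing2)
    next
      case 3
      have u1: "1 \<le> u" using 3 by simp
      have "?v u * emeasure (K u) (cover m) \<le> ennreal (1 / sqrt u) * ennreal (8 / u)"
        using v[OF 3(1)] by (intro mult_mono ennreal_leI emeasure_K_cover 3) auto
      also have "\<dots> = ennreal (8 * (1 / (u * sqrt u)))"
        using 3 by (simp add: ennreal_mult[symmetric] mult.commute)
      \<comment> \<open>For \<open>u \<ge> 1\<close> one has \<open>1 + u \<le> 2 * u\<close> and
        \<open>sqrt (1 + u) \<le> 2 * sqrt u\<close>; hence the factor 4.\<close>
      also have "\<dots> \<le> ennreal (8 * (4 * shift_weight u))"
      proof (intro ennreal_leI mult_left_mono)
        have "sqrt (1 + u) \<le> sqrt (4 * u)" using u1 by (intro real_sqrt_le_mono) simp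
        then have "sqrt (1 + u) \<le> 2 * sqrt u" by (simp add: real_sqrt_mult)
        then have "(1 + u) * sqrt (1 + u) \<le> (2 * u) * (2 * sqrt u)" using u1 by (intro mult_mono) auto
        then have "4 / ((2 * u) * (2 * sqrt u)) \<le> 4 / ((1 + u) * sqrt (1 + u))"
          using u1 by (intro divide_left_mono mult_pos_pos) auto
        then show "1 / (u * sqrt u) \<le> 4 * shift_weight u" by (simp add: shift_weight_def)
      qed simp
      also have "\<dots> = 32 * ennreal (shift_weight u)"
        using shift_weight_pos[of u] u1 by (simp add: ennreal_mult)
      finally show ?thesis using 3 by (simp add: add_increasing)
    qed simp
  qed
  also have "\<dots> = (\<integral>\<^sup>+u. ennreal (1 / sqrt u) * indicator {0..real (Suc m)} u \<partial>lborel) + 32 * (\<integral>\<^sup>+u. ennreal (shift_weight u) * indicator {0..} u \<partial>lborel)"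
    by (simp add: nn_integral_add nn_integral_cmult)
  also have "\<dots> < \<infinity>"
    using nn_integral_inverse_sqrt_finite[of "real (Suc m)"] nn_integral_shift_weight_finite
    by (simp add: ennreal_mult_less_top del: of_nat_Suc)
  finally show ?thesis .
qed

section \<open>Transience of the Bessel process along the grid\<close>

lemma emeasure_R_small:
  assumes s: "0 < s" and r: "0 < r"
  shows "emeasure R {Y \<in> space R. \<bar>Y s\<bar> < r} \<le> ennreal ((2 * r / sqrt s) ^ 3)"
proof -
  interpret brownian W3 by unfold_locales (rule W3)
  have [measurable]: "(\<lambda>X. X s) \<in> borel_measurable (path_space {0..} :: (real \<Rightarrow> real) measure)"
    using s by (intro measurable_eval) simp
  let ?A = "{Y \<in> space (path_space {0..}). \<bar>Y s\<bar> < r}"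
  have "emeasure R ?A = emeasure W3 {X \<in> space W3. norm_path X \<in> ?A}"
  proof (rule emeasure_sym_bessel3_symmetric[OF wiener_lawD(2)[OF W3]])
    show "?A \<in> sets (path_space {0..})" by measurable
    show "neg_path X \<in> ?A \<longleftrightarrow> X \<in> ?A" if "X \<in> space (path_space {0..})" for X
      using that measurable_space[OF measurable_neg_path that] s by (simp add: neg_path_def)
  qed
  also have "{X \<in> space W3. norm_path X \<in> ?A} = {X \<in> space W3. norm (X s) < r}"
    using measurable_space[OF measurable_cong_path[OF wiener_lawD(2)[OF W3] measurable_norm_path]] s
    by (auto simp: norm_path_def)
  also have "emeasure W3 \<dots> = emeasure W3 {X \<in> space W3. norm (X s - X 0) < r}"
  proof (rule emeasure_eq_AE)
    show "AE X in W3. (X \<in> {X \<in> space W3. norm (X s) < r}) = (X \<in> {X \<in> space W3. norm (X s - X 0) < r})"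
      using wiener_lawD(3)[OF W3] by eventually_elim simp
    have [measurable]: "(\<lambda>X. X s) \<in> borel_measurable W3" "(\<lambda>X. X 0) \<in> borel_measurable W3"
      using s by (auto intro: eval_measurable)
    show "{X \<in> space W3. norm (X s) < r} \<in> sets W3" "{X \<in> space W3. norm (X s - X 0) < r} \<in> sets W3"
      by measurable
  qed
  also have "\<dots> \<le> ennreal ((2 * r / sqrt s) ^ 3)"
    using increment_small_ball[of 0 s r] s r by simp
  finally show ?thesis by simp
qed

text \<open>For \<open>n \<ge> 2 * u\<close> every grid time is at least \<open>n / 2\<close> after
  \<open>u\<close>, so the small-ball bound gives at most \<open>sqrt 8 ^ 3 * n powr (-9/2)\<close>
  per grid point. The union over \<open>n ^ 3\<close> points leaves the summable power -3/2.\<close>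

lemma measure_K_away:
  assumes u: "0 < u" and n: "2 * u \<le> real n" "1 \<le> n"
  shows "measure (K u) (space (K u) - away n) \<le> sqrt 8 ^ 3 * real n powr (- 3 / 2)"
proof -
  interpret prob_space "K u" by (rule prob_K[OF u])
  define B where "B i = {X \<in> space (K u). \<bar>X (grid n i)\<bar> < 1 / real n}" for i
  have [measurable]: "(\<lambda>X. X (grid n i)) \<in> borel_measurable (K u)" for i
    using grid_eval[of n i] by (simp cong: measurable_cong_sets)
  have Bm: "B i \<in> sets (K u)" for i unfolding B_def by measurable
  have Bi: "measure (K u) (B i) \<le> (2 * (1 / real n) / sqrt (real n / 2)) ^ 3" for i
  proof -
    define s where "s = grid n i - u"
    have "real n \<le> grid n i" by (simp add: grid_def)
    then have s: "real n / 2 \<le> s" "0 < s" unfolding s_def using n u by linarith+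
    have "B i = {X \<in> space (K u). \<bar>shift_path u X s\<bar> < 1 / real n}"
      using s by (simp add: B_def shift_path_def s_def)
    then have "emeasure (K u) (B i) = emeasure R {Y \<in> space R. \<bar>Y s\<bar> < 1 / real n}"
    proof (simp only:, intro emeasure_K_shift[OF u])
      have "(\<lambda>X. X s) \<in> borel_measurable (path_space {0..} :: (real \<Rightarrow> real) measure)"
        using s by (intro measurable_eval) simp
      then show "{Y \<in> space R. \<bar>Y s\<bar> < 1 / real n} \<in> sets R" by simp
    qed
    also have "\<dots> \<le> ennreal ((2 * (1 / real n) / sqrt s) ^ 3)"
      using s n by (intro emeasure_R_small) auto
    also have "\<dots> \<le> ennreal ((2 * (1 / real n) / sqrt (real n / 2)) ^ 3)"
      using s n by (intro ennreal_leI power_mono divide_left_mono mult_pos_pos) auto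
    finally show ?thesis using n by (simp add: emeasure_eq_measure ennreal_le_iff)
  qed
  have "space (K u) - away n \<subseteq> (\<Union>i\<in>{..<n ^ 3}. B i)"
    by (auto simp: away_def B_def not_le)
  then have "measure (K u) (space (K u) - away n) \<le> measure (K u) (\<Union>i\<in>{..<n ^ 3}. B i)"
    using Bm by (intro finite_measure_mono) auto
  also have "\<dots> \<le> (\<Sum>i\<in>{..<n ^ 3}. measure (K u) (B i))"
    using Bm by (intro finite_measure_subadditive_finite) auto
  also have "\<dots> \<le> (\<Sum>i\<in>{..<n ^ 3}. (2 * (1 / real n) / sqrt (real n / 2)) ^ 3)"
    by (intro sum_mono Bi)
  also have "\<dots> = (real n * (2 * (1 / real n) / sqrt (real n / 2))) ^ 3"
    by (simp only: sum_constant card_lessThan of_nat_power power_mult_distrib)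
  also have "real n * (2 * (1 / real n) / sqrt (real n / 2)) = sqrt 8 * real n powr (- 1 / 2)"
  proof -
    have "sqrt 8 = 2 * sqrt 2" using real_sqrt_mult[of 4 2] by simp
    moreover have "real n powr (- 1 / 2) = 1 / sqrt (real n)"
      using n by (simp add: powr_minus_divide powr_half_sqrt)
    ultimately show ?thesis using n by (simp add: real_sqrt_divide)
  qed
  also have "(sqrt 8 * real n powr (- 1 / 2)) ^ 3 = sqrt 8 ^ 3 * real n powr (- 3 / 2)"
    using n by (simp add: power_mult_distrib powr_power)
  finally show ?thesis .
qed

lemma AE_K_cover:
  assumes u: "0 < u"
  shows "AE X in K u. \<exists>m. X \<in> cover m"
proof -
  interpret prob_space "K u" by (rule prob_K[OF u])
  have "summable (\<lambda>n. measure (K u) (space (K u) - away n))"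
  proof (rule summable_comparison_test_ev)
    obtain N where "max (2 * u) 1 \<le> real N" using real_arch_simple by blast
    then have "\<forall>\<^sub>F n in sequentially. max (2 * u) 1 \<le> real n"
      unfolding eventually_sequentially by (intro exI[of _ N] allI impI) (meson of_nat_mono order_trans)
    then show "\<forall>\<^sub>F n in sequentially. norm (measure (K u) (space (K u) - away n)) \<le> sqrt 8 ^ 3 * real n powr (- 3 / 2)"
      by eventually_elim (use measure_K_away[OF u] in simp)
    show "summable (\<lambda>n. sqrt 8 ^ 3 * real n powr (- 3 / 2))"
      by (intro summable_mult) (simp add: summable_real_powr_iff)
  qed
  then have "AE X in K u. \<forall>\<^sub>F n in sequentially. X \<in> space (K u) - (space (K u) - away n)"
    by (intro borel_cantelli_AE1) (auto simp: less_top[symmetric])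
  then show ?thesis
  proof eventually_elim
    case (elim X)
    then obtain m where m: "\<And>n. m \<le> n \<Longrightarrow> X \<in> space (K u) - (space (K u) - away n)"
      by (auto simp: eventually_sequentially)
    have "X \<in> space (K u)" using m[of m] by blast
    moreover have "X \<in> away n" if "Suc m \<le> n" for n using m[of n] that by auto
    ultimately have "X \<in> cover m" by (simp add: cover_def)
    then show ?case by blast
  qed
qed

lemma AE_scrW_cover: "AE X in scrW W1 W3. \<exists>m. X \<in> cover m"
  by (rule AE_scrWI) (measurable, rule AE_K_cover)

end

subsection \<open>The Wiener integral under the sigma-finite measure\<close>

text \<open>Convergence \<open>b n \<rightarrow> 0\<close> is only known in \<open>L^1\<close> for the weight \<open>w\<close>, which is much smaller
  than the density \<open>v\<close> near \<open>0\<close> and at infinity; the bound \<open>h\<close> takes over where \<open>v > k w\<close>.\<close>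

lemma tendsto_0_nn_integral_change_weight:
  fixes e b :: "nat \<Rightarrow> 'a \<Rightarrow> ennreal" and v w h :: "'a \<Rightarrow> ennreal"
  assumes [measurable]: "\<And>n. b n \<in> borel_measurable M" "v \<in> borel_measurable M" "w \<in> borel_measurable M"
      "h \<in> borel_measurable M"
    and h: "\<And>n x. x \<in> space M \<Longrightarrow> e n x \<le> h x" and b: "\<And>n. AE x in M. e n x \<le> b n x"
    and fin: "(\<integral>\<^sup>+x. v x * h x \<partial>M) < \<infinity>"
    and lim: "(\<lambda>n. \<integral>\<^sup>+x. w x * b n x \<partial>M) \<longlonglongrightarrow> 0"
    and w: "\<And>x. x \<in> space M \<Longrightarrow> 0 < w x" and v: "\<And>x. x \<in> space M \<Longrightarrow> v x < \<infinity>"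
  shows "(\<lambda>n. \<integral>\<^sup>+x. v x * e n x \<partial>M) \<longlonglongrightarrow> 0"
proof (rule tendsto_zero_ennreal)
  fix r :: real assume r: "0 < r"
  \<comment> \<open>Since \<open>v\<close> is finite and \<open>w\<close> positive, the sets where
    \<open>v\<close> exceeds \<open>k * w\<close> shrink to the empty set; \<open>k\<close> is fixed
    before \<open>n\<close> is sent to infinity.\<close>
  have "(\<lambda>k. \<integral>\<^sup>+x. v x * h x * indicator {x \<in> space M. of_nat k * w x < v x} x \<partial>M) \<longlonglongrightarrow> (\<integral>\<^sup>+x. 0 \<partial>M)"
  proof (rule nn_integral_dominated_convergence[where w = "\<lambda>x. v x * h x"])
    show "AE x in M. (\<lambda>k. v x * h x * indicator {x \<in> space M. of_nat k * w x < v x} x) \<longlonglongrightarrow> 0"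
    proof (intro AE_I2)
      fix x assume x: "x \<in> space M"
      obtain c where c: "v x = ennreal c" "0 \<le> c" using v[OF x] by (cases "v x") auto
      \<comment> \<open>\<open>w x\<close> may be infinite, so a finite positive lower bound is used
        in its place.\<close>
      obtain d where d: "0 < d" "ennreal d \<le> w x"
        using w[OF x] by (cases "w x") (auto intro: that[of 1])
      obtain k0 where k0: "c / d \<le> real k0" using real_arch_simple by blast
      have "\<not> of_nat k * w x < v x" if "k0 \<le> k" for k
      proof -
        have "c \<le> real k * d" using k0 that d(1) by (simp add: field_simps) (metis mult_right_mono of_nat_mono less_imp_le order_trans mult.commute)
        then have "v x \<le> ennreal (real k) * ennreal d" using c d by (simp add: ennreal_mult[symmetric] ennreal_leI)
        also have "\<dots> \<le> of_nat k * w x" using d(2) by (simp add: ennreal_of_nat_eq_real_of_nat mult_left_mono)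
        finally show ?thesis by simp
      qed
      then have "\<forall>\<^sub>F k in sequentially. v x * h x * indicator {x \<in> space M. of_nat k * w x < v x} x = 0"
        by (auto simp: eventually_sequentially intro!: exI[of _ k0])
      then show "(\<lambda>k. v x * h x * indicator {x \<in> space M. of_nat k * w x < v x} x) \<longlonglongrightarrow> 0"
        by (rule tendsto_eventually)
    qed
    show "AE x in M. v x * h x * indicator {x \<in> space M. of_nat k * w x < v x} x \<le> v x * h x" for k
      by (intro AE_I2) (auto simp: indicator_def)
  qed (use fin in auto)
  from order_tendstoD(2)[OF this, of "ennreal (r / 2)"] r obtain k where
    k: "(\<integral>\<^sup>+x. v x * h x * indicator {x \<in> space M. of_nat k * w x < v x} x \<partial>M) < ennreal (r / 2)"
    by (auto simp: eventually_sequentially)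
  have "(\<lambda>n. of_nat k * (\<integral>\<^sup>+x. w x * b n x \<partial>M)) \<longlonglongrightarrow> 0"
    by (rule tendsto_0_cmult_ennreal[OF lim]) (simp add: ennreal_of_nat_eq_real_of_nat)
  from order_tendstoD(2)[OF this, of "ennreal (r / 2)"] r
  have "\<forall>\<^sub>F n in sequentially. of_nat k * (\<integral>\<^sup>+x. w x * b n x \<partial>M) < ennreal (r / 2)" by simp
  then show "\<forall>\<^sub>F n in sequentially. (\<integral>\<^sup>+x. v x * e n x \<partial>M) < ennreal r"
  proof eventually_elim
    case (elim n)
    have "(\<integral>\<^sup>+x. v x * e n x \<partial>M) \<le> (\<integral>\<^sup>+x. v x * h x * indicator {x \<in> space M. of_nat k * w x < v x} x + of_nat k * (w x * b n x) \<partial>M)"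
    proof (rule nn_integral_mono_AE)
      show "AE x in M. v x * e n x \<le> v x * h x * indicator {x \<in> space M. of_nat k * w x < v x} x + of_nat k * (w x * b n x)"
        using b[of n] AE_space
      proof eventually_elim
        case (elim x)
        show ?case
        proof (cases "of_nat k * w x < v x")
          case True
          then show ?thesis using h[OF elim(2), of n] elim(2) by (simp add: mult_left_mono add_increasing2)
        next
          case False
          then have "v x * e n x \<le> of_nat k * w x * b n x" using elim by (intro mult_mono) auto
          then show ?thesis using False by (simp add: mult.assoc)
        qed
      qed
    qed
    also have "\<dots> = (\<integral>\<^sup>+x. v x * h x * indicator {x \<in> space M. of_nat k * w x < v x} x \<partial>M) + of_nat k * (\<integral>\<^sup>+x. w x * b n x \<partial>M)"
      by (subst nn_integral_add) (simp_all add: nn_integral_cmult)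
    also have "\<dots> < ennreal (r / 2) + ennreal (r / 2)" by (rule add_strict_mono[OF k elim])
    also have "\<dots> = ennreal r" using r by (simp add: ennreal_plus[symmetric] del: ennreal_plus)
    finally show ?case .
  qed
qed

context bridge_bessel
begin

text \<open>The tail bound of \<open>emeasure_K_limit\<close> is summable against
  \<open>shift_weight\<close> by \<open>nn_integral_weight_shift\<close>, but not against the
  density of \<open>scrW\<close>; the change of weight bridges this gap.\<close>

lemma scrW_local_limit:
  assumes f [measurable]: "f \<in> borel_measurable borel" and \<phi>: "\<And>n. is_step (\<phi> n)"
    and fast: "(\<Sum>n. 4 ^ n * approx_dist (\<lambda>s. step_fun (\<phi> n) s - f s)) < \<infinity>"
    and \<psi>: "\<And>n. is_step (\<psi> n)" and lim: "(\<lambda>n. approx_dist (\<lambda>s. step_fun (\<psi> n) s - f s)) \<longlonglongrightarrow> 0"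
  shows "tendsto_locally_in_measure (scrW W1 W3) (\<lambda>n. step_integral (\<psi> n)) (\<lambda>X. lim (\<lambda>n. step_integral (\<phi> n) X))"
  unfolding tendsto_locally_in_measure_def
proof (intro allI impI ballI)
  fix \<epsilon> :: real and A assume \<epsilon>: "0 < \<epsilon>" and "A \<in> sets (scrW W1 W3)" and finA: "emeasure (scrW W1 W3) A < \<infinity>"
  then have A [measurable]: "A \<in> sets (path_space {0..})" by (simp add: sets_scrW)
  let ?L = "restrict_space lborel {0<..} :: real measure"
  let ?Z = "\<lambda>X. lim (\<lambda>n. step_integral (\<phi> n) X)"
  have [measurable]: "step_integral (\<psi> n) \<in> borel_measurable (path_space {0..})" "step_integral (\<phi> n) \<in> borel_measurable (path_space {0..})" for n
    using \<phi> \<psi> by (auto intro: measurable_step_integral)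
  have [measurable]: "?Z \<in> borel_measurable (path_space {0..})" by (intro borel_measurable_lim_metric) measurable
  define E where "E n = {X \<in> space (path_space {0..}). \<epsilon> \<le> \<bar>step_integral (\<psi> n) X - ?Z X\<bar>}" for n
  have [measurable]: "E n \<in> sets (path_space {0..})" for n unfolding E_def by measurable
  define g where "g n s = step_fun (\<psi> n) s - f s" for n s
  have [measurable]: "g n \<in> borel_measurable borel" for n unfolding g_def by measurable
  define b where "b n u = ennreal (limit_const \<epsilon>) * (2 * sq_norm {0..} (g n) + wt_norm (\<lambda>s. 1 / sqrt s) (\<lambda>s. g n (s + u)))" for n u
  have wm [measurable]: "(\<lambda>u. wt_norm (\<lambda>s. 1 / sqrt s) (\<lambda>s. g n (s + u))) \<in> borel_measurable borel" for n
    by (rule wt_norm_shift_measurable) measurable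
  have bm [measurable]: "b n \<in> borel_measurable borel" for n unfolding b_def by measurable
  have conv: "AE u in lborel. 0 \<le> u \<longrightarrow> (\<Sum>n. 4 ^ n * wt_norm (\<lambda>s. 1 / sqrt s) (\<lambda>s. step_fun (\<phi> n) (s + u) - f (s + u))) < \<infinity>"
  proof (rule AE_wt_norm_shift_finite)
    show "(\<Sum>n. 4 ^ n * wt_norm (\<lambda>s. 1 / (1 + sqrt s)) (\<lambda>s. step_fun (\<phi> n) s - f s)) < \<infinity>"
      by (rule le_less_trans[OF _ fast]) (intro suminf_le mult_left_mono, auto simp: approx_dist_def)
  qed measurable
  have fast2: "(\<Sum>n. 4 ^ n * sq_norm {0..} (\<lambda>s. step_fun (\<phi> n) s - f s)) < \<infinity>"
    by (rule le_less_trans[OF _ fast]) (intro suminf_le mult_left_mono, auto simp: approx_dist_def)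
  have "(\<lambda>n. \<integral>\<^sup>+u. ennreal (1 / sqrt (2 * pi * u)) * emeasure (K u) (A \<inter> E n) \<partial>?L) \<longlonglongrightarrow> 0"
  \<comment> \<open>With \<open>h\<close> the mass of \<open>A\<close> under \<open>K u\<close>,
    integrability of \<open>h\<close> against the density says exactly that \<open>A\<close> has
    finite \<open>scrW\<close>-measure.\<close>
  proof (rule tendsto_0_nn_integral_change_weight[where b = b and h = "\<lambda>u. emeasure (K u) A" and w = "\<lambda>u. ennreal (shift_weight u)"])
    show "b n \<in> borel_measurable ?L" for n by (rule measurable_restrict_space1) measurable
    show "(\<lambda>u. ennreal (shift_weight u)) \<in> borel_measurable ?L" by (rule measurable_restrict_space1) measurable
    show "emeasure (K u) (A \<inter> E n) \<le> emeasure (K u) A" for n u by (rule emeasure_mono) auto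
    show "AE u in ?L. emeasure (K u) (A \<inter> E n) \<le> b n u" for n
    proof (subst AE_restrict_space_iff)
      show "AE u in lborel. u \<in> {0<..} \<longrightarrow> emeasure (K u) (A \<inter> E n) \<le> b n u"
        using conv
      proof eventually_elim
        case (elim u)
        show ?case
        proof
          assume "u \<in> {0<..}"
          then have u: "0 < u" by simp
          have "emeasure (K u) (A \<inter> E n) \<le> emeasure (K u) {X \<in> space (K u). \<epsilon> \<le> \<bar>step_integral (\<psi> n) X - ?Z X\<bar>}"
            by (rule emeasure_mono) (auto simp: E_def)
          also have "\<dots> \<le> b n u"
            unfolding b_def g_def using elim u by (intro emeasure_K_limit[OF f \<phi> fast2 u _ \<psi> \<epsilon>]) simp
          finally show "emeasure (K u) (A \<inter> E n) \<le> b n u" .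
        qed
      qed
    qed simp
    show "(\<integral>\<^sup>+u. ennreal (1 / sqrt (2 * pi * u)) * emeasure (K u) A \<partial>?L) < \<infinity>"
      using finA by (simp add: emeasure_scrW[OF A])
    show "(\<lambda>n. \<integral>\<^sup>+u. ennreal (shift_weight u) * b n u \<partial>?L) \<longlonglongrightarrow> 0"
    proof (rule tendsto_0_ennreal_le)
      define k where "k = (\<integral>\<^sup>+u. ennreal (shift_weight u) * indicator {0..} u \<partial>lborel)"
      have "(\<integral>\<^sup>+u. ennreal (shift_weight u) * b n u \<partial>?L) \<le> ennreal (limit_const \<epsilon>) * (2 * k + 3) * approx_dist (g n)" for n
      proof -
        have "(\<integral>\<^sup>+u. ennreal (shift_weight u) * b n u \<partial>?L) = (\<integral>\<^sup>+u. ennreal (shift_weight u) * b n u * indicator {0<..} u \<partial>lborel)"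
          by (simp add: nn_integral_restrict_space)
        also have "\<dots> \<le> (\<integral>\<^sup>+u. ennreal (limit_const \<epsilon>) * (2 * sq_norm {0..} (g n) * (ennreal (shift_weight u) * indicator {0..} u) +
            ennreal (shift_weight u) * wt_norm (\<lambda>s. 1 / sqrt s) (\<lambda>s. g n (s + u)) * indicator {0..} u) \<partial>lborel)"
          by (intro nn_integral_mono) (auto simp: b_def indicator_def distrib_left mult_ac)
        also have "\<dots> = ennreal (limit_const \<epsilon>) * (2 * sq_norm {0..} (g n) * k +
            (\<integral>\<^sup>+u\<in>{0..}. ennreal (shift_weight u) * wt_norm (\<lambda>s. 1 / sqrt s) (\<lambda>s. g n (s + u)) \<partial>lborel))"
          by (simp add: nn_integral_add nn_integral_cmult k_def)
        also have "\<dots> \<le> ennreal (limit_const \<epsilon>) * (2 * approx_dist (g n) * k + 3 * approx_dist (g n))"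
        proof (intro mult_left_mono add_mono mult_right_mono)
          show "(\<integral>\<^sup>+u\<in>{0..}. ennreal (shift_weight u) * wt_norm (\<lambda>s. 1 / sqrt s) (\<lambda>s. g n (s + u)) \<partial>lborel) \<le> 3 * approx_dist (g n)"
            by (rule order_trans[OF nn_integral_weight_shift]) (measurable, simp add: approx_dist_def mult_left_mono)
        qed (auto simp: approx_dist_def)
        finally show ?thesis by (simp add: algebra_simps)
      qed
      then show "(\<integral>\<^sup>+u. ennreal (shift_weight u) * b n u \<partial>?L) \<le> ennreal (limit_const \<epsilon>) * (2 * k + 3) * approx_dist (g n)" for n .
      have "ennreal (limit_const \<epsilon>) * (2 * k + 3) < \<infinity>"
        using nn_integral_shift_weight_finite by (simp add: k_def ennreal_mult_less_top)
      then show "(\<lambda>n. ennreal (limit_const \<epsilon>) * (2 * k + 3) * approx_dist (g n)) \<longlonglongrightarrow> 0"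
        using lim by (intro tendsto_0_cmult_ennreal) (simp_all add: g_def[abs_def])
    qed
    show "0 < ennreal (shift_weight u)" if "u \<in> space ?L" for u
      using that shift_weight_pos[of u] by (simp add: space_restrict_space)
  qed (simp_all add: density_measurable emeasure_K_measurable)
  moreover have "A \<inter> {X \<in> space (scrW W1 W3). \<epsilon> \<le> \<bar>step_integral (\<psi> n) X - ?Z X\<bar>} = A \<inter> E n" for n
    by (simp add: E_def space_scrW)
  ultimately show "(\<lambda>n. emeasure (scrW W1 W3) (A \<inter> {X \<in> space (scrW W1 W3). \<epsilon> \<le> \<bar>step_integral (\<psi> n) X - ?Z X\<bar>})) \<longlonglongrightarrow> 0"
    by (simp add: emeasure_scrW)
qed

text \<open>Local convergence in measure determines the limit on each \<open>cover m\<close>, a set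
  of finite measure, and these sets exhaust almost every path.\<close>

lemma tendsto_locally_AE_eq:
  assumes [measurable]: "\<And>n. F n \<in> borel_measurable (scrW W1 W3)" "Z \<in> borel_measurable (scrW W1 W3)" "Z' \<in> borel_measurable (scrW W1 W3)"
    and "tendsto_locally_in_measure (scrW W1 W3) F Z" "tendsto_locally_in_measure (scrW W1 W3) F Z'"
  shows "AE X in scrW W1 W3. Z X = Z' X"
proof -
  have "AE X in scrW W1 W3. X \<in> cover m \<longrightarrow> Z X = Z' X" for m
    using assms(4,5) emeasure_scrW_cover[of m] cover_sets[of m]
    by (intro AE_eq_of_tendsto_in_measure[where F = F]) (auto simp: tendsto_locally_in_measure_def sets_scrW)
  then have "AE X in scrW W1 W3. \<forall>m. X \<in> cover m \<longrightarrow> Z X = Z' X"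
    by (intro AE_all_countable[THEN iffD2] allI)
  with AE_scrW_cover show ?thesis by eventually_elim blast
qed

lemma ex_fast_steps:
  assumes [measurable]: "f \<in> borel_measurable borel" and "approx_dist f < \<infinity>"
  obtains \<phi> where "\<And>n. is_step (\<phi> n)" "(\<Sum>n. 4 ^ n * approx_dist (\<lambda>s. step_fun (\<phi> n) s - f s)) < \<infinity>"
proof -
  \<comment> \<open>The rate \<open>(1 / 8) ^ n\<close> leaves \<open>(1 / 2) ^ n\<close> after
    multiplication by the weight \<open>4 ^ n\<close>.\<close>
  have "\<exists>\<phi>. is_step \<phi> \<and> approx_dist (\<lambda>s. step_fun \<phi> s - f s) < ennreal ((1 / 8) ^ n)" for n :: nat
    by (rule approx_dist_step[OF assms]) simp
  then obtain \<phi> where \<phi>: "\<And>n. is_step (\<phi> n)" "\<And>n. approx_dist (\<lambda>s. step_fun (\<phi> n) s - f s) < ennreal ((1 / 8) ^ n)"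
    by metis
  have "(\<Sum>n. 4 ^ n * approx_dist (\<lambda>s. step_fun (\<phi> n) s - f s)) \<le> (\<Sum>n. ennreal ((1 / 2) ^ n))"
  proof (intro suminf_le)
    fix n :: nat
    have "4 ^ n * approx_dist (\<lambda>s. step_fun (\<phi> n) s - f s) \<le> ennreal (4 ^ n) * ennreal ((1 / 8) ^ n)"
      using \<phi>(2)[of n] by (intro mult_mono) (auto simp: ennreal_power[symmetric] less_imp_le)
    also have "\<dots> = ennreal ((1 / 2) ^ n)"
      by (simp add: ennreal_mult[symmetric] power_mult_distrib[symmetric])
    finally show "4 ^ n * approx_dist (\<lambda>s. step_fun (\<phi> n) s - f s) \<le> ennreal ((1 / 2) ^ n)" .
  qed auto
  also have "\<dots> = ennreal (\<Sum>n. (1 / 2) ^ n)"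
    by (rule suminf_ennreal2) (auto intro: summable_geometric)
  also have "\<dots> < \<infinity>" by simp
  finally show thesis using \<phi>(1) by (intro that)
qed

text \<open>One fast sequence serves under \<open>scrW\<close> and under \<open>K u\<close> for
  almost every \<open>u\<close> at once, so its pointwise limit is a common version of both sides,
  with no choice depending on \<open>u\<close>.\<close>

lemma ex_common_version_borel:
  assumes f: "f \<in> borel_measurable borel" and fin: "approx_dist f < \<infinity>"
  shows "\<exists>Z. Z \<in> borel_measurable (path_space {0..}) \<and>
    (AE X in scrW W1 W3. wiener_integral_scrW (scrW W1 W3) f X = Z X) \<and>
    (AE u in lborel. 0 < u \<longrightarrow> (AE X in K u. Z X = wiener_integral_bridge (Br u) u f (restrict X {0..u})
      + wiener_integral_bessel R (\<lambda>s. f (s + u)) (shift_path u X)))"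
proof -
  obtain \<phi> where \<phi>: "\<And>n. is_step (\<phi> n)" and fast: "(\<Sum>n. 4 ^ n * approx_dist (\<lambda>s. step_fun (\<phi> n) s - f s)) < \<infinity>"
    using ex_fast_steps[OF f fin] by blast
  define Z where "Z X = lim (\<lambda>n. step_integral (\<phi> n) X)" for X
  have sm: "step_integral \<rho> \<in> borel_measurable (path_space {0..})" if "is_step \<rho>" for \<rho>
    using that by (rule measurable_step_integral)
  have Zm: "Z \<in> borel_measurable (path_space {0..})"
    unfolding Z_def using sm[OF \<phi>] by (intro borel_measurable_lim_metric)
  have W_cong: "borel_measurable (scrW W1 W3) = borel_measurable (path_space {0..})"
    by (rule measurable_cong_sets[OF sets_scrW refl])
  define Q where "Q Z \<longleftrightarrow> Z \<in> borel_measurable (scrW W1 W3) \<and>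
    (\<forall>\<phi>. (\<forall>n. is_step (\<phi> n)) \<and>
          L2_tendsto {0..} (\<lambda>n. step_fun (\<phi> n)) f \<and>
          L1_weighted_tendsto (\<lambda>s. 1 / (1 + sqrt s)) (\<lambda>n. step_fun (\<phi> n)) f \<longrightarrow>
        tendsto_locally_in_measure (scrW W1 W3) (\<lambda>n. step_integral (\<phi> n)) Z)" for Z
  have ex: "Q Z"
    unfolding Q_def
  proof (intro conjI allI impI)
    show "Z \<in> borel_measurable (scrW W1 W3)" using Zm by (simp add: W_cong)
    fix \<psi> :: "nat \<Rightarrow> step_data"
    assume "(\<forall>n. is_step (\<psi> n)) \<and> L2_tendsto {0..} (\<lambda>n. step_fun (\<psi> n)) f \<and>
          L1_weighted_tendsto (\<lambda>s. 1 / (1 + sqrt s)) (\<lambda>n. step_fun (\<psi> n)) f"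
    then have \<psi>: "\<And>n. is_step (\<psi> n)" and lim: "(\<lambda>n. sq_norm {0..} (\<lambda>s. step_fun (\<psi> n) s - f s)) \<longlonglongrightarrow> 0"
      "(\<lambda>n. wt_norm (\<lambda>s. 1 / (1 + sqrt s)) (\<lambda>s. step_fun (\<psi> n) s - f s)) \<longlonglongrightarrow> 0"
      by (auto simp: L2_tendsto_iff_sq_norm L1_weighted_tendsto_iff_wt_norm)
    have "(\<lambda>n. approx_dist (\<lambda>s. step_fun (\<psi> n) s - f s)) \<longlonglongrightarrow> 0"
      unfolding approx_dist_def using tendsto_add[OF lim] by simp
    then show "tendsto_locally_in_measure (scrW W1 W3) (\<lambda>n. step_integral (\<psi> n)) Z"
      unfolding Z_def by (rule scrW_local_limit[OF f \<phi> fast \<psi>])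
  qed
  have WI: "Q (wiener_integral_scrW (scrW W1 W3) f)"
    unfolding wiener_integral_scrW_def Q_def[symmetric] by (rule someI[where P = Q, OF ex])
  have fast0: "(\<lambda>n. approx_dist (\<lambda>s. step_fun (\<phi> n) s - f s)) \<longlonglongrightarrow> 0"
    by (rule tendsto_0_ennreal_le[OF suminf_ennreal_tendsto_0[OF fast]])
      (metis mult_right_mono one_le_power mult_1 zero_le one_le_numeral)
  have "L2_tendsto {0..} (\<lambda>n. step_fun (\<phi> n)) f"
    unfolding L2_tendsto_iff_sq_norm by (rule tendsto_0_ennreal_le[OF fast0]) (simp add: approx_dist_def)
  moreover have "L1_weighted_tendsto (\<lambda>s. 1 / (1 + sqrt s)) (\<lambda>n. step_fun (\<phi> n)) f"
    unfolding L1_weighted_tendsto_iff_wt_norm by (rule tendsto_0_ennreal_le[OF fast0]) (simp add: approx_dist_def)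
  ultimately have conv: "tendsto_locally_in_measure (scrW W1 W3) (\<lambda>n. step_integral (\<phi> n)) Y" if "Q Y" for Y
    using that \<phi> unfolding Q_def by blast
  have 1: "AE X in scrW W1 W3. wiener_integral_scrW (scrW W1 W3) f X = Z X"
  proof (rule tendsto_locally_AE_eq[OF _ _ _ conv[OF WI] conv[OF ex]])
    show "step_integral (\<phi> n) \<in> borel_measurable (scrW W1 W3)" for n using sm[OF \<phi>] by (simp add: W_cong)
    show "wiener_integral_scrW (scrW W1 W3) f \<in> borel_measurable (scrW W1 W3)" using WI by (simp add: Q_def)
    show "Z \<in> borel_measurable (scrW W1 W3)" using ex by (simp add: Q_def)
  qed
  have fast2: "(\<Sum>n. 4 ^ n * sq_norm {0..} (\<lambda>s. step_fun (\<phi> n) s - f s)) < \<infinity>"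
    by (rule le_less_trans[OF _ fast]) (intro suminf_le mult_left_mono, auto simp: approx_dist_def)
  have "AE u in lborel. 0 \<le> u \<longrightarrow> (\<Sum>n. 4 ^ n * wt_norm (\<lambda>s. 1 / sqrt s) (\<lambda>s. step_fun (\<phi> n) (s + u) - f (s + u))) < \<infinity>"
  proof (rule AE_wt_norm_shift_finite)
    show "(\<lambda>s. step_fun (\<phi> n) s - f s) \<in> borel_measurable borel" for n using f by measurable
    show "(\<Sum>n. 4 ^ n * wt_norm (\<lambda>s. 1 / (1 + sqrt s)) (\<lambda>s. step_fun (\<phi> n) s - f s)) < \<infinity>"
      by (rule le_less_trans[OF _ fast]) (intro suminf_le mult_left_mono, auto simp: approx_dist_def)
  qed
  then have 2: "AE u in lborel. 0 < u \<longrightarrow> (AE X in K u. Z X = wiener_integral_bridge (Br u) u f (restrict X {0..u})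
      + wiener_integral_bessel R (\<lambda>s. f (s + u)) (shift_path u X))"
  proof eventually_elim
    case (elim u)
    show ?case
    proof
      assume u: "0 < u"
      then have "(\<Sum>n. 4 ^ n * wt_norm (\<lambda>s. 1 / sqrt s) (\<lambda>s. step_fun (\<phi> n) (s + u) - f (s + u))) < \<infinity>" using elim by simp
      from AE_K_convergent[OF f \<phi> fast2 u this]
      show "AE X in K u. Z X = wiener_integral_bridge (Br u) u f (restrict X {0..u})
        + wiener_integral_bessel R (\<lambda>s. f (s + u)) (shift_path u X)"
        by eventually_elim (simp add: Z_def limI)
    qed
  qed
  show ?thesis using Zm 1 2 by blast
qed

end

section \<open>Replacing the integrand by a Borel function\<close>

lemma wiener_integral_scrW_cong:
  assumes "AE s in lborel. 0 \<le> s \<longrightarrow> f s = g s"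
  shows "wiener_integral_scrW M f = wiener_integral_scrW M g"
proof -
  have "sq_norm {0..} (\<lambda>s. h s - f s) = sq_norm {0..} (\<lambda>s. h s - g s)" for h
    unfolding sq_norm_def
    by (rule nn_integral_cong_AE) (use assms in \<open>eventually_elim, auto simp: indicator_def\<close>)
  moreover have "wt_norm w (\<lambda>s. h s - f s) = wt_norm w (\<lambda>s. h s - g s)" for h w
    unfolding wt_norm_def
    by (rule nn_integral_cong_AE) (use assms in \<open>eventually_elim, auto simp: indicator_def\<close>)
  \<comment> \<open>The properties under \<open>SOME\<close> coincide, so the chosen functions are
    equal, not merely almost everywhere equal.\<close>
  ultimately show ?thesis
    unfolding wiener_integral_scrW_def L2_tendsto_iff_sq_norm L1_weighted_tendsto_iff_wt_norm by simp
qed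

lemma wiener_integral_bridge_cong:
  assumes "AE s in lborel. 0 \<le> s \<longrightarrow> f s = g s"
  shows "wiener_integral_bridge M u f = wiener_integral_bridge M u g"
proof -
  have "sq_norm {0..u} (\<lambda>s. h s - f s) = sq_norm {0..u} (\<lambda>s. h s - g s)" for h
    unfolding sq_norm_def
    by (rule nn_integral_cong_AE) (use assms in \<open>eventually_elim, auto simp: indicator_def\<close>)
  then show ?thesis
    unfolding wiener_integral_bridge_def L2_tendsto_iff_sq_norm by simp
qed

lemma wiener_integral_bessel_cong:
  assumes "AE s in lborel. 0 \<le> s \<longrightarrow> f s = g s"
  shows "wiener_integral_bessel M f = wiener_integral_bessel M g"
proof -
  have "sq_norm {0..} (\<lambda>s. h s - f s) = sq_norm {0..} (\<lambda>s. h s - g s)" for h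
    unfolding sq_norm_def
    by (rule nn_integral_cong_AE) (use assms in \<open>eventually_elim, auto simp: indicator_def\<close>)
  moreover have "wt_norm w (\<lambda>s. h s - f s) = wt_norm w (\<lambda>s. h s - g s)" for h w
    unfolding wt_norm_def
    by (rule nn_integral_cong_AE) (use assms in \<open>eventually_elim, auto simp: indicator_def\<close>)
  ultimately show ?thesis
    unfolding wiener_integral_bessel_def L2_tendsto_iff_sq_norm L1_weighted_tendsto_iff_wt_norm by simp
qed

lemma AE_lborel_shift:
  assumes "AE s in lborel. P (s :: real)"
  shows "AE s in lborel. P (s + u)"
proof -
  have "AE s in distr lborel borel ((+) u). P s" using assms by (simp only: lborel_distr_plus)
  then have "AE s in lborel. P (u + s)" by (rule AE_distrD[rotated]) measurable
  then show ?thesis by (simp only: add.commute)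
qed

lemma wt_norm_cong_AE:
  assumes "AE s in lborel. 0 \<le> s \<longrightarrow> f s = g s"
  shows "wt_norm w f = wt_norm w g"
  unfolding wt_norm_def
  by (rule nn_integral_cong_AE) (use assms in \<open>eventually_elim, auto simp: indicator_def\<close>)

theorem theorem1p3:
  fixes W1 :: "(real \<Rightarrow> real) measure"
    and W3 :: "(real \<Rightarrow> real ^ 3) measure"
    and f :: "real \<Rightarrow> real"
  assumes "wiener_law W1" and "wiener_law W3"
    and "f \<in> L2 {0..} \<inter> L1_weighted (\<lambda>s. 1 / (1 + sqrt s))"
  shows "(AE u in lebesgue. 0 \<le> u \<longrightarrow> (\<lambda>s. f (s + u)) \<in> L1_weighted (\<lambda>s. 1 / sqrt s)) \<and>
    (\<exists>I :: real \<Rightarrow> (real \<Rightarrow> real) \<Rightarrow> real.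
       (\<lambda>(u, X). I u X) \<in> borel_measurable (restrict_space borel {0..} \<Otimes>\<^sub>M path_space {0..}) \<and>
       (AE X in scrW W1 W3.
          wiener_integral_scrW (scrW W1 W3) f X = I (last_zero X) X) \<and>
       (AE u in lebesgue. 0 \<le> u \<longrightarrow>
          (AE X in concat_law u (brownian_bridge W1 u) (sym_bessel3 W3).
             I u X = wiener_integral_bridge (brownian_bridge W1 u) u f (restrict X {0..u})
                   + wiener_integral_bessel (sym_bessel3 W3) (\<lambda>s. f (s + u)) (shift_path u X))))"
proof -
  interpret bridge_bessel W1 W3 by unfold_locales (fact assms)+
  have m: "(\<lambda>s. indicator {0..} s *\<^sub>R f s) \<in> borel_measurable lebesgue"
    and fin: "(\<integral>\<^sup>+s\<in>{0..}. ennreal ((f s)\<^sup>2) \<partial>lebesgue) < \<infinity>"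
      "(\<integral>\<^sup>+s\<in>{0..}. ennreal (\<bar>f s\<bar> * (1 / (1 + sqrt s))) \<partial>lebesgue) < \<infinity>"
    using assms(3) by (auto simp: L2_def L1_weighted_def set_borel_measurable_def)
  \<comment> \<open>\<open>f\<close> is only Lebesgue measurable on \<open>{0..}\<close> and
    arbitrary elsewhere; \<open>g\<close> is a Borel version of its extension by 0.\<close>
  obtain g where g [measurable]: "g \<in> borel_measurable borel" and fg: "AE s in lborel. indicator {0..} s *\<^sub>R f s = g s"
    using completion_ex_borel_measurable_real[OF m] by auto
  have ae: "AE s in lborel. 0 \<le> s \<longrightarrow> f s = g s" using fg by eventually_elim auto
  have ae_shift: "AE s in lborel. 0 \<le> s \<longrightarrow> f (s + u) = g (s + u)" if "0 \<le> u" for u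
    using AE_lborel_shift[OF ae, of u] by eventually_elim (use that in simp)
  have "sq_norm {0..} g = sq_norm {0..} f"
    unfolding sq_norm_def
    by (rule nn_integral_cong_AE) (use ae in \<open>eventually_elim, auto simp: indicator_def\<close>)
  moreover have "wt_norm (\<lambda>s. 1 / (1 + sqrt s)) g = wt_norm (\<lambda>s. 1 / (1 + sqrt s)) f"
    by (rule wt_norm_cong_AE[OF ae, symmetric])
  ultimately have wng: "wt_norm (\<lambda>s. 1 / (1 + sqrt s)) g < \<infinity>" and fing: "approx_dist g < \<infinity>"
    using fin by (auto simp: approx_dist_def sq_norm_def wt_norm_def nn_integral_completion)
  \<comment> \<open>The integrability claim is obtained from the series lemma
    \<open>AE_wt_norm_shift_finite\<close> applied to a series with one nonzero term.\<close>
  have single: "(\<Sum>n :: nat. (if n = 0 then 1 else 0) * x) = x" for x :: ennreal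
    by (subst suminf_finite[of "{0}"]) auto
  have "AE u in lborel. 0 \<le> u \<longrightarrow> (\<Sum>n :: nat. (if n = 0 then 1 else 0) * wt_norm (\<lambda>s. 1 / sqrt s) (\<lambda>s. g (s + u))) < \<infinity>"
    by (rule AE_wt_norm_shift_finite) (use wng in \<open>simp_all only: single g\<close>)
  then have "AE u in lborel. 0 \<le> u \<longrightarrow> wt_norm (\<lambda>s. 1 / sqrt s) (\<lambda>s. g (s + u)) < \<infinity>"
    by (simp only: single)
  then have "AE u in lborel. 0 \<le> u \<longrightarrow> (\<lambda>s. f (s + u)) \<in> L1_weighted (\<lambda>s. 1 / sqrt s)"
  proof eventually_elim
    case (elim u)
    show ?case
    proof
      assume u: "0 \<le> u"
      have "wt_norm (\<lambda>s. 1 / sqrt s) (\<lambda>s. f (s + u)) < \<infinity>"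
        using elim u by (simp add: wt_norm_cong_AE[OF ae_shift[OF u]])
      moreover have "set_borel_measurable lebesgue {0..} (\<lambda>s. f (s + u))"
        unfolding set_borel_measurable_def
      proof (rule borel_measurable_AE)
        show "(\<lambda>s. indicator {0..} s *\<^sub>R g (s + u)) \<in> borel_measurable lebesgue"
          by (rule measurable_completion) measurable
        show "AE s in lebesgue. indicator {0..} s *\<^sub>R g (s + u) = indicator {0..} s *\<^sub>R f (s + u)"
          by (rule AE_completion) (use ae_shift[OF u] in \<open>eventually_elim, auto simp: indicator_def\<close>)
      qed
      ultimately show "(\<lambda>s. f (s + u)) \<in> L1_weighted (\<lambda>s. 1 / sqrt s)"
        by (simp add: L1_weighted_def wt_norm_def nn_integral_completion)
    qed
  qed
  then have 1: "AE u in lebesgue. 0 \<le> u \<longrightarrow> (\<lambda>s. f (s + u)) \<in> L1_weighted (\<lambda>s. 1 / sqrt s)"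
    by (rule AE_completion)
  obtain Z where Z: "Z \<in> borel_measurable (path_space {0..})"
    and Zs: "AE X in scrW W1 W3. wiener_integral_scrW (scrW W1 W3) g X = Z X"
    and Zu: "AE u in lborel. 0 < u \<longrightarrow> (AE X in K u. Z X = wiener_integral_bridge (Br u) u g (restrict X {0..u})
      + wiener_integral_bessel R (\<lambda>s. g (s + u)) (shift_path u X))"
    using ex_common_version_borel[OF g fing] by blast
  have "AE u in lborel. 0 \<le> u \<longrightarrow> (AE X in K u. Z X = wiener_integral_bridge (Br u) u f (restrict X {0..u})
      + wiener_integral_bessel R (\<lambda>s. f (s + u)) (shift_path u X))"
    \<comment> \<open>The case \<open>u = 0\<close> is discarded as a null set.\<close>
    using Zu AE_lborel_singleton[of 0]
  proof eventually_elim
    case (elim u)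
    then show ?case
      using wiener_integral_bridge_cong[OF ae] wiener_integral_bessel_cong[OF ae_shift] by auto
  qed
  then have 2: "AE u in lebesgue. 0 \<le> u \<longrightarrow> (AE X in K u. Z X = wiener_integral_bridge (Br u) u f (restrict X {0..u})
      + wiener_integral_bessel R (\<lambda>s. f (s + u)) (shift_path u X))"
    by (rule AE_completion)
  have "(\<lambda>(u, X). Z X) \<in> borel_measurable (restrict_space borel {0..} \<Otimes>\<^sub>M path_space {0..})"
    using measurable_compose[OF measurable_snd Z] by (simp add: case_prod_beta')
  moreover have "AE X in scrW W1 W3. wiener_integral_scrW (scrW W1 W3) f X = Z X"
    using Zs by (simp only: wiener_integral_scrW_cong[OF ae])
  ultimately show ?thesis using 1 2 by (intro conjI exI[of _ "\<lambda>u. Z"])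
qed

end
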